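(* Let $g,h:\mathbb{R}\to\mathbb{R}$ be locally Lipschitz continuous functions satisfying condition $(C_0)$ and at least one of the four conditions $(h_-)$, $(h_+)$, $(g_-)$, $(g_+)$ described in the context. Let $a$, $T$, $T_1$ and $a_{\lambda,\mu}$ be as in the context, and consider the system $$x'=h(y),\qquad y'=-a_{\lambda,\mu}(t)\,g(x).$$ Let $m\ge2$ be a fixed integer. Then, for each positive integer $k$, there exists $\Lambda_k>0$ such that for each $\lambda>\Lambda_k$ there exists $\mu^*=\mu^*(\lambda)$ such that for each $\mu>\mu^*$ the following holds: there exist two families of pairwise disjoint nonempty compact sets $S^{(1)}_1,\dots,S^{(1)}_{2k}$ contained in the closed first quadrant minus the origin and $S^{(2)}_1,\dots,S^{(2)}_{2k}$ contained in the closed third quadrant minus the origin, such that for every two-sided sequence $(\xi_n)_{n\in\mathbb{Z}}$ with $\xi_n\in\{1,\dots,2k\}$ for all $n$ and having minimal period $m$, the system has at least two periodic solutions $u_1,u_2$ of minimal period $mT$, not belonging to the same periodicity class, with $u_i(nT)\in S^{(i)}_{\xi_n}$ for all $n\in\mathbb{Z}$ and $i=1,2$.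
   Context: Condition $(C_0)$: $h(0)=0$ and $h(y)y>0$ for all $y\neq0$; $g(0)=0$ and $g(x)x>0$ for all $x\neq0$; $h_0:=\liminf_{|y|\to0} h(y)/y>0$ and $g_0:=\liminf_{|x|\to0} g(x)/x>0$. Conditions: $(h_-)$: $h$ is bounded on $\mathbb{R}^-$; $(h_+)$: $h$ is bounded on $\mathbb{R}^+$; $(g_-)$: $g$ is bounded on $\mathbb{R}^-$; $(g_+)$: $g$ is bounded on $\mathbb{R}^+$. The function $a:\mathbb{R}\to\mathbb{R}$ is continuous, $T$-periodic and sign-changing, and there is $T_1\in\,]0,T[$ such that $a\succ0$ on $[0,T_1]$ and $a\prec0$ on $[T_1,T]$, where $a\succ0$ on an interval $I$ means $a(t)\ge0$ for a.e. $t\in I$ and $a>0$ on a subset of $I$ of positive measure, and $a\prec0$ means $-a\succ0$. For $\lambda,\mu>0$, $a_{\lambda,\mu}(t):=\lambda a^+(t)-\mu a^-(t)$, where $a^+=(a+|a|)/2$ and $a^-=a^+-a$. Two $mT$-periodic solutions belong to the same periodicity class if one is obtained from the other by a time shift $t\mapsto t-iT$ with $i\in\{1,\dots,m-1\}$. Global continuability of solutions is not assumed. *)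

theory Defs
  imports "HOL-Analysis.Analysis"
begin

definition loc_lipschitz :: "(real \<Rightarrow> real) \<Rightarrow> bool" where
  "loc_lipschitz f \<longleftrightarrow> (\<forall>x. \<exists>U L. open U \<and> x \<in> U \<and> L-lipschitz_on U f)"

definition cond_C0 :: "(real \<Rightarrow> real) \<Rightarrow> bool" where
  "cond_C0 f \<longleftrightarrow> f 0 = 0 \<and> (\<forall>x. x \<noteq> 0 \<longrightarrow> f x * x > 0)
     \<and> Liminf (at (0::real)) (\<lambda>x. ereal (f x / x)) > 0"

definition succ0_on :: "(real \<Rightarrow> real) \<Rightarrow> real set \<Rightarrow> bool" where
  "succ0_on a I \<longleftrightarrow> (AE t in lebesgue. t \<in> I \<longrightarrow> a t \<ge> 0)
     \<and> (\<exists>S. S \<subseteq> I \<and> S \<in> sets lebesgue \<and> emeasure lebesgue S > 0 \<and> (\<forall>t\<in>S. a t > 0))"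

definition prec0_on :: "(real \<Rightarrow> real) \<Rightarrow> real set \<Rightarrow> bool" where
  "prec0_on a I \<longleftrightarrow> succ0_on (\<lambda>t. - a t) I"

definition pos_part :: "(real \<Rightarrow> real) \<Rightarrow> real \<Rightarrow> real" where
  "pos_part a t = (a t + \<bar>a t\<bar>) / 2"

definition neg_part :: "(real \<Rightarrow> real) \<Rightarrow> real \<Rightarrow> real" where
  "neg_part a t = pos_part a t - a t"

definition a_lm :: "(real \<Rightarrow> real) \<Rightarrow> real \<Rightarrow> real \<Rightarrow> real \<Rightarrow> real" where
  "a_lm a la mu t = la * pos_part a t - mu * neg_part a t"

definition is_solution ::
  "(real \<Rightarrow> real) \<Rightarrow> (real \<Rightarrow> real) \<Rightarrow> (real \<Rightarrow> real) \<Rightarrow> (real \<Rightarrow> real \<times> real) \<Rightarrow> bool" where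
  "is_solution h g w u \<longleftrightarrow>
     (\<forall>t. (u has_vector_derivative (h (snd (u t)), - w t * g (fst (u t)))) (at t))"

definition minimal_period :: "(real \<Rightarrow> 'b) \<Rightarrow> real \<Rightarrow> bool" where
  "minimal_period u p \<longleftrightarrow> p > 0 \<and> (\<forall>t. u (t + p) = u t)
     \<and> (\<forall>q. 0 < q \<and> q < p \<longrightarrow> \<not> (\<forall>t. u (t + q) = u t))"

definition seq_minimal_period :: "(int \<Rightarrow> 'b) \<Rightarrow> nat \<Rightarrow> bool" where
  "seq_minimal_period \<xi> m \<longleftrightarrow> m > 0 \<and> (\<forall>n. \<xi> (n + int m) = \<xi> n)
     \<and> (\<forall>p. 0 < p \<and> p < m \<longrightarrow> \<not> (\<forall>n. \<xi> (n + int p) = \<xi> n))"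

definition same_periodicity_class ::
  "real \<Rightarrow> nat \<Rightarrow> (real \<Rightarrow> real \<times> real) \<Rightarrow> (real \<Rightarrow> real \<times> real) \<Rightarrow> bool" where
  "same_periodicity_class T m u v \<longleftrightarrow>
     (\<exists>i\<in>{1..m-1}. \<forall>t. v t = u (t - real i * T))"

definition quad1 :: "(real \<times> real) set" where
  "quad1 = {(x, y). x \<ge> 0 \<and> y \<ge> 0} - {(0, 0)}"

definition quad3 :: "(real \<times> real) set" where
  "quad3 = {(x, y). x \<le> 0 \<and> y \<le> 0} - {(0, 0)}"

end

theory Submission
  imports Defs
begin

text \<open>On \<open>[0, T1]\<close> orbits rotate clockwise: fast near the origin once \<open>lam\<close> is large, while the
  bounded nonlinearity makes one of the quadrants too slow to be crossed at large amplitude. A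
  radial segment of the first quadrant is therefore stretched into a spiral with many turns. On
  \<open>[T1, T]\<close> the flow is of saddle type, and for large \<open>mu\<close> every crossing of the second or fourth
  quadrant by the spiral is stretched again across an annular sector of the first quadrant; the two
  crossings per turn are the symbols. Lifted angles at time \<open>T1\<close> tell the crossings apart. Clamping
  this angle to the prescribed crossing gives globally defined maps, and an orbit with a periodic
  itinerary of length \<open>m\<close> is a zero of \<open>2 m\<close> functions to which the Poincare-Miranda theorem
  applies. The clamping is not active at a zero. Truncating \<open>h\<close> and \<open>g\<close> far away avoids blow-up, and
  since \<open>x y\<close> is nondecreasing on \<open>[T1, T]\<close> the orbits found do not see the truncation.\<close>

section \<open>Flows of globally Lipschitz fields\<close>

text \<open>The delicate point is the order of the constants. Truncation makes the field globally
  Lipschitz, but its constant \<open>L\<close> depends on the truncation level \<open>c\<close>, and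
  the inner radius \<open>r\<close> depends on \<open>L\<close> through the amplitude factor
  \<open>exp K\<close>. Hence \<open>R\<close> and \<open>c\<close> must come from estimates blind
  to \<open>L\<close>: in place of Gronwall's inequality, \<open>growth\<close> bounds the change of
  the radius per quadrant by a majorant of the untruncated \<open>h\<close> and \<open>g\<close>,
  and only orbits with a bounded number of quarter turns are required to stay in the box. The
  threshold for \<open>mu\<close> comes last, because the phase on \<open>[0, T1]\<close> does not
  see it. Log-polar coordinates make the lifted angle a component of the flow and move the origin to
  infinity. The third-quadrant family comes from the reflection \<open>(x, y)\<close> to
  \<open>(-x, -y)\<close>. Minimality of the period is not purely symbolic: itineraries exclude only
  the multiples of \<open>T\<close>. Any period of an orbit is also a period of the weight, and one
  block of each sign per period forbids a weight period that is not a multiple of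
  \<open>T\<close>.\<close>

lemma picard_flow:
  fixes F :: "real \<Rightarrow> 'a::banach \<Rightarrow> 'a"
  assumes le: "t0 \<le> t1" and L: "0 \<le> L"
    and cont: "continuous_on ({t0..t1} \<times> UNIV) (\<lambda>(t, x). F t x)"
    and lip: "\<And>t x y. t \<in> {t0..t1} \<Longrightarrow> norm (F t x - F t y) \<le> L * norm (x - y)"
  obtains \<phi> :: "'a \<Rightarrow> real \<Rightarrow> 'a"
  where "\<And>z. \<phi> z t0 = z"
    and "\<And>z t. t \<in> {t0..t1} \<Longrightarrow> (\<phi> z has_vector_derivative F t (\<phi> z t)) (at t within {t0..t1})"
    and "\<And>t. t \<in> {t0..t1} \<Longrightarrow> continuous_on UNIV (\<lambda>z. \<phi> z t)"
proof -
  \<comment> \<open>Weighting the sup norm by \<open>exp (K * (t - t0))\<close> makes the integral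
    operator a contraction on the whole interval at once, since \<open>L / K\<close> is at most 1/2;
    the \<open>+ 1\<close> keeps \<open>K\<close> positive when \<open>L = 0\<close>.\<close>
  define K where "K = 2 * L + 1"
  have K: "K > 0" "L / K \<le> 1/2" using L by (auto simp: K_def field_simps)
  \<comment> \<open>Bounded continuous functions live on the whole line, so time is clamped; outside
    the interval the operator returns endpoint values.\<close>
  define \<sigma> where "\<sigma> t = max t0 (min t1 t)" for t
  have \<sigma>: "\<sigma> t \<in> {t0..t1}" "t \<in> {t0..t1} \<Longrightarrow> \<sigma> t = t" for t
    using le by (auto simp: \<sigma>_def)
  have cont\<sigma>: "continuous_on UNIV \<sigma>"
    unfolding \<sigma>_def by (intro continuous_intros)
  define E where "E t = exp (K * (t - t0))" for t
  have cont_comp: "continuous_on {t0..t1} (\<lambda>s. F s (v s))" if "continuous_on {t0..t1} v" for v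
  proof -
    have "continuous_on {t0..t1} (\<lambda>s. case (s, v s) of (t, x) \<Rightarrow> F t x)"
      by (rule continuous_on_compose2[OF cont]) (auto intro!: continuous_intros that)
    then show ?thesis by simp
  qed
  define J where "J z w t = z + integral {t0..t} (\<lambda>s. F s (E s *\<^sub>R apply_bcontfun w s))"
    for z :: 'a and w t
  have cint: "continuous_on {t0..t1} (\<lambda>s. F s (E s *\<^sub>R apply_bcontfun w s))" for w
    unfolding E_def by (intro cont_comp continuous_intros continuous_on_apply_bcontfun)
  have contJ: "continuous_on {t0..t1} (J z w)" for z w
    unfolding J_def
    by (intro continuous_intros indefinite_integral_continuous_1 integrable_continuous_real cint)
  define Q where "Q z w t = exp (- (K * (\<sigma> t - t0))) *\<^sub>R J z w (\<sigma> t)" for z w t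
  have contQ: "continuous_on UNIV (Q z w)" for z w
    unfolding Q_def
    by (intro continuous_intros cont\<sigma> continuous_on_compose2[OF contJ cont\<sigma>]) (use \<sigma> in auto)
  have Qb: "Q z w \<in> bcontfun" for z w
  proof -
    have eq: "Q z w t = Q z w (\<sigma> t)" for t using \<sigma> by (simp add: Q_def)
    have "compact (Q z w ` {t0..t1})"
      by (intro compact_continuous_image continuous_on_subset[OF contQ]) auto
    then have "bounded (Q z w ` {t0..t1})" by (rule compact_imp_bounded)
    moreover have "range (Q z w) \<subseteq> Q z w ` {t0..t1}"
      using eq \<sigma> by blast
    ultimately show ?thesis using contQ bounded_subset by (auto simp: bcontfun_def)
  qed
  define B where "B z w = Bcontfun (Q z w)" for z w
  have B: "apply_bcontfun (B z w) = Q z w" for z w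
    unfolding B_def by (simp add: Bcontfun_inverse Qb)
  \<comment> \<open>One estimate serves twice: for equal initial values it is the contraction
    property, and at the fixed points it gives Lipschitz dependence on the initial value.\<close>
  have est: "dist (B z w) (B z' w') \<le> norm (z - z') + dist w w' / 2" for z z' w w'
  proof (rule dist_bound)
    fix t
    define \<tau> where "\<tau> = \<sigma> t"
    have \<tau>: "t0 \<le> \<tau>" "\<tau> \<le> t1" using \<sigma>(1)[of t] by (auto simp: \<tau>_def)
    let ?d = "dist w w'"
    have int: "(\<lambda>s. F s (E s *\<^sub>R apply_bcontfun w s)) integrable_on {t0..\<tau>}" for w
      by (intro integrable_continuous_real continuous_on_subset[OF cint]) (use \<tau> in auto)
    have hi: "((\<lambda>s. L * ?d * E s) has_integral (L * ?d * (E \<tau> / K) - L * ?d * (E t0 / K))) {t0..\<tau>}"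
      unfolding E_def
      by (rule fundamental_theorem_of_calculus)
         (use \<tau> K in \<open>auto intro!: derivative_eq_intros simp: has_real_derivative_iff_has_vector_derivative[symmetric]\<close>)
    have "norm (integral {t0..\<tau>} (\<lambda>s. F s (E s *\<^sub>R apply_bcontfun w s))
            - integral {t0..\<tau>} (\<lambda>s. F s (E s *\<^sub>R apply_bcontfun w' s)))
        = norm (integral {t0..\<tau>} (\<lambda>s. F s (E s *\<^sub>R apply_bcontfun w s) - F s (E s *\<^sub>R apply_bcontfun w' s)))"
      by (simp add: integral_diff int)
    also have "\<dots> \<le> integral {t0..\<tau>} (\<lambda>s. L * ?d * E s)"
    proof (rule integral_norm_bound_integral)
      fix s assume s: "s \<in> {t0..\<tau>}"
      have "norm (F s (E s *\<^sub>R apply_bcontfun w s) - F s (E s *\<^sub>R apply_bcontfun w' s))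
          \<le> L * norm (E s *\<^sub>R apply_bcontfun w s - E s *\<^sub>R apply_bcontfun w' s)"
        using s \<tau> by (intro lip) auto
      also have "\<dots> = L * (E s * dist (apply_bcontfun w s) (apply_bcontfun w' s))"
        by (simp add: scaleR_diff_right[symmetric] dist_norm E_def)
      also have "\<dots> \<le> L * (E s * ?d)"
        by (intro mult_left_mono L dist_bounded) (simp add: E_def)
      finally show "norm (F s (E s *\<^sub>R apply_bcontfun w s) - F s (E s *\<^sub>R apply_bcontfun w' s)) \<le> L * ?d * E s"
        by (simp add: algebra_simps)
    qed (use hi in \<open>auto intro!: integrable_diff int\<close>)
    also have "\<dots> = L / K * ?d * E \<tau> - L / K * ?d"
      using integral_unique[OF hi] by (simp add: E_def)
    also have "\<dots> \<le> ?d / 2 * E \<tau>"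
    proof -
      have "L / K * ?d * E \<tau> \<le> 1 / 2 * ?d * E \<tau>"
        by (intro mult_right_mono K(2)) (auto simp: E_def)
      moreover have "0 \<le> L / K * ?d" using L K by auto
      ultimately show ?thesis by linarith
    qed
    finally have "norm (J z w \<tau> - J z' w' \<tau>) \<le> norm (z - z') + ?d / 2 * E \<tau>"
      unfolding J_def by (smt (verit) add_diff_add norm_triangle_ineq)
    then have "norm (J z w \<tau> - J z' w' \<tau>) / E \<tau> \<le> norm (z - z') / E \<tau> + ?d / 2"
      by (simp add: field_simps E_def)
    moreover have "norm (z - z') / E \<tau> \<le> norm (z - z')"
      using \<tau> K by (simp add: E_def divide_le_eq mult_le_cancel_left1)
    moreover have "dist (Q z w t) (Q z' w' t) = norm (J z w \<tau> - J z' w' \<tau>) / E \<tau>"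
      unfolding Q_def \<tau>_def[symmetric] dist_norm scaleR_diff_right[symmetric] norm_scaleR E_def
      by (simp only: exp_minus abs_inverse abs_exp_cancel divide_inverse mult.commute)
    ultimately show "dist (apply_bcontfun (B z w) t) (apply_bcontfun (B z' w') t) \<le> norm (z - z') + ?d / 2"
      unfolding B by linarith
  qed
  have "\<exists>!w. B z w = w" for z
  proof (rule banach_fix_type)
    show "\<forall>x y. dist (B z x) (B z y) \<le> (1/2) * dist x y"
      using est[of z _ z] by auto
  qed auto
  then obtain W where W: "\<And>z. B z (W z) = W z" by metis
  have distW: "dist (W z) (W z') \<le> 2 * norm (z - z')" for z z'
    using est[of z "W z" z' "W z'"] unfolding W by linarith
  \<comment> \<open>The fixed point is the trajectory divided by the weight, which is multiplied
    back here.\<close>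
  define \<phi> where "\<phi> z t = E t *\<^sub>R apply_bcontfun (W z) t" for z t
  have \<phi>J: "\<phi> z t = J z (W z) t" if "t \<in> {t0..t1}" for z t
  proof -
    have "apply_bcontfun (W z) t = Q z (W z) t" using B W by metis
    then show ?thesis using \<sigma>(2)[OF that]
      by (simp add: \<phi>_def Q_def E_def exp_minus)
  qed
  show thesis
  proof
    show "\<phi> z t0 = z" for z using le by (simp add: \<phi>J J_def)
    fix t assume t: "t \<in> {t0..t1}"
    show "(\<phi> z has_vector_derivative F t (\<phi> z t)) (at t within {t0..t1})" for z
    proof -
      have "((\<lambda>u. z + integral {t0..u} (\<lambda>s. F s (\<phi> z s))) has_vector_derivative F t (\<phi> z t)) (at t within {t0..t1})"
        using integral_has_vector_derivative[OF cint t, of "W z"]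
        by (auto intro!: derivative_eq_intros simp: \<phi>_def)
      then show ?thesis
        by (rule has_vector_derivative_transform[OF t, rotated])
           (simp add: \<phi>J J_def, simp add: \<phi>_def)
    qed
    have "dist (\<phi> z t) (\<phi> z' t) \<le> 2 * E t * dist z z'" for z z'
    proof -
      have "dist (\<phi> z t) (\<phi> z' t) = E t * dist (apply_bcontfun (W z) t) (apply_bcontfun (W z') t)"
        by (simp add: \<phi>_def dist_norm scaleR_diff_right[symmetric] E_def)
      also have "\<dots> \<le> E t * dist (W z) (W z')"
        by (intro mult_left_mono dist_bounded) (simp add: E_def)
      also have "\<dots> \<le> E t * (2 * norm (z - z'))"
        by (intro mult_left_mono distW) (simp add: E_def)
      finally show ?thesis by (simp add: dist_norm algebra_simps)
    qed
    then have "(2 * E t)-lipschitz_on UNIV (\<lambda>z. \<phi> z t)"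
      by (intro lipschitz_onI) (auto simp: E_def)
    then show "continuous_on UNIV (\<lambda>z. \<phi> z t)"
      by (rule lipschitz_on_continuous_on)
  qed
qed

section \<open>Cycles of stretching maps\<close>

lemma tendsto_fun_iff:
  fixes f :: "'c \<Rightarrow> 'i \<Rightarrow> 'b::topological_space"
  shows "(f \<longlongrightarrow> l) F \<longleftrightarrow> (\<forall>i. ((\<lambda>c. f c i) \<longlongrightarrow> l i) F)"
  using limitin_componentwise[of "\<lambda>_. euclidean" UNIV f l F]
  by (simp add: euclidean_product_topology limitin_canonical_iff)

text \<open>Points are sequences, so that the dimension \<open>2 * m\<close> can be a variable;
  compactness of this infinite cube is Tychonoff's theorem.\<close>

lemma compact_unit_cube: "compact {x :: nat \<Rightarrow> real. \<forall>i. x i \<in> {0..1}}"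
proof -
  have "compactin (product_topology (\<lambda>_::nat. euclidean) UNIV) (PiE UNIV (\<lambda>_. {0..1::real}))"
    by (simp add: compactin_PiE compactin_euclidean_iff)
  moreover have "PiE UNIV (\<lambda>_. {0..1::real}) = {x :: nat \<Rightarrow> real. \<forall>i. x i \<in> {0..1}}"
    by (auto simp: PiE_def)
  ultimately show ?thesis
    by (simp add: euclidean_product_topology compactin_euclidean_iff)
qed

text \<open>Kuhn's lemma on grids of mesh \<open>1 / (p + 1)\<close> gives small cubes in which
  every \<open>f i\<close> takes a value \<le> 0 and a value \<ge> 0. At a limit point of these
  cubes continuity makes all of them vanish.\<close>

lemma poincare_miranda:
  fixes f :: "nat \<Rightarrow> (nat \<Rightarrow> real) \<Rightarrow> real"
  defines "Q \<equiv> {x :: nat \<Rightarrow> real. \<forall>i. x i \<in> {0..1}}"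
  assumes cont: "\<And>i. i < n \<Longrightarrow> continuous_on Q (f i)"
    and lo: "\<And>i x. i < n \<Longrightarrow> x \<in> Q \<Longrightarrow> x i = 0 \<Longrightarrow> f i x \<le> 0"
    and hi: "\<And>i x. i < n \<Longrightarrow> x \<in> Q \<Longrightarrow> x i = 1 \<Longrightarrow> f i x \<ge> 0"
  obtains x where "x \<in> Q" "\<And>i. i < n \<Longrightarrow> f i x = 0"
proof -
  define scale :: "nat \<Rightarrow> (nat \<Rightarrow> nat) \<Rightarrow> nat \<Rightarrow> real"
    where "scale p u = (\<lambda>j. if j < n then real (u j) / real (Suc p) else 0)" for p u
  have scaleQ: "scale p u \<in> Q" if "\<forall>j<n. u j \<le> Suc p" for p u
    using that by (auto simp: scale_def Q_def divide_le_eq)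
  have "\<exists>q rs. (\<forall>j<n. q j \<le> Suc p) \<and> (\<forall>i<n. scale p (fst (rs i)) \<in> Q \<and> scale p (snd (rs i)) \<in> Q \<and>
      (\<forall>j<n. q j \<le> fst (rs i) j \<and> fst (rs i) j \<le> q j + 1) \<and>
      (\<forall>j<n. q j \<le> snd (rs i) j \<and> snd (rs i) j \<le> q j + 1) \<and>
      f i (scale p (fst (rs i))) \<le> 0 \<and> f i (scale p (snd (rs i))) \<ge> 0)" for p
  proof -
    \<comment> \<open>Kuhn's lemma prescribes the labels on opposite faces; \<open>lo\<close> and
      \<open>hi\<close> make them agree with the signs, up to weak inequalities.\<close>
    define label where "label u i = (if u i = 0 then 0 else if u i = Suc p then 1
        else if f i (scale p u) < 0 then 0 else 1::nat)" for u :: "nat \<Rightarrow> nat" and i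
    obtain q where q: "\<forall>i<n. q i < Suc p" and
      rs: "\<forall>i<n. \<exists>r s. (\<forall>j<n. q j \<le> r j \<and> r j \<le> q j + 1) \<and> (\<forall>j<n. q j \<le> s j \<and> s j \<le> q j + 1)
        \<and> label r i \<noteq> label s i"
      by (rule kuhn_lemma[of "Suc p" n label]) (auto simp: label_def)
    have "\<exists>rs. scale p (fst rs) \<in> Q \<and> scale p (snd rs) \<in> Q \<and>
      (\<forall>j<n. q j \<le> fst rs j \<and> fst rs j \<le> q j + 1) \<and>
      (\<forall>j<n. q j \<le> snd rs j \<and> snd rs j \<le> q j + 1) \<and>
      f i (scale p (fst rs)) \<le> 0 \<and> f i (scale p (snd rs)) \<ge> 0" if i: "i < n" for i
    proof -
      obtain r s where r: "\<forall>j<n. q j \<le> r j \<and> r j \<le> q j + 1"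
        and s: "\<forall>j<n. q j \<le> s j \<and> s j \<le> q j + 1" and ne: "label r i \<noteq> label s i"
        using rs i by blast
      have Qu: "scale p u \<in> Q" if "\<forall>j<n. q j \<le> u j \<and> u j \<le> q j + 1" for u
        by (intro scaleQ) (use that q in fastforce)
      have l0: "f i (scale p u) \<le> 0" if "label u i = 0" "scale p u \<in> Q" for u
        using that lo[OF i that(2)] by (auto simp: label_def scale_def i split: if_splits)
      have l1: "f i (scale p u) \<ge> 0" if "label u i \<noteq> 0" "scale p u \<in> Q" for u
        using that hi[OF i that(2)] i by (auto simp: label_def scale_def split: if_splits)
      show ?thesis
      proof (cases "label r i = 0")
        case True
        then show ?thesis using r s ne Qu[OF r] Qu[OF s] l0[of r] l1[of s]
          by (intro exI[of _ "(r, s)"]) auto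
      next
        case False
        then have "label s i = 0" using ne by (auto simp: label_def split: if_splits)
        then show ?thesis using r s False Qu[OF r] Qu[OF s] l0[of s] l1[of r]
          by (intro exI[of _ "(s, r)"]) auto
      qed
    qed
    then have "\<exists>rs. \<forall>i<n. scale p (fst (rs i)) \<in> Q \<and> scale p (snd (rs i)) \<in> Q \<and>
      (\<forall>j<n. q j \<le> fst (rs i) j \<and> fst (rs i) j \<le> q j + 1) \<and>
      (\<forall>j<n. q j \<le> snd (rs i) j \<and> snd (rs i) j \<le> q j + 1) \<and>
      f i (scale p (fst (rs i))) \<le> 0 \<and> f i (scale p (snd (rs i))) \<ge> 0" by metis
    then obtain rs where "\<forall>i<n. scale p (fst (rs i)) \<in> Q \<and> scale p (snd (rs i)) \<in> Q \<and>
      (\<forall>j<n. q j \<le> fst (rs i) j \<and> fst (rs i) j \<le> q j + 1) \<and>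
      (\<forall>j<n. q j \<le> snd (rs i) j \<and> snd (rs i) j \<le> q j + 1) \<and>
      f i (scale p (fst (rs i))) \<le> 0 \<and> f i (scale p (snd (rs i))) \<ge> 0" ..
    with q show ?thesis by (intro exI[of _ q] exI[of _ rs]) (auto intro: less_imp_le)
  qed
  then obtain q rs where qle: "\<And>p. \<forall>j<n. q p j \<le> Suc p" and
    rs: "\<And>p i. i < n \<Longrightarrow> scale p (fst (rs p i)) \<in> Q \<and> scale p (snd (rs p i)) \<in> Q \<and>
      (\<forall>j<n. q p j \<le> fst (rs p i) j \<and> fst (rs p i) j \<le> q p j + 1) \<and>
      (\<forall>j<n. q p j \<le> snd (rs p i) j \<and> snd (rs p i) j \<le> q p j + 1) \<and>
      f i (scale p (fst (rs p i))) \<le> 0 \<and> f i (scale p (snd (rs p i))) \<ge> 0"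
    by metis
  have "seq_compact Q" unfolding Q_def
    by (intro compact_imp_seq_compact compact_unit_cube)
  then obtain l \<sigma> where l: "l \<in> Q" "strict_mono (\<sigma> :: nat \<Rightarrow> nat)" "((\<lambda>p. scale p (q p)) \<circ> \<sigma>) \<longlonglongrightarrow> l"
    using scaleQ qle by (metis seq_compact_def)
  \<comment> \<open>A vertex of the \<open>p\<close>-th cube differs from its base corner by at most
    the mesh, so every choice of vertices has the same limit.\<close>
  have near: "(\<lambda>k. scale (\<sigma> k) (u (\<sigma> k))) \<longlonglongrightarrow> l"
    if u: "\<And>p. \<forall>j<n. q p j \<le> u p j \<and> u p j \<le> q p j + 1" for u
    unfolding tendsto_fun_iff
  proof
    fix j
    have 1: "(\<lambda>k. scale (\<sigma> k) (q (\<sigma> k)) j) \<longlonglongrightarrow> l j"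
      using l(3) by (simp add: tendsto_fun_iff o_def)
    have 2: "(\<lambda>k. 1 / real (Suc (\<sigma> k))) \<longlonglongrightarrow> 0"
      using LIMSEQ_subseq_LIMSEQ[OF LIMSEQ_inverse_real_of_nat l(2)]
      by (simp add: o_def inverse_eq_divide)
    have "norm (scale (\<sigma> k) (u (\<sigma> k)) j - scale (\<sigma> k) (q (\<sigma> k)) j) \<le> 1 / real (Suc (\<sigma> k))" for k
    proof (cases "j < n")
      case True
      then have "\<bar>real (u (\<sigma> k) j) - real (q (\<sigma> k) j)\<bar> \<le> 1" using u[of "\<sigma> k"] by fastforce
      then show ?thesis using True
        by (auto simp: scale_def diff_divide_distrib[symmetric] abs_divide divide_right_mono)
    qed (simp add: scale_def)
    then have "(\<lambda>k. scale (\<sigma> k) (u (\<sigma> k)) j - scale (\<sigma> k) (q (\<sigma> k)) j) \<longlonglongrightarrow> 0"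
      by (intro Lim_null_comparison[OF _ 2]) auto
    from tendsto_add[OF this 1] show "(\<lambda>k. scale (\<sigma> k) (u (\<sigma> k)) j) \<longlonglongrightarrow> l j" by simp
  qed
  have "f i l = 0" if i: "i < n" for i
  proof (rule antisym)
    have "(\<lambda>k. f i (scale (\<sigma> k) (fst (rs (\<sigma> k) i)))) \<longlonglongrightarrow> f i l"
      by (rule continuous_on_tendsto_compose[OF cont[OF i] near[of "\<lambda>p. fst (rs p i)"] l(1)])
         (use rs[OF i] in auto)
    then show "f i l \<le> 0"
      by (rule LIMSEQ_le_const2) (use rs[OF i] in auto)
    have "(\<lambda>k. f i (scale (\<sigma> k) (snd (rs (\<sigma> k) i)))) \<longlonglongrightarrow> f i l"
      by (rule continuous_on_tendsto_compose[OF cont[OF i] near[of "\<lambda>p. snd (rs p i)"] l(1)])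
         (use rs[OF i] in auto)
    then show "0 \<le> f i l"
      by (rule LIMSEQ_le_const) (use rs[OF i] in auto)
  qed
  with l(1) that show thesis by blast
qed

text \<open>Unknown \<open>2 i\<close> (resp. \<open>2 i + 1\<close>) of the Poincare-Miranda cube is the rescaled first
  (resp. second) coordinate of the \<open>i\<close>-th point.\<close>

lemma stretching_cycle:
  fixes \<Phi> :: "nat \<Rightarrow> real \<times> real \<Rightarrow> real \<times> real"
  defines "succ \<equiv> \<lambda>m i. Suc i mod m"
  assumes ab: "a < b" and cd: "c < d" and m: "m > 0"
    and cont: "\<And>i. i < m \<Longrightarrow> continuous_on ({a..b} \<times> {c..d}) (\<Phi> i)"
    and snd: "\<And>i z. i < m \<Longrightarrow> z \<in> {a..b} \<times> {c..d} \<Longrightarrow> snd (\<Phi> i z) \<in> {c..d}"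
    and fst: "\<And>i. i < m \<Longrightarrow>
       (\<forall>t\<in>{c..d}. fst (\<Phi> i (a, t)) \<le> a \<and> fst (\<Phi> i (b, t)) \<ge> b) \<or>
       (\<forall>t\<in>{c..d}. fst (\<Phi> i (a, t)) \<ge> b \<and> fst (\<Phi> i (b, t)) \<le> a)"
  obtains z where "\<And>i. i < m \<Longrightarrow> z i \<in> {a..b} \<times> {c..d}"
    and "\<And>i. i < m \<Longrightarrow> \<Phi> i (z i) = z (succ m i)"
proof -
  define Q where "Q = {x :: nat \<Rightarrow> real. \<forall>i. x i \<in> {0..1}}"
  define up where "up i \<longleftrightarrow> (\<forall>t\<in>{c..d}. fst (\<Phi> i (a, t)) \<le> a \<and> fst (\<Phi> i (b, t)) \<ge> b)" for i
  define Z where "Z x i = (a + (b - a) * x (2 * i), c + (d - c) * x (2 * i + 1))" for x :: "nat \<Rightarrow> real" and i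
  have ZQ: "Z x i \<in> {a..b} \<times> {c..d}" if "x \<in> Q" for x i
  proof -
    have "0 \<le> x j" "x j \<le> 1" for j using that by (auto simp: Q_def)
    then have "(b - a) * x j \<le> b - a" "(d - c) * x j \<le> d - c" "0 \<le> (b - a) * x j" "0 \<le> (d - c) * x j" for j
      using ab cd by (auto simp: mult_left_le)
    then show ?thesis by (simp add: Z_def) (smt (verit))
  qed
  have contx: "continuous_on Q (\<lambda>x. x j)" for j
    by (rule continuous_on_product_then_coordinatewise) (rule continuous_on_id)
  have contZ: "continuous_on Q (\<lambda>x. Z x i)" for i
    unfolding Z_def by (intro continuous_intros contx)
  have cont\<Phi>: "continuous_on Q (\<lambda>x. \<Phi> i (Z x i))" if "i < m" for i
    by (rule continuous_on_compose2[OF cont[OF that] contZ]) (use ZQ in blast)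
  define pred where "pred i = (i + (m - 1)) mod m" for i
  have pred: "pred i < m" "succ m (pred i) = i" if "i < m" for i
    using that m by (auto simp: pred_def assms(1) mod_Suc_eq)
  have psucc: "pred (succ m i) = i" if "i < m" for i
  proof -
    have "pred (succ m i) = (Suc i + (m - 1)) mod m" by (simp add: pred_def assms(1) mod_add_left_eq)
    also have "\<dots> = (i + m) mod m" using m by simp
    finally show ?thesis using that by simp
  qed
  have succ: "succ m i < m" for i using m by (simp add: assms(1))
  \<comment> \<open>The equation for consecutive points is split. Its first coordinate is attached
    to the departing point, with a sign for the orientation, because stretching controls it on the
    faces of that point. Its second coordinate is attached to the arriving point, whose own second
    coordinate is extremal on its faces while images stay in \<open>[c, d]\<close>.\<close>
  define f where "f j x = (let i = j div 2 in
      if even j then (if up i then 1 else -1) * (fst (\<Phi> i (Z x i)) - fst (Z x (succ m i)))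
      else snd (Z x i) - snd (\<Phi> (pred i) (Z x (pred i))))" for j x
  obtain x where x: "x \<in> Q" "\<And>j. j < 2 * m \<Longrightarrow> f j x = 0"
  proof (rule poincare_miranda[of "2 * m" f, folded Q_def])
    fix j assume j: "j < 2 * m"
    then have i: "j div 2 < m" by simp
    show "continuous_on Q (f j)"
    proof (cases "even j")
      case True
      have "continuous_on Q (\<lambda>x. (if up (j div 2) then 1 else -1) *
          (fst (\<Phi> (j div 2) (Z x (j div 2))) - fst (Z x (succ m (j div 2)))))"
        by (intro continuous_on_mult continuous_on_const continuous_on_diff continuous_on_fst
            cont\<Phi> contZ i)
      then show ?thesis using True by (simp add: f_def Let_def)
    next
      case False
      have "continuous_on Q (\<lambda>x. snd (Z x (j div 2)) - snd (\<Phi> (pred (j div 2)) (Z x (pred (j div 2)))))"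
        by (intro continuous_on_diff continuous_on_snd cont\<Phi> contZ pred i)
      then show ?thesis using False by (simp add: f_def Let_def)
    qed
    fix x assume xQ: "x \<in> Q"
    have sndZ: "snd (Z x i) \<in> {c..d}" and fstZ: "fst (Z x i) \<in> {a..b}" for i
      using ZQ[OF xQ, of i] by (auto simp: mem_Times_iff)
    have snd\<Phi>: "snd (\<Phi> (pred (j div 2)) (Z x (pred (j div 2)))) \<in> {c..d}"
      by (intro snd pred i ZQ xQ)
    have up: "up (j div 2) \<or> (\<forall>t\<in>{c..d}. fst (\<Phi> (j div 2) (a, t)) \<ge> b \<and> fst (\<Phi> (j div 2) (b, t)) \<le> a)"
      using fst[OF i] by (auto simp: up_def)
    show "f j x \<le> 0" if "x j = 0"
    proof (cases "even j")
      case True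
      then have "Z x (j div 2) = (a, snd (Z x (j div 2)))" using that by (simp add: Z_def)
      moreover obtain p t where "Z x (j div 2) = (p, t)" by fastforce
      ultimately have "Z x (j div 2) = (a, t)" "t \<in> {c..d}" using sndZ[of "j div 2"] by auto
      moreover have "f j x = (if up (j div 2) then 1 else -1) *
          (fst (\<Phi> (j div 2) (Z x (j div 2))) - fst (Z x (succ m (j div 2))))"
        using True by (simp add: f_def Let_def)
      ultimately have eq: "f j x = (if up (j div 2) then 1 else -1) *
          (fst (\<Phi> (j div 2) (a, t)) - fst (Z x (succ m (j div 2))))" and t: "t \<in> {c..d}"
        by simp_all
      show ?thesis
      proof (cases "up (j div 2)")
        case True
        then show ?thesis using fstZ[of "succ m (j div 2)"] t by (auto simp: eq up_def dest!: bspec[OF _ t])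
      next
        case False
        then have "fst (\<Phi> (j div 2) (a, t)) \<ge> b \<and> fst (\<Phi> (j div 2) (b, t)) \<le> a" using up t by blast
        then show ?thesis using fstZ[of "succ m (j div 2)"] False by (auto simp: eq)
      qed
    next
      case False
      then have "snd (Z x (j div 2)) = c" using that by (simp add: Z_def)
      then show ?thesis using False snd\<Phi> by (simp add: f_def Let_def)
    qed
    show "f j x \<ge> 0" if "x j = 1"
    proof (cases "even j")
      case True
      then have "Z x (j div 2) = (b, snd (Z x (j div 2)))" using that by (simp add: Z_def)
      moreover obtain p t where "Z x (j div 2) = (p, t)" by fastforce
      ultimately have "Z x (j div 2) = (b, t)" "t \<in> {c..d}" using sndZ[of "j div 2"] by auto
      moreover have "f j x = (if up (j div 2) then 1 else -1) *
          (fst (\<Phi> (j div 2) (Z x (j div 2))) - fst (Z x (succ m (j div 2))))"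
        using True by (simp add: f_def Let_def)
      ultimately have eq: "f j x = (if up (j div 2) then 1 else -1) *
          (fst (\<Phi> (j div 2) (b, t)) - fst (Z x (succ m (j div 2))))" and t: "t \<in> {c..d}"
        by simp_all
      show ?thesis
      proof (cases "up (j div 2)")
        case True
        then show ?thesis using fstZ[of "succ m (j div 2)"] t by (auto simp: eq up_def dest!: bspec[OF _ t])
      next
        case False
        then have "fst (\<Phi> (j div 2) (a, t)) \<ge> b \<and> fst (\<Phi> (j div 2) (b, t)) \<le> a" using up t by blast
        then show ?thesis using fstZ[of "succ m (j div 2)"] False by (auto simp: eq)
      qed
    next
      case False
      then have "snd (Z x (j div 2)) = d" using that by (simp add: Z_def)
      then show ?thesis using False snd\<Phi> by (simp add: f_def Let_def)
    qed
  qed auto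
  show thesis
  proof
    fix i assume i: "i < m"
    show "Z x i \<in> {a..b} \<times> {c..d}" by (rule ZQ[OF x(1)])
    have "f (2 * i) x = 0" using i by (intro x) simp
    then have 1: "fst (\<Phi> i (Z x i)) = fst (Z x (succ m i))" by (simp add: f_def Let_def split: if_splits)
    have "f (2 * succ m i + 1) x = 0" using succ[of i] by (intro x) simp
    then have "snd (\<Phi> i (Z x i)) = snd (Z x (succ m i))" by (simp add: f_def Let_def psucc[OF i])
    with 1 show "\<Phi> i (Z x i) = Z x (succ m i)" by (simp add: prod_eq_iff)
  qed
qed

section \<open>Log-polar coordinates\<close>

lemma deriv_le_increment:
  fixes f f' :: "real \<Rightarrow> real"
  assumes "a \<le> b" "{a..b} \<subseteq> S"
    and d: "\<And>t. t \<in> S \<Longrightarrow> (f has_real_derivative f' t) (at t within S)"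
    and M: "\<And>t. t \<in> {a..b} \<Longrightarrow> f' t \<le> M"
  shows "f b - f a \<le> M * (b - a)"
proof -
  have "(f has_derivative (*) (f' t)) (at t within {a..b})" if "a \<le> t" "t \<le> b" for t
    using has_field_derivative_subset[OF d assms(2), of t] that assms(2)
    by (auto simp: has_field_derivative_def)
  then obtain t where "t \<in> {a..b}" "f b - f a = f' t * (b - a)"
    using mvt_very_simple[OF assms(1), of f "\<lambda>t. (*) (f' t)"] by auto
  then show ?thesis using M assms(1) by (auto intro: mult_right_mono)
qed

lemma deriv_ge_increment:
  fixes f f' :: "real \<Rightarrow> real"
  assumes "a \<le> b" "{a..b} \<subseteq> S"
    and d: "\<And>t. t \<in> S \<Longrightarrow> (f has_real_derivative f' t) (at t within S)"
    and M: "\<And>t. t \<in> {a..b} \<Longrightarrow> M \<le> f' t"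
  shows "M * (b - a) \<le> f b - f a"
proof -
  have "- f b - (- f a) \<le> - M * (b - a)"
    by (rule deriv_le_increment[OF assms(1,2) DERIV_minus[OF d]]) (use M in auto)
  then show ?thesis by simp
qed

lemma has_vector_derivative_within_Un:
  assumes "(f has_vector_derivative D) (at x within A)" "(f has_vector_derivative D) (at x within B)"
  shows "(f has_vector_derivative D) (at x within A \<union> B)"
  using assms unfolding has_vector_derivative_def has_derivative_within by (auto intro: Lim_Un)

text \<open>Both one-sided derivatives of the concatenation at a node agree because the vector field is
  \<open>T\<close>-periodic and the pieces match.\<close>

lemma concatenate_solutions:
  fixes f :: "real \<Rightarrow> 'a \<Rightarrow> 'a::real_normed_vector" and V :: "int \<Rightarrow> real \<Rightarrow> 'a" and T :: real
  defines "u \<equiv> \<lambda>t. V \<lfloor>t / T\<rfloor> (t - of_int \<lfloor>t / T\<rfloor> * T)"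
  assumes T: "T > 0" and per: "\<And>t x. f (t + T) x = f t x"
    and V: "\<And>n t. t \<in> {0..T} \<Longrightarrow> (V n has_vector_derivative f t (V n t)) (at t within {0..T})"
    and match: "\<And>n. V n T = V (n + 1) 0"
  shows "(u has_vector_derivative f t (u t)) (at t)"
proof -
  have perN: "f (t + real n * T) x = f t x" for n t x
  proof (induction n)
    case (Suc n)
    then show ?case using per[of "t + real n * T" x] by (simp add: algebra_simps)
  qed simp
  have perZ: "f (t - of_int n * T) x = f t x" for n t x
  proof (cases "n \<ge> 0")
    case True
    then show ?thesis using perN[of "t - of_int n * T" "nat n" x] by simp
  next
    case False
    then show ?thesis using perN[of t "nat (- n)" x] by simp
  qed
  let ?I = "\<lambda>n::int. {of_int n * T .. (of_int n + 1) * T}"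
  have u_eq: "u s = V n (s - of_int n * T)" if "s \<in> ?I n" for s n
  proof (cases "s = (of_int n + 1) * T")
    case True
    then have "\<lfloor>s / T\<rfloor> = n + 1" using T by simp
    then show ?thesis using match[of n] True by (simp add: u_def algebra_simps)
  next
    case False
    then have "of_int n \<le> s / T" "s / T < of_int n + 1"
      using that T by (auto simp: field_simps)
    then have "\<lfloor>s / T\<rfloor> = n" by (simp add: floor_eq_iff)
    then show ?thesis by (simp add: u_def)
  qed
  have piece: "(u has_vector_derivative f s (u s)) (at s within ?I n)" if s: "s \<in> ?I n" for s n
  proof -
    have img: "(\<lambda>r. r - of_int n * T) ` ?I n = {0..T}"
      unfolding image_minus_const_atLeastAtMost' by (simp add: algebra_simps)
    have "((V n \<circ> (\<lambda>r. r - of_int n * T)) has_vector_derivative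
        1 *\<^sub>R f (s - of_int n * T) (V n (s - of_int n * T))) (at s within ?I n)"
    proof (rule vector_diff_chain_within)
      show "((\<lambda>r. r - of_int n * T) has_vector_derivative 1) (at s within ?I n)"
        by (auto intro!: derivative_eq_intros)
      show "(V n has_vector_derivative f (s - of_int n * T) (V n (s - of_int n * T)))
         (at (s - of_int n * T) within (\<lambda>r. r - of_int n * T) ` ?I n)"
        unfolding img by (rule V) (use s in \<open>auto simp: algebra_simps\<close>)
    qed
    then have "((V n \<circ> (\<lambda>r. r - of_int n * T)) has_vector_derivative f s (u s)) (at s within ?I n)"
      by (simp add: perZ u_eq[OF s])
    then show ?thesis
      by (rule has_vector_derivative_transform[OF s, rotated]) (use u_eq[of _ n] in simp)
  qed
  define n where "n = \<lfloor>t / T\<rfloor>"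
  have n: "of_int n * T \<le> t" "t < (of_int n + 1) * T"
  proof -
    have "of_int n \<le> t / T" "t / T < of_int n + 1"
      using floor_correct[of "t / T"] by (simp_all add: n_def)
    then show "of_int n * T \<le> t" "t < (of_int n + 1) * T"
      using pos_le_divide_eq[OF T] pos_divide_less_eq[OF T] by blast+
  qed
  show ?thesis
  proof (cases "of_int n * T = t")
    case False
    then have "t \<in> {of_int n * T <..< (of_int n + 1) * T}" using n by simp
    then have "t \<in> interior (?I n)" by (simp only: interior_atLeastAtMost_real)
    then have "at t within ?I n = at t" by (rule at_within_interior)
    moreover have "(u has_vector_derivative f t (u t)) (at t within ?I n)"
      by (rule piece) (use n in simp)
    ultimately show ?thesis by simp
  next
    case True
    have "(u has_vector_derivative f t (u t)) (at t within ?I (n - 1) \<union> ?I n)"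
    proof (rule has_vector_derivative_within_Un; rule piece)
      show "t \<in> ?I (n - 1)" "t \<in> ?I n" using n True T by (simp_all add: left_diff_distrib)
    qed
    moreover have "?I (n - 1) \<union> ?I n = {t - T .. t + T}"
    proof -
      have "?I (n - 1) = {t - T..t}" "?I n = {t..t + T}"
        using True by (simp_all add: distrib_right left_diff_distrib)
      then show ?thesis using T by (simp only:) (rule ivl_disj_un_two_touch, auto)
    qed
    moreover have "at t within {t - T .. t + T} = at t"
      by (rule at_within_interior) (use T in simp)
    ultimately show ?thesis by metis
  qed
qed

section \<open>Truncated nonlinearities\<close>

definition clip :: "real \<Rightarrow> real \<Rightarrow> real" where
  "clip c v = max (- c) (min c v)"

lemma clip_id: "\<bar>v\<bar> \<le> c \<Longrightarrow> clip c v = v"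
  by (auto simp: clip_def)

lemma abs_clip_le: "0 \<le> c \<Longrightarrow> \<bar>clip c v\<bar> \<le> \<bar>v\<bar>"
  by (auto simp: clip_def)

lemma clip_sgn: "0 < c \<Longrightarrow> 0 < v \<Longrightarrow> 0 < clip c v" "0 < c \<Longrightarrow> v < 0 \<Longrightarrow> clip c v < 0"
  by (auto simp: clip_def)

text \<open>On the compact interval \<open>[-c, c]\<close> local Lipschitz continuity becomes
  uniform, and \<open>clip c\<close> is a 1-Lipschitz map into it.\<close>

lemma loc_lipschitz_clip:
  assumes f: "loc_lipschitz f" and c: "0 \<le> c"
  obtains L where "L-lipschitz_on UNIV (\<lambda>v. f (clip c v))"
proof -
  have "local_lipschitz {0::real} {-c..c} (\<lambda>_. f)"
  proof (rule local_lipschitzI)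
    fix t x :: real
    obtain U L where U: "open U" "x \<in> U" and L: "L-lipschitz_on U f"
      using f unfolding loc_lipschitz_def by blast
    obtain u where u: "u > 0" "cball x u \<subseteq> U" using U open_contains_cball by blast
    have "L-lipschitz_on (cball x u \<inter> {-c..c}) f"
      by (rule lipschitz_on_subset[OF L]) (use u in auto)
    with u(1) show "\<exists>u>0. \<exists>L. \<forall>t\<in>cball t u \<inter> {0}. L-lipschitz_on (cball x u \<inter> {-c..c}) f" by blast
  qed
  then obtain L where L: "\<And>t. t \<in> {0::real} \<Longrightarrow> L-lipschitz_on {-c..c} f"
    using local_lipschitz_compact_implies_lipschitz[of "{0::real}" "{-c..c}" "\<lambda>_. f"] by auto
  have "(L * 1)-lipschitz_on UNIV (f \<circ> clip c)"
  proof (rule lipschitz_on_compose)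
    show "1-lipschitz_on UNIV (clip c)"
      by (intro lipschitz_onI) (auto simp: clip_def dist_real_def)
    show "L-lipschitz_on (clip c ` UNIV) f"
      by (rule lipschitz_on_subset[OF L]) (use c in \<open>auto simp: clip_def\<close>)
  qed
  then show thesis using that by (simp add: o_def)
qed

lemma loc_lipschitz_continuous:
  assumes "loc_lipschitz f"
  shows "continuous_on UNIV f"
proof -
  have "isCont f x" for x
  proof -
    obtain U L where "open U" "x \<in> U" "L-lipschitz_on U f"
      using assms unfolding loc_lipschitz_def by blast
    then show ?thesis
      using lipschitz_on_continuous_on continuous_on_eq_continuous_at by blast
  qed
  then show ?thesis by (simp add: continuous_at_imp_continuous_on)
qed

lemma abs_diff_mult_le:
  fixes a a' b b' d :: real
  assumes "\<bar>a\<bar> \<le> A" "\<bar>b'\<bar> \<le> B" "\<bar>a - a'\<bar> \<le> K * d" "\<bar>b - b'\<bar> \<le> M * d" "0 \<le> d"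
  shows "\<bar>a * b - a' * b'\<bar> \<le> (A * M + B * K) * d"
proof -
  have "\<bar>a * b - a' * b'\<bar> = \<bar>a * (b - b') + (a - a') * b'\<bar>" by (simp add: algebra_simps)
  also have "\<dots> \<le> \<bar>a\<bar> * \<bar>b - b'\<bar> + \<bar>a - a'\<bar> * \<bar>b'\<bar>"
    by (metis abs_mult abs_triangle_ineq)
  also have "\<dots> \<le> A * (M * d) + (K * d) * B"
    using assms by (intro add_mono mult_mono) (auto intro: order_trans[OF abs_ge_zero])
  finally show ?thesis by (simp add: algebra_simps)
qed

lemma lipschitz_on_real: "L-lipschitz_on UNIV f \<Longrightarrow> \<bar>f x - f y\<bar> \<le> L * \<bar>x - y\<bar>" for f :: "real \<Rightarrow> real"
  using lipschitz_onD[of L UNIV f x y] by (simp add: dist_real_def)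

lemma lipschitz_on_real0: "L-lipschitz_on UNIV f \<Longrightarrow> f 0 = 0 \<Longrightarrow> \<bar>f x\<bar> \<le> L * \<bar>x\<bar>" for f :: "real \<Rightarrow> real"
  using lipschitz_on_real[of L f x 0] by simp

section \<open>Global Lipschitz estimates in log-polar coordinates\<close>

lemma log_radial_bound:
  fixes f :: "real \<Rightarrow> real"
  assumes f: "L-lipschitz_on UNIV f" "f 0 = 0" and c: "\<bar>c\<bar> \<le> 1"
  shows "\<bar>exp (- s) * f (exp s * c)\<bar> \<le> L"
proof -
  have L: "L \<ge> 0" using f(1) by (rule lipschitz_on_nonneg)
  have "\<bar>exp (- s) * f (exp s * c)\<bar> \<le> exp (- s) * (L * \<bar>exp s * c\<bar>)"
    using lipschitz_on_real0[OF f, of "exp s * c"] by (simp add: abs_mult)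
  also have "\<dots> = L * \<bar>c\<bar>" by (simp add: abs_mult exp_minus field_simps)
  also have "\<dots> \<le> L" using L c by (simp add: mult_left_le)
  finally show ?thesis .
qed

text \<open>The factor \<open>exp (- s)\<close> blows up towards the origin and is compensated by
  the linear bound that \<open>f 0 = 0\<close> provides. The difference telescopes by changing
  \<open>c\<close>, the outer factor and the argument in turn; each change of \<open>s\<close> costs
  \<open>1 - exp (s - s') \<le> s' - s\<close>.\<close>

lemma log_radial_lipschitz:
  fixes f :: "real \<Rightarrow> real"
  assumes f: "L-lipschitz_on UNIV f" "f 0 = 0" and c: "\<bar>c\<bar> \<le> 1" "\<bar>c'\<bar> \<le> 1"
  shows "\<bar>exp (- s) * f (exp s * c) - exp (- s') * f (exp s' * c')\<bar> \<le> L * \<bar>c - c'\<bar> + 2 * L * \<bar>s - s'\<bar>"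
proof -
  have L: "L \<ge> 0" using f(1) by (rule lipschitz_on_nonneg)
  \<comment> \<open>For \<open>s \<le> s'\<close> the exponential differences have a definite sign;
    the other case follows by exchanging the points.\<close>
  have *: "\<bar>exp (- s) * f (exp s * c) - exp (- s') * f (exp s' * c')\<bar> \<le> L * \<bar>c - c'\<bar> + 2 * L * (s' - s)"
    if "s \<le> s'" and c': "\<bar>c'\<bar> \<le> 1" for s s' c c' :: real
  proof -
    have 1: "exp (- s) * \<bar>f (exp s * c) - f (exp s * c')\<bar> \<le> L * \<bar>c - c'\<bar>"
    proof -
      have "exp (- s) * \<bar>f (exp s * c) - f (exp s * c')\<bar> \<le> exp (- s) * (L * \<bar>exp s * c - exp s * c'\<bar>)"
        using lipschitz_on_real[OF f(1)] by simp
      also have "\<dots> = L * \<bar>c - c'\<bar>"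
      proof -
        have "exp s * c - exp s * c' = exp s * (c - c')" by (simp add: algebra_simps)
        then show ?thesis by (simp add: abs_mult exp_minus)
      qed
      finally show ?thesis .
    qed
    have e: "1 - exp (s - s') \<le> s' - s" using exp_ge_add_one_self[of "s - s'"] by linarith
    have 2: "(exp (- s) - exp (- s')) * \<bar>f (exp s * c')\<bar> \<le> L * (s' - s)"
    proof -
      have "(exp (- s) - exp (- s')) * \<bar>f (exp s * c')\<bar> \<le> (exp (- s) - exp (- s')) * (L * (exp s * 1))"
        using that lipschitz_on_real0[OF f, of "exp s * c'"] L c'
        by (intro mult_left_mono) (auto simp: abs_mult intro: order_trans[OF _ mult_left_mono])
      also have "\<dots> = L * (1 - exp (s - s'))" by (simp add: algebra_simps exp_minus exp_diff divide_inverse)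
      also have "\<dots> \<le> L * (s' - s)" using e L by (intro mult_left_mono)
      finally show ?thesis .
    qed
    have 3: "exp (- s') * \<bar>f (exp s * c') - f (exp s' * c')\<bar> \<le> L * (s' - s)"
    proof -
      have "exp (- s') * \<bar>f (exp s * c') - f (exp s' * c')\<bar> \<le> exp (- s') * (L * \<bar>exp s * c' - exp s' * c'\<bar>)"
        using lipschitz_on_real[OF f(1)] by simp
      also have "\<bar>exp s * c' - exp s' * c'\<bar> = (exp s' - exp s) * \<bar>c'\<bar>"
        using that by (simp add: left_diff_distrib[symmetric] abs_mult)
      also have "exp (- s') * (L * ((exp s' - exp s) * \<bar>c'\<bar>)) \<le> exp (- s') * (L * ((exp s' - exp s) * 1))"
        using L that c' by (intro mult_left_mono) auto
      also have "\<dots> = L * (1 - exp (s - s'))" by (simp add: algebra_simps exp_minus exp_diff divide_inverse)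
      also have "\<dots> \<le> L * (s' - s)" using e L by (intro mult_left_mono)
      finally show ?thesis .
    qed
    have "exp (- s) * f (exp s * c) - exp (- s') * f (exp s' * c') =
        exp (- s) * (f (exp s * c) - f (exp s * c')) + (exp (- s) - exp (- s')) * f (exp s * c')
        + exp (- s') * (f (exp s * c') - f (exp s' * c'))" by (simp add: algebra_simps)
    also have "\<bar>\<dots>\<bar> \<le> exp (- s) * \<bar>f (exp s * c) - f (exp s * c')\<bar>
        + (exp (- s) - exp (- s')) * \<bar>f (exp s * c')\<bar> + exp (- s') * \<bar>f (exp s * c') - f (exp s' * c')\<bar>"
      using that by (intro order_trans[OF abs_triangle_ineq] add_mono) (auto simp: abs_mult)
    finally show ?thesis using 1 2 3 by linarith
  qed
  show ?thesis
  proof (cases "s \<le> s'")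
    case True then show ?thesis using *[of s s' c' c] c by simp
  next
    case False then show ?thesis using *[of s' s c c'] c
      by (simp add: abs_minus_commute)
  qed
qed

text \<open>The planar field in the coordinates (logarithm of the radius, lifted angle), in which it is
  still globally Lipschitz.\<close>

definition polar_field ::
  "(real \<Rightarrow> real) \<Rightarrow> (real \<Rightarrow> real) \<Rightarrow> (real \<Rightarrow> real) \<Rightarrow> real \<Rightarrow> real \<times> real \<Rightarrow> real \<times> real" where
  "polar_field H G w t z =
    (cos (snd z) * (exp (- fst z) * H (exp (fst z) * sin (snd z)))
       - w t * (sin (snd z) * (exp (- fst z) * G (exp (fst z) * cos (snd z)))),
     - (sin (snd z) * (exp (- fst z) * H (exp (fst z) * sin (snd z))))
       - w t * (cos (snd z) * (exp (- fst z) * G (exp (fst z) * cos (snd z)))))"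

lemma abs_sin_diff_le: "\<bar>sin x - sin y\<bar> \<le> \<bar>x - y\<bar>" for x y :: real
proof -
  have *: "sin b - sin a \<le> b - a \<and> - (b - a) \<le> sin b - sin a" if "a \<le> b" for a b :: real
    using deriv_le_increment[of a b UNIV sin cos 1] deriv_ge_increment[of a b UNIV sin cos "-1"] that by auto
  show ?thesis using *[of x y] *[of y x] by linarith
qed

lemma abs_cos_diff_le: "\<bar>cos x - cos y\<bar> \<le> \<bar>x - y\<bar>" for x y :: real
  using abs_sin_diff_le[of "pi/2 - x" "pi/2 - y"] by (simp add: sin_diff abs_minus_commute)

text \<open>Each term is a trigonometric factor times a radial quotient bounded by \<open>L\<close>
  with Lipschitz constant \<open>3 * L\<close>, hence \<open>4 * L\<close> per term; the weight
  contributes \<open>1 + B\<close> and the two components a factor 2.\<close>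

lemma polar_flow:
  fixes H G w :: "real \<Rightarrow> real"
  assumes le: "t0 \<le> t1" and H: "L-lipschitz_on UNIV H" "H 0 = 0" and G: "L-lipschitz_on UNIV G" "G 0 = 0"
    and w: "continuous_on {t0..t1} w"
  obtains \<phi> :: "real \<times> real \<Rightarrow> real \<Rightarrow> real \<times> real"
  where "\<And>z. \<phi> z t0 = z"
    and "\<And>z t. t \<in> {t0..t1} \<Longrightarrow>
      (\<phi> z has_vector_derivative polar_field H G w t (\<phi> z t)) (at t within {t0..t1})"
    and "\<And>t. t \<in> {t0..t1} \<Longrightarrow> continuous_on UNIV (\<lambda>z. \<phi> z t)"
proof -
  have L: "L \<ge> 0" using H(1) by (rule lipschitz_on_nonneg)
  have "bounded (w ` {t0..t1})"
    using w by (intro compact_imp_bounded compact_continuous_image) auto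
  then obtain B where B: "B > 0" "\<And>t. t \<in> {t0..t1} \<Longrightarrow> \<bar>w t\<bar> \<le> B"
    by (auto simp: bounded_pos)
  have contH: "continuous_on UNIV H" "continuous_on UNIV G"
    using H G lipschitz_on_continuous_on by blast+
  have trig: "\<bar>trig x * (exp (- s) * f (exp s * trig' x)) - trig y * (exp (- s') * f (exp s' * trig' y))\<bar>
     \<le> (4 * L) * norm ((s, x) - (s', y))"
    if tr: "\<And>x. \<bar>trig x\<bar> \<le> 1" "\<And>x. \<bar>trig' x\<bar> \<le> 1"
      "\<And>x y. \<bar>trig x - trig y\<bar> \<le> \<bar>x - y\<bar>" "\<And>x y. \<bar>trig' x - trig' y\<bar> \<le> \<bar>x - y\<bar>"
      and f: "L-lipschitz_on UNIV f" "f 0 = 0" for trig trig' f :: "real \<Rightarrow> real" and s s' x y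
  proof -
    let ?d = "norm ((s, x) - (s', y))"
    have d: "\<bar>s - s'\<bar> \<le> ?d" "\<bar>x - y\<bar> \<le> ?d"
      using norm_fst_le[of "s - s'" "x - y"] norm_snd_le[of "x - y" "s - s'"] by auto
    have "\<bar>exp (- s) * f (exp s * trig' x) - exp (- s') * f (exp s' * trig' y)\<bar>
        \<le> L * \<bar>trig' x - trig' y\<bar> + 2 * L * \<bar>s - s'\<bar>"
      by (rule log_radial_lipschitz[OF f tr(2) tr(2)])
    also have "\<dots> \<le> L * ?d + 2 * L * ?d"
      using L d tr(4)[of x y] by (intro add_mono mult_left_mono) auto
    finally have "\<bar>exp (- s) * f (exp s * trig' x) - exp (- s') * f (exp s' * trig' y)\<bar> \<le> (3 * L) * ?d" by simp
    moreover have "\<bar>trig x - trig y\<bar> \<le> 1 * ?d" using tr(3)[of x y] d by simp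
    ultimately show ?thesis
      using abs_diff_mult_le[OF tr(1)[of x] log_radial_bound[OF f tr(2)[of y], of s'], of "trig y" 1 ?d
          "exp (- s) * f (exp s * trig' x)" "3 * L"] by simp
  qed
  have 1: "continuous_on ({t0..t1} \<times> UNIV) (\<lambda>(t, z). polar_field H G w t z)"
    unfolding polar_field_def case_prod_beta
    by (intro continuous_intros continuous_on_compose2[OF contH(1)] continuous_on_compose2[OF contH(2)]
        continuous_on_compose2[OF w]) auto
  have 2: "norm (polar_field H G w t z - polar_field H G w t z') \<le> (8 * L * (1 + B)) * norm (z - z')"
    if t: "t \<in> {t0..t1}" for t z z'
  proof -
    let ?d = "norm (z - z')"
    have comb: "\<bar>(p - w t * q) - (p' - w t * q')\<bar> \<le> (4 * L * (1 + B)) * ?d"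
      if "\<bar>p - p'\<bar> \<le> 4 * L * ?d" "\<bar>q - q'\<bar> \<le> 4 * L * ?d" for p q p' q'
    proof -
      have "\<bar>(p - w t * q) - (p' - w t * q')\<bar> = \<bar>(p - p') - w t * (q - q')\<bar>" by (simp add: algebra_simps)
      also have "\<dots> \<le> \<bar>p - p'\<bar> + \<bar>w t\<bar> * \<bar>q - q'\<bar>" by (metis abs_mult abs_triangle_ineq4)
      also have "\<dots> \<le> 4 * L * ?d + B * (4 * L * ?d)"
        using that B t by (intro add_mono mult_mono) auto
      finally show ?thesis by (simp add: algebra_simps)
    qed
    obtain s x where z: "z = (s, x)" by fastforce
    obtain s' y where z': "z' = (s', y)" by fastforce
    note T = abs_sin_le_one abs_cos_le_one abs_sin_diff_le abs_cos_diff_le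
    have "\<bar>fst (polar_field H G w t z - polar_field H G w t z')\<bar> \<le> (4 * L * (1 + B)) * ?d"
      unfolding polar_field_def fst_diff fst_conv z z' snd_conv
      by (rule comb[unfolded z z']; rule trig[unfolded z z']; fact T H G)
    moreover have "\<bar>snd (polar_field H G w t z - polar_field H G w t z')\<bar> \<le> (4 * L * (1 + B)) * ?d"
      unfolding polar_field_def snd_diff fst_conv z z' snd_conv
      apply (rule comb[unfolded z z'])
      subgoal
        using trig[of sin sin H x s y s'] T H by (simp add: abs_minus_commute)
      subgoal by (rule trig; fact T G)
      done
    ultimately show ?thesis
      using norm_Pair_le[of "fst (polar_field H G w t z - polar_field H G w t z')"
          "snd (polar_field H G w t z - polar_field H G w t z')"]
      unfolding prod.collapse real_norm_def by linarith
  qed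
  have 3: "0 \<le> 8 * L * (1 + B)" using L B by simp
  show thesis
    by (rule picard_flow[OF le 3 1 2]) (assumption | rule that)+
qed

section \<open>The saddle phase\<close>

text \<open>The sign part of \<open>(C_0)\<close>. It survives truncation, reflection and rescaling;
  the slope at the origin is carried separately, as a quantitative bound on a small
  interval.\<close>

definition restoring :: "(real \<Rightarrow> real) \<Rightarrow> bool" where
  "restoring f \<longleftrightarrow> f 0 = 0 \<and> (\<forall>x. x \<noteq> 0 \<longrightarrow> f x * x > 0)"

text \<open>Writing \<open>f v = v * r\<close> with \<open>r \<ge> 0\<close>, passing from
  \<open>v\<close> to \<open>f v\<close> multiplies the product by \<open>r\<close>. Thus the signs
  of \<open>x * H y\<close> and \<open>w * (y * G x)\<close> are read off from that of
  \<open>x * y\<close>.\<close>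

lemma restoring_mult_sign:
  assumes f: "restoring f"
  shows "0 \<le> c * (u * v) \<Longrightarrow> 0 \<le> c * (u * f v)" "c * (u * v) \<le> 0 \<Longrightarrow> c * (u * f v) \<le> 0"
proof -
  have "\<exists>r\<ge>0. f v = v * r"
  proof (cases "v = 0")
    case True
    then show ?thesis using f by (auto simp: restoring_def)
  next
    case False
    then have "f v * v > 0" using f by (auto simp: restoring_def)
    then have "f v / v > 0" by (simp add: zero_less_mult_iff zero_less_divide_iff)
    then show ?thesis using False by (intro exI[of _ "f v / v"]) auto
  qed
  then obtain r where "r \<ge> 0" "f v = v * r" by blast
  then have r: "c * (u * f v) = c * (u * v) * r" "r \<ge> 0" by simp_all
  show "0 \<le> c * (u * f v)" if "0 \<le> c * (u * v)"
    unfolding r(1) using that r(2) by (rule mult_nonneg_nonneg)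
  show "c * (u * f v) \<le> 0" if "c * (u * v) \<le> 0"
    unfolding r(1) using that r(2) by (rule mult_nonpos_nonneg)
qed

lemma restoring_nonneg: "restoring f \<Longrightarrow> 0 \<le> v \<Longrightarrow> 0 \<le> f v"
  using restoring_mult_sign(1)[of f 1 1 v] by simp

lemma restoring_nonpos: "restoring f \<Longrightarrow> v \<le> 0 \<Longrightarrow> f v \<le> 0"
  using restoring_mult_sign(2)[of f 1 1 v] by simp

lemma restoring_self: "restoring f \<Longrightarrow> 0 \<le> v * f v"
  using restoring_mult_sign(1)[of f 1 v v] by simp

lemma restoring_reflect: "restoring f \<Longrightarrow> restoring (\<lambda>v. - f (- v))"
proof -
  assume f: "restoring f"
  have "f (- v) * (- v) > 0" if "v \<noteq> 0" for v
    using f that unfolding restoring_def by (metis neg_equal_0_iff_equal)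
  then show ?thesis using f by (simp add: restoring_def)
qed

text \<open>Compactness of \<open>[p, q]\<close>, for \<open>f\<close> and for its reflection. These
  minima are the guaranteed speeds of orbits away from the axes.\<close>

lemma restoring_lower_bound:
  assumes f: "restoring f" "continuous_on UNIV f" and p: "0 < p"
  obtains m where "m > 0" "\<And>v. p \<le> \<bar>v\<bar> \<Longrightarrow> \<bar>v\<bar> \<le> q \<Longrightarrow> m \<le> \<bar>f v\<bar>"
proof -
  have *: "\<exists>m>0. \<forall>v. p \<le> v \<and> v \<le> q \<longrightarrow> m \<le> \<bar>k v\<bar>"
    if k: "continuous_on UNIV k" "\<And>v. p \<le> v \<Longrightarrow> k v \<noteq> 0" for k :: "real \<Rightarrow> real"
  proof (cases "p \<le> q")
    case True
    have "continuous_on {p..q} (\<lambda>v. \<bar>k v\<bar>)"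
      by (intro continuous_on_rabs continuous_on_subset[OF k(1)]) simp
    then obtain z where z: "z \<in> {p..q}" "\<forall>v\<in>{p..q}. \<bar>k z\<bar> \<le> \<bar>k v\<bar>"
      using continuous_attains_inf[of "{p..q}" "\<lambda>v. \<bar>k v\<bar>"] True by fastforce
    then show ?thesis using k(2)[of z] by (intro exI[of _ "\<bar>k z\<bar>"]) simp
  next
    case False
    then show ?thesis by (intro exI[of _ 1]) simp
  qed
  have ne: "f v \<noteq> 0" if "v \<noteq> 0" for v
    using f(1) that unfolding restoring_def by (metis less_irrefl mult_zero_left)
  obtain m1 where m1: "m1 > 0" "\<And>v. p \<le> v \<Longrightarrow> v \<le> q \<Longrightarrow> m1 \<le> \<bar>f v\<bar>"
    using *[OF f(2)] ne p by (metis less_irrefl order_less_le_trans)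
  have "continuous_on UNIV (\<lambda>v. f (- v))"
    by (rule continuous_on_compose2[OF f(2)]) (auto intro: continuous_intros)
  then obtain m2 where m2: "m2 > 0" "\<And>v. p \<le> v \<Longrightarrow> v \<le> q \<Longrightarrow> m2 \<le> \<bar>f (- v)\<bar>"
    using *[of "\<lambda>v. f (- v)"] ne p by (metis less_irrefl neg_equal_0_iff_equal order_less_le_trans)
  show thesis
  proof (rule that[of "min m1 m2"])
    show "min m1 m2 > 0" using m1 m2 by simp
    show "min m1 m2 \<le> \<bar>f v\<bar>" if "p \<le> \<bar>v\<bar>" "\<bar>v\<bar> \<le> q" for v
      using m1(2)[of v] m2(2)[of "- v"] that by (cases "0 \<le> v") auto
  qed
qed

locale planar_solution =
  fixes H G w x y :: "real \<Rightarrow> real" and t0 t1 :: real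
  assumes H: "restoring H" and G: "restoring G"
    and dx: "\<And>t. t \<in> {t0..t1} \<Longrightarrow> (x has_real_derivative H (y t)) (at t within {t0..t1})"
    and dy: "\<And>t. t \<in> {t0..t1} \<Longrightarrow> (y has_real_derivative - w t * G (x t)) (at t within {t0..t1})"
begin

text \<open>Carries statements about the first and fourth quadrants to the third and second.\<close>

lemma reflected: "planar_solution (\<lambda>v. - H (- v)) (\<lambda>v. - G (- v)) w (\<lambda>t. - x t) (\<lambda>t. - y t) t0 t1"
  by unfold_locales (auto intro!: restoring_reflect H G derivative_eq_intros dx dy)

lemma continuous_x: "continuous_on {t0..t1} x" and continuous_y: "continuous_on {t0..t1} y"
  by (rule DERIV_continuous_on, rule dx dy, assumption)+

text \<open>Squares make the monotonicity of the moduli depend only on the signs of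
  \<open>x * y\<close> and of the weight, in all quadrants alike.\<close>

lemma dx2: "t \<in> {t0..t1} \<Longrightarrow> ((\<lambda>t. (x t)\<^sup>2) has_real_derivative 2 * (x t * H (y t))) (at t within {t0..t1})"
  by (auto intro!: derivative_eq_intros dx)

lemma dy2: "t \<in> {t0..t1} \<Longrightarrow> ((\<lambda>t. (y t)\<^sup>2) has_real_derivative - 2 * (w t * (y t * G (x t)))) (at t within {t0..t1})"
  by (auto intro!: derivative_eq_intros dy)

context
  fixes t t' assumes tt: "t0 \<le> t" "t \<le> t'" "t' \<le> t1"
begin

lemma sub: "{t..t'} \<subseteq> {t0..t1}" using tt by auto

lemma abs_x_le:
  assumes "\<And>r. r \<in> {t..t'} \<Longrightarrow> 0 \<le> x r * y r"
  shows "\<bar>x t\<bar> \<le> \<bar>x t'\<bar>"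
proof -
  have "0 * (t' - t) \<le> (x t')\<^sup>2 - (x t)\<^sup>2"
    by (rule deriv_ge_increment[OF tt(2) sub dx2])
       (use assms restoring_mult_sign(1)[OF H, of 1] in auto)
  then show ?thesis by (simp add: abs_le_square_iff)
qed

lemma abs_x_ge:
  assumes "\<And>r. r \<in> {t..t'} \<Longrightarrow> x r * y r \<le> 0"
  shows "\<bar>x t'\<bar> \<le> \<bar>x t\<bar>"
proof -
  have "(x t')\<^sup>2 - (x t)\<^sup>2 \<le> 0 * (t' - t)"
    by (rule deriv_le_increment[OF tt(2) sub dx2])
       (use assms restoring_mult_sign(2)[OF H, of 1] in auto)
  then show ?thesis by (simp add: abs_le_square_iff)
qed

lemma abs_y_ge:
  assumes "\<And>r. r \<in> {t..t'} \<Longrightarrow> 0 \<le> w r * (x r * y r)"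
  shows "\<bar>y t'\<bar> \<le> \<bar>y t\<bar>"
proof -
  have "(y t')\<^sup>2 - (y t)\<^sup>2 \<le> 0 * (t' - t)"
    by (rule deriv_le_increment[OF tt(2) sub dy2])
       (use assms restoring_mult_sign(1)[OF G] in \<open>auto simp: mult.commute mult.left_commute\<close>)
  then show ?thesis by (simp add: abs_le_square_iff)
qed

lemma abs_y_le:
  assumes "\<And>r. r \<in> {t..t'} \<Longrightarrow> w r * (x r * y r) \<le> 0"
  shows "\<bar>y t\<bar> \<le> \<bar>y t'\<bar>"
proof -
  have "0 * (t' - t) \<le> (y t')\<^sup>2 - (y t)\<^sup>2"
    by (rule deriv_ge_increment[OF tt(2) sub dy2])
       (use assms restoring_mult_sign(2)[OF G] in \<open>auto simp: mult.commute mult.left_commute\<close>)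
  then show ?thesis by (simp add: abs_le_square_iff)
qed

lemma x_diff_le:
  assumes "\<And>r. r \<in> {t..t'} \<Longrightarrow> \<bar>H (y r)\<bar> \<le> K"
  shows "\<bar>x t' - x t\<bar> \<le> K * (t' - t)"
proof -
  have "- K * (t' - t) \<le> x t' - x t"
    by (rule deriv_ge_increment[OF tt(2) sub dx]) (use assms in \<open>auto simp: abs_le_iff minus_le_iff\<close>)
  moreover have "x t' - x t \<le> K * (t' - t)"
    by (rule deriv_le_increment[OF tt(2) sub dx]) (use assms in \<open>auto simp: abs_le_iff\<close>)
  ultimately show ?thesis by (simp add: abs_le_iff)
qed

lemma y_diff_le:
  assumes "\<And>r. r \<in> {t..t'} \<Longrightarrow> \<bar>G (x r)\<bar> \<le> K" "\<And>r. r \<in> {t..t'} \<Longrightarrow> \<bar>w r\<bar> \<le> W" "0 \<le> W"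
  shows "\<bar>y t' - y t\<bar> \<le> W * K * (t' - t)"
proof -
  have *: "\<bar>w r * G (x r)\<bar> \<le> W * K" if "r \<in> {t..t'}" for r
    unfolding abs_mult using assms that by (intro mult_mono) auto
  have "- (W * K) * (t' - t) \<le> y t' - y t"
    by (rule deriv_ge_increment[OF tt(2) sub dy]) (use * in \<open>auto simp: abs_le_iff minus_le_iff\<close>)
  moreover have "y t' - y t \<le> W * K * (t' - t)"
    by (rule deriv_le_increment[OF tt(2) sub dy]) (use * in \<open>auto simp: abs_le_iff minus_le_iff\<close>)
  ultimately show ?thesis by (simp add: abs_le_iff)
qed

end

end

text \<open>On the interval where the weight is nonpositive the product \<open>x y\<close> is nondecreasing, so an
  orbit can only pass from the second or fourth to the first or third quadrant.\<close>

locale saddle_solution = planar_solution +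
  assumes le: "t0 \<le> t1" and w: "\<And>t. t \<in> {t0..t1} \<Longrightarrow> w t \<le> 0"
begin

lemma reflected: "saddle_solution (\<lambda>v. - H (- v)) (\<lambda>v. - G (- v)) w (\<lambda>t. - x t) (\<lambda>t. - y t) t0 t1"
  using reflected le w by (simp add: saddle_solution_def saddle_solution_axioms_def)

text \<open>The derivative is \<open>H y * y - w * (x * G x)\<close>, where both
  \<open>H y * y\<close> and \<open>- w * (x * G x)\<close> are nonnegative because
  \<open>w \<le> 0\<close>.\<close>

lemma product_mono:
  assumes "t0 \<le> t" "t \<le> t'" "t' \<le> t1"
  shows "x t * y t \<le> x t' * y t'"
proof -
  have "0 * (t' - t) \<le> x t' * y t' - x t * y t"
  proof (rule deriv_ge_increment[OF assms(2)])
    show "{t..t'} \<subseteq> {t0..t1}" using assms by auto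
    show "((\<lambda>t. x t * y t) has_real_derivative H (y r) * y r - w r * (x r * G (x r))) (at r within {t0..t1})"
      if "r \<in> {t0..t1}" for r using that by (auto intro!: derivative_eq_intros dx dy simp: algebra_simps)
    fix r assume "r \<in> {t..t'}"
    then have "w r \<le> 0" using assms w by auto
    then show "0 \<le> H (y r) * y r - w r * (x r * G (x r))"
      using restoring_self[OF H, of "y r"] mult_nonpos_nonneg[OF _ restoring_self[OF G, of "x r"], of "w r"]
      by (simp add: mult.commute[of "H (y r)"])
  qed
  then show ?thesis by simp
qed

lemma abs_mono:
  assumes "t0 \<le> t" "t \<le> t'" "t' \<le> t1" "0 \<le> x t * y t"
  shows "\<bar>x t\<bar> \<le> \<bar>x t'\<bar>" "\<bar>y t\<bar> \<le> \<bar>y t'\<bar>"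
proof -
  have p: "0 \<le> x r * y r" if "r \<in> {t..t'}" for r
    using product_mono[of t r] assms that by auto
  show "\<bar>x t\<bar> \<le> \<bar>x t'\<bar>" by (rule abs_x_le) (use p assms in auto)
  show "\<bar>y t\<bar> \<le> \<bar>y t'\<bar>"
    by (rule abs_y_le) (use p assms w in \<open>auto simp: mult_nonpos_nonneg\<close>)
qed

lemma abs_antimono:
  assumes "t0 \<le> t" "t \<le> t'" "t' \<le> t1" "x t' * y t' \<le> 0"
  shows "\<bar>x t'\<bar> \<le> \<bar>x t\<bar>" "\<bar>y t'\<bar> \<le> \<bar>y t\<bar>"
proof -
  have p: "x r * y r \<le> 0" if "r \<in> {t..t'}" for r
    using product_mono[of r t'] assms that by auto
  show "\<bar>x t'\<bar> \<le> \<bar>x t\<bar>" by (rule abs_x_ge) (use p assms in auto)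
  show "\<bar>y t'\<bar> \<le> \<bar>y t\<bar>"
    by (rule abs_y_ge) (use p assms w in \<open>auto simp: mult_nonpos_nonpos\<close>)
qed

text \<open>The sign of \<open>x * y\<close> changes at most from negative to positive, so each
  modulus decreases and then increases; its maximum is at an endpoint.\<close>

lemma abs_le_endpoints:
  assumes t: "t \<in> {t0..t1}"
  shows "\<bar>x t\<bar> \<le> max \<bar>x t0\<bar> \<bar>x t1\<bar>" "\<bar>y t\<bar> \<le> max \<bar>y t0\<bar> \<bar>y t1\<bar>"
proof -
  have t': "t0 \<le> t" "t \<le> t1" using t by auto
  have "\<bar>x t\<bar> \<le> max \<bar>x t0\<bar> \<bar>x t1\<bar> \<and> \<bar>y t\<bar> \<le> max \<bar>y t0\<bar> \<bar>y t1\<bar>"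
  proof (cases "0 \<le> x t * y t")
    case True
    from abs_mono[OF t' order_refl True] show ?thesis by (simp add: le_max_iff_disj)
  next
    case False
    then have "x t * y t \<le> 0" by simp
    from abs_antimono[OF order_refl t' this] show ?thesis by (simp add: le_max_iff_disj)
  qed
  then show "\<bar>x t\<bar> \<le> max \<bar>x t0\<bar> \<bar>x t1\<bar>" "\<bar>y t\<bar> \<le> max \<bar>y t0\<bar> \<bar>y t1\<bar>" by simp_all
qed

lemma nonvanishing_sign:
  assumes "\<And>t. t \<in> {t0..t1} \<Longrightarrow> x t \<noteq> 0" "t \<in> {t0..t1}" "t' \<in> {t0..t1}" "0 < x t"
  shows "0 < x t'"
proof (rule ccontr)
  assume "\<not> 0 < x t'"
  then have "x t' \<le> 0" by simp
  have cont: "continuous_on {min t t'..max t t'} x"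
    by (rule continuous_on_subset[OF continuous_x]) (use assms in auto)
  have "\<exists>r. min t t' \<le> r \<and> r \<le> max t t' \<and> x r = 0"
  proof (cases "t \<le> t'")
    case True
    then show ?thesis using IVT2'[of x t' 0 t] cont \<open>x t' \<le> 0\<close> assms by auto
  next
    case False
    then show ?thesis using IVT'[of x t' 0 t] cont \<open>x t' \<le> 0\<close> assms by auto
  qed
  then obtain r where "min t t' \<le> r" "r \<le> max t t'" "x r = 0" by blast
  moreover from this have "t0 \<le> r" "r \<le> t1" using assms(2,3) by (auto simp: min_le_iff_disj le_max_iff_disj)
  ultimately show False using assms(1)[of r] by simp
qed

end

text \<open>A coordinate that starts positive cannot reach 0, since its modulus does not decrease;
  the nonnegative product then fixes the sign of the other one. A start on the \<open>y\<close> axis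
  exchanges the roles.\<close>

lemma (in saddle_solution) first_quadrant_invariant:
  assumes "0 \<le> x t0" "0 \<le> y t0" "x t0 \<noteq> 0 \<or> y t0 \<noteq> 0" "t \<in> {t0..t1}"
  shows "0 \<le> x t \<and> 0 \<le> y t"
proof -
  have prod: "0 \<le> x r * y r" if "r \<in> {t0..t1}" for r
    using product_mono[of t0 r] assms that by (auto intro: order_trans[OF mult_nonneg_nonneg])
  have mono: "\<bar>x t0\<bar> \<le> \<bar>x r\<bar>" "\<bar>y t0\<bar> \<le> \<bar>y r\<bar>" if "r \<in> {t0..t1}" for r
    using abs_mono[of t0 r] assms that by auto
  show ?thesis
  proof (cases "x t0 = 0")
    case False
    then have "x r \<noteq> 0" if "r \<in> {t0..t1}" for r using mono[OF that] by auto
    then have "0 < x t" using nonvanishing_sign[of t0 t] assms le False by auto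
    then show ?thesis using prod[OF assms(4)] by (simp add: zero_le_mult_iff)
  next
    case True
    then have y0: "y t0 > 0" using assms by auto
    then have ny: "y r \<noteq> 0" if "r \<in> {t0..t1}" for r using mono[OF that] by auto
    have "0 < y t"
    proof (rule ccontr)
      assume "\<not> 0 < y t"
      then obtain r where "t0 \<le> r" "r \<le> t" "y r = 0"
        using IVT2'[of y t 0 t0] continuous_on_subset[OF continuous_y, of "{t0..t}"] y0 assms by auto
      then show False using ny[of r] assms by auto
    qed
    then show ?thesis using prod[OF assms(4)] by (simp add: zero_le_mult_iff)
  qed
qed

lemma (in saddle_solution) third_quadrant_invariant:
  assumes "x t0 \<le> 0" "y t0 \<le> 0" "x t0 \<noteq> 0 \<or> y t0 \<noteq> 0" "t \<in> {t0..t1}"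
  shows "x t \<le> 0 \<and> y t \<le> 0"
  using saddle_solution.first_quadrant_invariant[OF reflected, of t] assms by auto

text \<open>Were the endpoint in the box of size \<open>R\<close>, monotonicity would keep the whole
  orbit there and the lower bounds would apply. Up to \<open>\<tau>1\<close> the velocity
  \<open>H y\<close> carries \<open>x\<close> away from the \<open>y\<close> axis, and on
  \<open>[\<tau>1, \<tau>2]\<close> this \<open>x\<close> drives \<open>y\<close> past
  \<open>R\<close>.\<close>

lemma (in saddle_solution) expands_in_first_quadrant:
  assumes \<tau>: "t0 < \<tau>1" "\<tau>1 < \<tau>2" "\<tau>2 < t1" and \<kappa>: "\<And>t. t \<in> {\<tau>1..\<tau>2} \<Longrightarrow> w t \<le> - \<kappa>" "0 \<le> \<kappa>"
    and start: "0 \<le> x t0" "0 \<le> y t0" "r0 \<le> x t0 \<or> r0 \<le> y t0" and r0: "0 < r0"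
    and mH: "0 < mH" "\<And>v. r0 \<le> \<bar>v\<bar> \<Longrightarrow> \<bar>v\<bar> \<le> R \<Longrightarrow> mH \<le> \<bar>H v\<bar>"
    and mG: "0 < mG" "\<And>v. min r0 ((\<tau>1 - t0) * mH) \<le> \<bar>v\<bar> \<Longrightarrow> \<bar>v\<bar> \<le> R \<Longrightarrow> mG \<le> \<bar>G v\<bar>"
    and large: "R < \<kappa> * mG * (\<tau>2 - \<tau>1)"
  shows "R < x t1 \<or> R < y t1"
proof (rule ccontr)
  assume "\<not> ?thesis"
  then have end_le: "x t1 \<le> R" "y t1 \<le> R" by auto
  have q1: "0 \<le> x t" "0 \<le> y t" if "t \<in> {t0..t1}" for t
    using first_quadrant_invariant[of t] start r0 that by auto
  have mono: "x t \<le> x t'" "y t \<le> y t'" if "t0 \<le> t" "t \<le> t'" "t' \<le> t1" for t t'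
    using abs_mono[of t t'] q1[of t] q1[of t'] that by auto
  have x1: "min r0 ((\<tau>1 - t0) * mH) \<le> x \<tau>1"
  proof (cases "r0 \<le> x t0")
    case True
    then show ?thesis using mono(1)[of t0 \<tau>1] \<tau> by auto
  next
    case False
    then have y0: "r0 \<le> y t0" using start by auto
    have "mH * (\<tau>1 - t0) \<le> x \<tau>1 - x t0"
    proof (rule deriv_ge_increment[OF _ _ dx])
      fix t assume t: "t \<in> {t0..\<tau>1}"
      then have "y t0 \<le> y t" "y t \<le> y t1" "0 \<le> y t" using mono \<tau> q1 by auto
      then show "mH \<le> H (y t)"
        using mH(2)[of "y t"] y0 r0 end_le restoring_nonneg[OF H, of "y t"] by auto
    qed (use \<tau> in auto)
    then show ?thesis using start by (simp add: mult.commute)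
  qed
  have "\<kappa> * mG * (\<tau>2 - \<tau>1) \<le> y \<tau>2 - y \<tau>1"
  proof (rule deriv_ge_increment[OF _ _ dy])
    fix t assume t: "t \<in> {\<tau>1..\<tau>2}"
    then have "x \<tau>1 \<le> x t" "x t \<le> x t1" "0 \<le> x t" using mono \<tau> q1 by auto
    then have "mG \<le> G (x t)"
      using mG(2)[of "x t"] x1 end_le restoring_nonneg[OF G, of "x t"] by auto
    then have "\<kappa> * mG \<le> (- w t) * G (x t)"
      using \<kappa>(1)[OF t] \<kappa>(2) mG(1) by (intro mult_mono) auto
    then show "\<kappa> * mG \<le> - w t * G (x t)" by simp
  qed (use \<tau> in auto)
  moreover have "y \<tau>2 \<le> y t1" "0 \<le> y \<tau>1" using mono(2)[of \<tau>2 t1] q1[of \<tau>1] \<tau> by auto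
  ultimately show False using large end_le by linarith
qed

text \<open>The expansion argument backwards in time. If \<open>x\<close> were not small at
  \<open>\<tau>2\<close>, then \<open>y\<close>, starting no lower than \<open>- R\<close>, would be
  above 0 by then; and if \<open>y\<close> stayed at or below \<open>- r\<close> up to
  \<open>t1\<close>, the remaining small \<open>x\<close> would be used up.\<close>

lemma (in saddle_solution) contracts_in_fourth_quadrant:
  assumes \<tau>: "t0 < \<tau>1" "\<tau>1 < \<tau>2" "\<tau>2 < t1" and \<kappa>: "\<And>t. t \<in> {\<tau>1..\<tau>2} \<Longrightarrow> w t \<le> - \<kappa>" "0 \<le> \<kappa>"
    and start: "\<bar>x t0\<bar> \<le> R" "\<bar>y t0\<bar> \<le> R" and r: "0 < r"
    and mH: "0 < mH" "\<And>v. r \<le> \<bar>v\<bar> \<Longrightarrow> \<bar>v\<bar> \<le> R \<Longrightarrow> mH \<le> \<bar>H v\<bar>"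
    and mG: "0 < mG" "\<And>v. min r ((t1 - \<tau>2) * mH) \<le> \<bar>v\<bar> \<Longrightarrow> \<bar>v\<bar> \<le> R \<Longrightarrow> mG \<le> \<bar>G v\<bar>"
    and large: "R < \<kappa> * mG * (\<tau>2 - \<tau>1)"
    and neg: "0 < x t1" "y t1 < 0"
  shows "\<bar>x t1\<bar> < r \<and> \<bar>y t1\<bar> < r"
proof -
  have prod: "x t * y t < 0" if "t \<in> {t0..t1}" for t
    using product_mono[of t t1] that neg mult_pos_neg[OF neg] by auto
  have x: "0 < x t" if "t \<in> {t0..t1}" for t
    using nonvanishing_sign[of t1 t] prod neg le that by fastforce
  have y: "y t < 0" if "t \<in> {t0..t1}" for t
    using prod[OF that] x[OF that] by (simp add: mult_less_0_iff)
  have mono: "x t' \<le> x t" "y t \<le> y t'" if "t0 \<le> t" "t \<le> t'" "t' \<le> t1" for t t'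
    using abs_antimono[of t t'] prod[of t'] x[of t] x[of t'] y[of t] y[of t'] that by auto
  have x2: "x \<tau>2 < min r ((t1 - \<tau>2) * mH)"
  proof (rule ccontr)
    assume far: "\<not> ?thesis"
    have "\<kappa> * mG * (\<tau>2 - \<tau>1) \<le> y \<tau>2 - y \<tau>1"
    proof (rule deriv_ge_increment[OF _ _ dy])
      fix t assume t: "t \<in> {\<tau>1..\<tau>2}"
      then have "x \<tau>2 \<le> x t" "x t \<le> x t0" "0 \<le> x t" using mono \<tau> x[of t] by auto
      then have "mG \<le> G (x t)"
        using mG(2)[of "x t"] far start restoring_nonneg[OF G, of "x t"] by auto
      then have "\<kappa> * mG \<le> (- w t) * G (x t)"
        using \<kappa>(1)[OF t] \<kappa>(2) mG(1) by (intro mult_mono) auto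
      then show "\<kappa> * mG \<le> - w t * G (x t)" by simp
    qed (use \<tau> in auto)
    moreover have "y \<tau>2 < 0" "y t0 \<le> y \<tau>1" using mono(2)[of t0 \<tau>1] y[of \<tau>2] \<tau> by auto
    ultimately show False using large start by linarith
  qed
  have "\<bar>y t1\<bar> < r"
  proof (rule ccontr)
    assume far: "\<not> ?thesis"
    have "x t1 - x \<tau>2 \<le> - mH * (t1 - \<tau>2)"
    proof (rule deriv_le_increment[OF _ _ dx])
      fix t assume t: "t \<in> {\<tau>2..t1}"
      then have "y t \<le> y t1" "y t0 \<le> y t" "y t < 0" using mono \<tau> y[of t] by auto
      then show "H (y t) \<le> - mH"
        using mH(2)[of "y t"] far neg(2) start restoring_nonpos[OF H, of "y t"] by auto
    qed (use \<tau> in auto)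
    then show False using x2 neg by (simp add: mult.commute)
  qed
  moreover have "x t1 \<le> x \<tau>2" using mono(1)[of \<tau>2 t1] \<tau> by auto
  ultimately show ?thesis using x2 neg by auto
qed

lemma (in saddle_solution) contracts_off_diagonal_quadrants:
  assumes \<tau>: "t0 < \<tau>1" "\<tau>1 < \<tau>2" "\<tau>2 < t1" and \<kappa>: "\<And>t. t \<in> {\<tau>1..\<tau>2} \<Longrightarrow> w t \<le> - \<kappa>" "0 \<le> \<kappa>"
    and start: "\<bar>x t0\<bar> \<le> R" "\<bar>y t0\<bar> \<le> R" and r: "0 < r"
    and mH: "0 < mH" "\<And>v. r \<le> \<bar>v\<bar> \<Longrightarrow> \<bar>v\<bar> \<le> R \<Longrightarrow> mH \<le> \<bar>H v\<bar>"
    and mG: "0 < mG" "\<And>v. min r ((t1 - \<tau>2) * mH) \<le> \<bar>v\<bar> \<Longrightarrow> \<bar>v\<bar> \<le> R \<Longrightarrow> mG \<le> \<bar>G v\<bar>"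
    and large: "R < \<kappa> * mG * (\<tau>2 - \<tau>1)"
    and neg: "x t1 * y t1 < 0"
  shows "\<bar>x t1\<bar> < r \<and> \<bar>y t1\<bar> < r"
proof (cases "0 < x t1")
  case True
  then have "y t1 < 0" using neg by (simp add: mult_less_0_iff)
  then show ?thesis
    using contracts_in_fourth_quadrant[OF \<tau> \<kappa> start r mH mG large] True by blast
next
  case False
  then have "x t1 < 0" "0 < y t1" using neg by (auto simp: mult_less_0_iff)
  then show ?thesis
    using saddle_solution.contracts_in_fourth_quadrant[OF reflected \<tau> \<kappa>, of R r mH mG]
      start r mH mG large by auto
qed

section \<open>The rotation phase\<close>

text \<open>Bound for the radius at one end of a passage through a quadrant by the radius at the
  other: \<open>M\<close> majorises both nonlinearities, \<open>C\<close> covers time and weight,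
  and the 2 comes from comparing the radius with the sum of the moduli of the coordinates.\<close>

definition growth :: "real \<Rightarrow> (real \<Rightarrow> real) \<Rightarrow> real \<Rightarrow> real" where
  "growth C M u = 2 * u + C * M u"

locale polar_solution =
  fixes H G w s \<theta> :: "real \<Rightarrow> real" and t0 t1 :: real
  assumes restoring_H: "restoring H" and restoring_G: "restoring G" and t01: "t0 \<le> t1"
    and ds: "\<And>t. t \<in> {t0..t1} \<Longrightarrow>
      (s has_real_derivative fst (polar_field H G w t (s t, \<theta> t))) (at t within {t0..t1})"
    and d\<theta>: "\<And>t. t \<in> {t0..t1} \<Longrightarrow>
      (\<theta> has_real_derivative snd (polar_field H G w t (s t, \<theta> t))) (at t within {t0..t1})"
begin

abbreviation x :: "real \<Rightarrow> real" where "x \<equiv> \<lambda>t. exp (s t) * cos (\<theta> t)"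
abbreviation y :: "real \<Rightarrow> real" where "y \<equiv> \<lambda>t. exp (s t) * sin (\<theta> t)"

sublocale planar_solution H G w x y t0 t1
proof
  have cs: "(cos a)\<^sup>2 + (sin a)\<^sup>2 = (1::real)" for a by simp
  have radial: "e * (c * p - v * (i * q)) * c + e * (- i * (- (i * p) - v * (c * q))) = (e * p) * (c\<^sup>2 + i\<^sup>2)"
    and angular: "e * (c * p - v * (i * q)) * i + e * (c * (- (i * p) - v * (c * q))) = - v * ((e * q) * (c\<^sup>2 + i\<^sup>2))"
    for e c i p q v :: real by (simp_all add: algebra_simps power2_eq_square)
  fix t assume t: "t \<in> {t0..t1}"
  let ?e = "exp (s t)" and ?c = "cos (\<theta> t)" and ?i = "sin (\<theta> t)"
  let ?p = "exp (- s t) * H (?e * ?i)" and ?q = "exp (- s t) * G (?e * ?c)"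
  have p: "?e * ?p = H (?e * ?i)" and q: "?e * ?q = G (?e * ?c)"
    by (simp_all add: exp_minus)
  have "(x has_real_derivative ?e * (?c * ?p - w t * (?i * ?q)) * ?c
        + ?e * (- ?i * (- (?i * ?p) - w t * (?c * ?q)))) (at t within {t0..t1})"
    using ds[OF t] d\<theta>[OF t] by (auto intro!: derivative_eq_intros simp: polar_field_def)
  moreover have "?e * (?c * ?p - w t * (?i * ?q)) * ?c + ?e * (- ?i * (- (?i * ?p) - w t * (?c * ?q)))
     = (?e * ?p) * (?c\<^sup>2 + ?i\<^sup>2)" by (rule radial)
  ultimately show "(x has_real_derivative H (y t)) (at t within {t0..t1})"
    unfolding p cs by simp
  have "(y has_real_derivative ?e * (?c * ?p - w t * (?i * ?q)) * ?i
        + ?e * (?c * (- (?i * ?p) - w t * (?c * ?q)))) (at t within {t0..t1})"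
    using ds[OF t] d\<theta>[OF t] by (auto intro!: derivative_eq_intros simp: polar_field_def)
  moreover have "?e * (?c * ?p - w t * (?i * ?q)) * ?i + ?e * (?c * (- (?i * ?p) - w t * (?c * ?q)))
     = - w t * ((?e * ?q) * (?c\<^sup>2 + ?i\<^sup>2))" by (rule angular)
  ultimately show "(y has_real_derivative - w t * G (x t)) (at t within {t0..t1})"
    unfolding q cs by simp
qed (fact restoring_H restoring_G)+

lemma abs_xy_le: "\<bar>x t\<bar> \<le> exp (s t)" "\<bar>y t\<bar> \<le> exp (s t)"
  using mult_left_mono[OF abs_cos_le_one, of "exp (s t)" "\<theta> t"]
    mult_left_mono[OF abs_sin_le_one, of "exp (s t)" "\<theta> t"] by (simp_all add: abs_mult)

lemma exp_le_abs_sum: "exp (s t) \<le> \<bar>x t\<bar> + \<bar>y t\<bar>"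
proof -
  have sq: "z\<^sup>2 \<le> \<bar>z\<bar>" if "\<bar>z\<bar> \<le> 1" for z :: real
    using mult_left_le[of "\<bar>z\<bar>" "\<bar>z\<bar>"] that by (simp add: power2_eq_square)
  have "1 \<le> \<bar>cos (\<theta> t)\<bar> + \<bar>sin (\<theta> t)\<bar>"
    using sin_cos_squared_add[of "\<theta> t"] sq[OF abs_cos_le_one[of "\<theta> t"]] sq[OF abs_sin_le_one[of "\<theta> t"]]
    by linarith
  then have "exp (s t) * 1 \<le> exp (s t) * (\<bar>cos (\<theta> t)\<bar> + \<bar>sin (\<theta> t)\<bar>)"
    by (intro mult_left_mono) simp_all
  then show ?thesis by (simp add: abs_mult distrib_left)
qed

lemma continuous_\<theta>: "continuous_on {t0..t1} \<theta>"
  by (rule DERIV_continuous_on, rule d\<theta>)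

text \<open>Lipschitz functions vanishing at 0 are at most linear, so the logarithm of the radius
  moves with bounded speed and the radius changes by at most a fixed factor.\<close>

lemma abs_s_diff_le:
  assumes L: "L-lipschitz_on UNIV H" "L-lipschitz_on UNIV G"
    and W: "\<And>t. t \<in> {t0..t1} \<Longrightarrow> \<bar>w t\<bar> \<le> W" and t: "t \<in> {t0..t1}"
  shows "\<bar>s t - s t0\<bar> \<le> L * (1 + W) * (t1 - t0)"
proof -
  have L0: "0 \<le> L" using L(1) by (rule lipschitz_on_nonneg)
  have W0: "0 \<le> W" using W[of t0] t01 by auto
  have 0: "H 0 = 0" "G 0 = 0" using restoring_H restoring_G by (auto simp: restoring_def)
  have b: "\<bar>fst (polar_field H G w r (s r, \<theta> r))\<bar> \<le> L * (1 + W)" if r: "r \<in> {t0..t1}" for r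
  proof -
    have p: "\<bar>exp (- s r) * H (exp (s r) * sin (\<theta> r))\<bar> \<le> L" (is "\<bar>?p\<bar> \<le> L")
      by (rule log_radial_bound[OF L(1) 0(1)]) simp
    have q: "\<bar>exp (- s r) * G (exp (s r) * cos (\<theta> r))\<bar> \<le> L" (is "\<bar>?q\<bar> \<le> L")
      by (rule log_radial_bound[OF L(2) 0(2)]) simp
    have "\<bar>cos (\<theta> r) * ?p - w r * (sin (\<theta> r) * ?q)\<bar> \<le> \<bar>cos (\<theta> r) * ?p\<bar> + \<bar>w r * (sin (\<theta> r) * ?q)\<bar>"
      by (rule abs_triangle_ineq4)
    also have "\<dots> \<le> 1 * L + W * (1 * L)"
      unfolding abs_mult[of "cos (\<theta> r)"] abs_mult[of "w r"] abs_mult[of "sin (\<theta> r)"]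
      using p q W[OF r] L0 W0 by (intro add_mono mult_mono) auto
    finally show ?thesis by (simp add: polar_field_def algebra_simps)
  qed
  have sub: "{t0..t} \<subseteq> {t0..t1}" using t by auto
  have "s t - s t0 \<le> L * (1 + W) * (t - t0)"
    by (rule deriv_le_increment[OF _ sub ds]) (use t b sub in \<open>auto simp: abs_le_iff\<close>)
  moreover have "- (L * (1 + W)) * (t - t0) \<le> s t - s t0"
    by (rule deriv_ge_increment[OF _ sub ds]) (use t b sub in \<open>auto simp: abs_le_iff minus_le_iff\<close>)
  ultimately have "\<bar>s t - s t0\<bar> \<le> L * (1 + W) * (t - t0)" by (simp add: abs_le_iff)
  also have "\<dots> \<le> L * (1 + W) * (t1 - t0)"
    using t L0 W0 by (intro mult_left_mono) auto
  finally show ?thesis .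
qed

end

text \<open>The product is \<open>sin (2 * a) / 2\<close>, and \<open>2 * a\<close> runs between
  consecutive multiples of \<open>pi\<close>.\<close>

lemma cos_mult_sin_sign:
  fixes k :: int
  shows "(\<forall>a. (of_int k - 1) * (pi/2) \<le> a \<and> a \<le> of_int k * (pi/2) \<longrightarrow> 0 \<le> cos a * sin a) \<or>
    (\<forall>a. (of_int k - 1) * (pi/2) \<le> a \<and> a \<le> of_int k * (pi/2) \<longrightarrow> cos a * sin a \<le> 0)"
proof -
  have *: "cos a * sin a = cos (pi * of_int (k - 1)) * (sin (2 * a - pi * of_int (k - 1)) / 2) \<and>
      0 \<le> sin (2 * a - pi * of_int (k - 1))"
    if "(of_int k - 1) * (pi/2) \<le> a" "a \<le> of_int k * (pi/2)" for a
  proof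
    define b where "b = 2 * a - pi * of_int (k - 1)"
    have "sin (2 * a) = sin (b + pi * of_int (k - 1))" by (simp add: b_def)
    also have "\<dots> = sin b * cos (pi * of_int (k - 1))" unfolding sin_add sin_npi_int by simp
    finally have "2 * sin a * cos a = sin b * cos (pi * of_int (k - 1))" by (simp only: sin_double)
    then show "cos a * sin a = cos (pi * of_int (k - 1)) * (sin (2 * a - pi * of_int (k - 1)) / 2)"
      unfolding b_def[symmetric] by (simp add: ac_simps)
    show "0 \<le> sin (2 * a - pi * of_int (k - 1))"
      by (rule sin_ge_zero) (use that in \<open>auto simp: algebra_simps\<close>)
  qed
  show ?thesis
  proof (cases "even (k - 1)")
    case True
    then have "cos (pi * of_int (k - 1)) = 1" unfolding cos_npi_int by simp
    then have "0 \<le> cos a * sin a" if "(of_int k - 1) * (pi/2) \<le> a" "a \<le> of_int k * (pi/2)" for a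
      using *[OF that] by simp
    then show ?thesis by blast
  next
    case False
    then have "cos (pi * of_int (k - 1)) = - 1" unfolding cos_npi_int by simp
    then have "cos a * sin a \<le> 0" if "(of_int k - 1) * (pi/2) \<le> a" "a \<le> of_int k * (pi/2)" for a
      using *[OF that] by simp
    then show ?thesis by blast
  qed
qed

locale rotating_solution = polar_solution +
  fixes W :: real and M :: "real \<Rightarrow> real"
  assumes w: "\<And>t. t \<in> {t0..t1} \<Longrightarrow> 0 \<le> w t" "\<And>t. t \<in> {t0..t1} \<Longrightarrow> w t \<le> W" and W: "1 \<le> W"
    and M0: "\<And>u. 0 \<le> u \<Longrightarrow> 0 \<le> M u" and M_mono: "\<And>u v. 0 \<le> u \<Longrightarrow> u \<le> v \<Longrightarrow> M u \<le> M v"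
    and M: "\<And>v. \<bar>H v\<bar> \<le> M \<bar>v\<bar>" "\<And>v. \<bar>G v\<bar> \<le> M \<bar>v\<bar>"
begin

text \<open>As \<open>1 \<le> W\<close>, this constant covers both equations: the first has weight
  1, the second a weight up to \<open>W\<close>.\<close>

definition C :: real where "C = (t1 - t0) * W"

abbreviation \<Phi> :: "real \<Rightarrow> real" where "\<Phi> \<equiv> growth C M"

lemma C_nonneg: "0 \<le> C" using t01 W by (simp add: C_def)

text \<open>Each angular term has the sign of \<open>- (z * f z)\<close> for a restoring
  \<open>f\<close>, and here the weight is nonnegative.\<close>

lemma \<theta>_antimono:
  assumes "t0 \<le> t" "t \<le> t'" "t' \<le> t1"
  shows "\<theta> t' \<le> \<theta> t"
proof -
  have "\<theta> t' - \<theta> t \<le> 0 * (t' - t)"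
  proof (rule deriv_le_increment[OF _ _ d\<theta>])
    fix r assume "r \<in> {t..t'}"
    then have "0 \<le> w r" using assms w by auto
    moreover have pos: "0 \<le> z * (exp (- s r) * f (exp (s r) * z))" if "restoring f" for z f
    proof -
      have "0 \<le> exp (- s r) * (z * (exp (s r) * z))"
        by (simp add: mult.left_commute[of z])
      from restoring_mult_sign(1)[OF that this] show ?thesis by (simp only: mult.left_commute)
    qed
    moreover note pos[OF restoring_H, of "sin (\<theta> r)"] pos[OF restoring_G, of "cos (\<theta> r)"]
    ultimately show "snd (polar_field H G w r (s r, \<theta> r)) \<le> 0"
      unfolding polar_field_def snd_conv fst_conv by (smt (verit) mult_nonneg_nonneg)
  qed (use assms in auto)
  then show ?thesis by simp
qed

lemma x_increment_le:
  assumes "t0 \<le> t" "t \<le> t'" "t' \<le> t1" and "\<And>r. r \<in> {t..t'} \<Longrightarrow> \<bar>H (y r)\<bar> \<le> K" "0 \<le> K"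
  shows "\<bar>x t' - x t\<bar> \<le> C * K"
proof -
  have "\<bar>x t' - x t\<bar> \<le> K * (t' - t)" by (rule x_diff_le) (use assms in auto)
  also have "\<dots> \<le> K * ((t1 - t0) * W)"
    using assms W mult_mono[of "t' - t" "t1 - t0" 1 W] by (intro mult_left_mono) auto
  finally show ?thesis by (simp add: C_def mult.commute)
qed

lemma y_increment_le:
  assumes "t0 \<le> t" "t \<le> t'" "t' \<le> t1" and "\<And>r. r \<in> {t..t'} \<Longrightarrow> \<bar>G (x r)\<bar> \<le> K" "0 \<le> K"
  shows "\<bar>y t' - y t\<bar> \<le> C * K"
proof -
  have "\<bar>y t' - y t\<bar> \<le> W * K * (t' - t)"
    by (rule y_diff_le) (use assms w W in auto)
  also have "\<dots> \<le> W * K * (t1 - t0)" using assms W by (intro mult_left_mono) auto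
  finally show ?thesis by (simp add: C_def algebra_simps)
qed

text \<open>Inside a quadrant one modulus decreases, the other increases, and each coordinate is
  driven by a function of the other. So the increase is controlled by the initial value of the
  decreasing coordinate, and symmetrically backwards in time; no Lipschitz constant enters.\<close>

lemma quadrant_growth:
  fixes k :: int
  assumes t: "t0 \<le> t" "t \<le> t'" "t' \<le> t1"
    and k: "\<theta> t \<le> of_int k * (pi/2)" "(of_int k - 1) * (pi/2) \<le> \<theta> t'"
  shows "exp (s t) \<le> \<Phi> (exp (s t')) \<and> exp (s t') \<le> \<Phi> (exp (s t))"
proof -
  let ?E = "exp (s t)" and ?E' = "exp (s t')"
  have q: "(of_int k - 1) * (pi/2) \<le> \<theta> r" "\<theta> r \<le> of_int k * (pi/2)" if "r \<in> {t..t'}" for r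
    using \<theta>_antimono[of t r] \<theta>_antimono[of r t'] t k that by auto
  have xy: "x r * y r = (exp (s r))\<^sup>2 * (cos (\<theta> r) * sin (\<theta> r))" for r
    by (simp add: power2_eq_square)
  have ME: "0 \<le> M ?E" "0 \<le> M ?E'" by (simp_all add: M0)
  have Mx: "M \<bar>x r\<bar> \<le> M (exp (s r))" "M \<bar>y r\<bar> \<le> M (exp (s r))" for r
    using abs_xy_le[of r] by (auto intro: M_mono)
  have HM: "\<bar>H (y r)\<bar> \<le> M (exp (s a))" if "\<bar>y r\<bar> \<le> \<bar>y a\<bar>" for r a
    using M(1)[of "y r"] M_mono[OF _ that] Mx(2)[of a] by simp
  have GM: "\<bar>G (x r)\<bar> \<le> M (exp (s a))" if "\<bar>x r\<bar> \<le> \<bar>x a\<bar>" for r a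
    using M(2)[of "x r"] M_mono[OF _ that] Mx(1)[of a] by simp
  have tri: "\<bar>a\<bar> \<le> \<bar>b\<bar> + K" "\<bar>b\<bar> \<le> \<bar>a\<bar> + K" if "\<bar>a - b\<bar> \<le> K" for a b K :: real
    using that by linarith+
  have comb: "e \<le> 2 * e' + K' \<and> e' \<le> 2 * e + K"
    if "e \<le> a + b" "e' \<le> a' + b'" "a \<le> e" "b \<le> e" "a' \<le> e'" "b' \<le> e'"
      "a \<le> a'" "b' \<le> b" "a' \<le> a + K" "b \<le> b' + K'" for e e' a a' b b' K K' :: real
    using that by linarith
  note bounds = exp_le_abs_sum[of t] exp_le_abs_sum[of t'] abs_xy_le[of t] abs_xy_le[of t']
  consider (pos) "\<And>r. r \<in> {t..t'} \<Longrightarrow> 0 \<le> x r * y r" | (neg) "\<And>r. r \<in> {t..t'} \<Longrightarrow> x r * y r \<le> 0"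
    using cos_mult_sin_sign[of k]
  proof
    assume "\<forall>a. (of_int k - 1) * (pi/2) \<le> a \<and> a \<le> of_int k * (pi/2) \<longrightarrow> 0 \<le> cos a * sin a"
    then show thesis using q by (intro that(1)) (simp add: xy)
  next
    assume "\<forall>a. (of_int k - 1) * (pi/2) \<le> a \<and> a \<le> of_int k * (pi/2) \<longrightarrow> cos a * sin a \<le> 0"
    then show thesis using q by (intro that(2)) (simp add: xy mult_nonneg_nonpos)
  qed
  then show ?thesis
  proof cases
    case pos
    have wpos: "0 \<le> w r * (x r * y r)" if "r \<in> {t..t'}" for r
      by (rule mult_nonneg_nonneg[OF w(1) pos[OF that]]) (use that t in auto)
    have mx: "\<bar>x r\<bar> \<le> \<bar>x t'\<bar>" if "r \<in> {t..t'}" for r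
      by (rule abs_x_le) (use that t pos in auto)
    have my: "\<bar>y r\<bar> \<le> \<bar>y t\<bar>" if "r \<in> {t..t'}" for r
      by (rule abs_y_ge) (use that t wpos in auto)
    have "\<bar>x t' - x t\<bar> \<le> C * M ?E"
      by (rule x_increment_le[OF t]) (use HM my ME in auto)
    moreover have "\<bar>y t' - y t\<bar> \<le> C * M ?E'"
      by (rule y_increment_le[OF t]) (use GM mx ME in auto)
    ultimately show ?thesis
      unfolding growth_def
      by (intro comb[OF bounds mx my tri(1) tri(2)]) (use t in auto)
  next
    case neg
    have wneg: "w r * (x r * y r) \<le> 0" if "r \<in> {t..t'}" for r
      by (rule mult_nonneg_nonpos[OF w(1) neg[OF that]]) (use that t in auto)
    have mx: "\<bar>x r\<bar> \<le> \<bar>x t\<bar>" if "r \<in> {t..t'}" for r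
      by (rule abs_x_ge) (use that t neg in auto)
    have my: "\<bar>y r\<bar> \<le> \<bar>y t'\<bar>" if "r \<in> {t..t'}" for r
      by (rule abs_y_le) (use that t wneg in auto)
    have "\<bar>x t' - x t\<bar> \<le> C * M ?E'"
      by (rule x_increment_le[OF t]) (use HM my ME in auto)
    moreover have "\<bar>y t' - y t\<bar> \<le> C * M ?E"
      by (rule y_increment_le[OF t]) (use GM mx ME in auto)
    ultimately show ?thesis
      unfolding growth_def
      by (intro comb[OF bounds(1,2)[unfolded add.commute[of "\<bar>x _\<bar>"]] bounds(4,3,6,5) my mx tri(1) tri(2)])
         (use t in auto)
  qed
qed

lemma growth_mono: "0 \<le> u \<Longrightarrow> u \<le> v \<Longrightarrow> \<Phi> u \<le> \<Phi> v"
  using C_nonneg M_mono[of u v] by (auto simp: growth_def intro!: add_mono mult_left_mono)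

lemma growth_ge: "0 \<le> u \<Longrightarrow> u \<le> \<Phi> u"
  using mult_nonneg_nonneg[OF C_nonneg M0[of u]] by (simp add: growth_def)

lemma growth_funpow_ge: "0 \<le> u \<Longrightarrow> u \<le> (\<Phi> ^^ n) u"
proof (induction n)
  case (Suc n)
  then have "u \<le> (\<Phi> ^^ n) u" by simp
  also have "\<dots> \<le> \<Phi> ((\<Phi> ^^ n) u)" by (rule growth_ge) (use Suc in simp)
  finally show ?case by simp
qed simp

lemma growth_funpow_mono: "0 \<le> u \<Longrightarrow> u \<le> v \<Longrightarrow> (\<Phi> ^^ n) u \<le> (\<Phi> ^^ n) v"
proof (induction n)
  case (Suc n)
  then show ?case using growth_funpow_ge[of u n] by (auto intro: growth_mono)
qed simp

text \<open>Induction on quarter turns, cutting the orbit where its angle meets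
  \<open>(k - 1) * (pi/2)\<close>. The first quadrant passed and \<open>n\<close> further ones
  account for \<open>n + 1\<close> applications of \<open>growth\<close>.\<close>

lemma growth_bound:
  fixes k :: int
  assumes "t0 \<le> t" "t \<le> t'" "t' \<le> t1"
    and "\<theta> t \<le> of_int k * (pi/2)" "(of_int k - real n - 1) * (pi/2) \<le> \<theta> t'"
  shows "exp (s t) \<le> (\<Phi> ^^ Suc n) (exp (s t')) \<and> exp (s t') \<le> (\<Phi> ^^ Suc n) (exp (s t))"
  using assms
proof (induction n arbitrary: t k)
  case 0
  then show ?case using quadrant_growth[of t t' k] by simp
next
  case (Suc n)
  have step: "(\<Phi> ^^ Suc n) u \<le> (\<Phi> ^^ Suc (Suc n)) u" if "0 \<le> u" for u
    using growth_ge[of "(\<Phi> ^^ Suc n) u"] growth_funpow_ge[OF that, of "Suc n"] that by simp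
  show ?case
  proof (cases "\<theta> t \<le> of_int (k - 1) * (pi/2)")
    case True
    have "exp (s t) \<le> (\<Phi> ^^ Suc n) (exp (s t')) \<and> exp (s t') \<le> (\<Phi> ^^ Suc n) (exp (s t))"
      by (rule Suc.IH[OF Suc.prems(1-3) True]) (use Suc.prems(5) in \<open>simp add: algebra_simps\<close>)
    then show ?thesis using step[of "exp (s t)"] step[of "exp (s t')"] by fastforce
  next
    case False
    show ?thesis
    proof (cases "of_int (k - 1) * (pi/2) \<le> \<theta> t'")
      case True
      then have "exp (s t) \<le> \<Phi> (exp (s t')) \<and> exp (s t') \<le> \<Phi> (exp (s t))"
        using quadrant_growth[OF Suc.prems(1-4)] by simp
      moreover have "\<Phi> u \<le> (\<Phi> ^^ Suc (Suc n)) u" if "0 \<le> u" for u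
        using growth_mono[OF that growth_funpow_ge[OF that, of "Suc n"]] by simp
      ultimately show ?thesis by (meson exp_ge_zero order_trans)
    next
      case False': False
      obtain r where r: "t \<le> r" "r \<le> t'" "\<theta> r = of_int (k - 1) * (pi/2)"
        using IVT2'[of \<theta> t' "of_int (k - 1) * (pi/2)" t] False False' Suc.prems
          continuous_on_subset[OF continuous_\<theta>, of "{t..t'}"] by auto
      have r01: "t0 \<le> r" "r \<le> t1" using r Suc.prems by auto
      have 1: "exp (s t) \<le> \<Phi> (exp (s r)) \<and> exp (s r) \<le> \<Phi> (exp (s t))"
        by (rule quadrant_growth[OF Suc.prems(1) r(1) r01(2) Suc.prems(4)]) (simp add: r)
      have 2: "exp (s r) \<le> (\<Phi> ^^ Suc n) (exp (s t')) \<and> exp (s t') \<le> (\<Phi> ^^ Suc n) (exp (s r))"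
        by (rule Suc.IH[OF r01(1) r(2) Suc.prems(3), of "k - 1"])
           (use Suc.prems(5) in \<open>simp_all add: r algebra_simps\<close>)
      have "\<Phi> (exp (s r)) \<le> \<Phi> ((\<Phi> ^^ Suc n) (exp (s t')))"
        by (rule growth_mono) (use 2 in auto)
      moreover have "(\<Phi> ^^ Suc n) (exp (s r)) \<le> (\<Phi> ^^ Suc n) (\<Phi> (exp (s t)))"
        by (rule growth_funpow_mono) (use 1 in auto)
      ultimately show ?thesis using 1 2 by (simp add: funpow_swap1)
    qed
  qed
qed

text \<open>A quadrant in which one of the nonlinearities is bounded cannot be crossed in the available
  time at large amplitude.\<close>

lemma few_rotations:
  assumes start: "0 \<le> \<theta> t0" "\<theta> t0 \<le> pi/2" and B: "0 \<le> B"
    and bnd: "(\<forall>v\<le>0. \<bar>H v\<bar> \<le> B) \<or> (\<forall>v\<ge>0. \<bar>H v\<bar> \<le> B) \<or> (\<forall>v\<le>0. \<bar>G v\<bar> \<le> B) \<or> (\<forall>v\<ge>0. \<bar>G v\<bar> \<le> B)"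
    and large: "(\<Phi> ^^ 5) (C * B) < exp (s t0)"
  shows "- 3 * pi \<le> \<theta> t1"
proof (rule ccontr)
  assume "\<not> ?thesis"
  then have end_lt: "\<theta> t1 < - 3 * pi" by simp
  \<comment> \<open>An angle below \<open>- 3 * pi\<close> means that the fourth, third, second and
    first quadrants (\<open>j = 0, 1, 2, 3\<close>) have been crossed completely. When a crossing
    starts, fewer than five quadrants lie behind, so a radius of at most \<open>C * B\<close> would
    contradict \<open>large\<close>.\<close>
  have cross: "\<exists>r r'. t0 \<le> r \<and> r \<le> r' \<and> r' \<le> t1 \<and> \<theta> r = - real j * (pi/2) \<and> \<theta> r' = - (real j + 1) * (pi/2)
      \<and> C * B < exp (s r)"
    if "j \<le> 3" for j :: nat
  proof -
    have j: "real j \<le> 3" using that by simp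
    have j': "real j * pi \<le> 3 * pi" using j by (intro mult_right_mono) auto
    have hit: "\<exists>r. t0 \<le> r \<and> r \<le> t1 \<and> \<theta> r = c" if "\<theta> t1 \<le> c" "c \<le> \<theta> t0" for c
      using IVT2'[OF that t01 continuous_\<theta>] .
    have jpos: "0 \<le> real j * pi" by simp
    have c1: "- real j * (pi/2) = - (real j * pi / 2)" "- (real j + 1) * (pi/2) = - (real j * pi / 2) - pi / 2"
      by (simp_all add: field_simps)
    obtain r where r: "t0 \<le> r" "r \<le> t1" "\<theta> r = - real j * (pi/2)"
      using hit[of "- real j * (pi/2)"] unfolding c1 using start end_lt j' jpos pi_gt_zero by auto
    obtain r' where r': "t0 \<le> r'" "r' \<le> t1" "\<theta> r' = - (real j + 1) * (pi/2)"
      using hit[of "- (real j + 1) * (pi/2)"] unfolding c1 using start end_lt j' jpos pi_gt_zero by auto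
    have "r \<le> r'"
    proof (rule ccontr)
      assume "\<not> r \<le> r'"
      then have "\<theta> r \<le> \<theta> r'" using r r' by (intro \<theta>_antimono) auto
      then show False using r r' pi_gt_zero by (simp add: field_simps)
    qed
    moreover have "C * B < exp (s r)"
    proof (rule ccontr)
      assume small: "\<not> ?thesis"
      have "exp (s t0) \<le> (\<Phi> ^^ Suc 4) (exp (s r))"
        by (rule growth_bound[of t0 r 1 4, THEN conjunct1])
           (use r(1,2) r(3)[unfolded c1] start j' pi_gt_zero in auto)
      also have "\<dots> \<le> (\<Phi> ^^ Suc 4) (C * B)"
        by (rule growth_funpow_mono) (use small in auto)
      finally show False using large by simp
    qed
    ultimately show ?thesis using r r' by blast
  qed
  have range: "\<theta> r' \<le> \<theta> q" "\<theta> q \<le> \<theta> r" if "t0 \<le> r" "r' \<le> t1" "q \<in> {r..r'}" for q r r'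
    using \<theta>_antimono[of r q] \<theta>_antimono[of q r'] that by auto
  \<comment> \<open>A crossing takes one coordinate from modulus \<open>exp (s r) > C * B\<close> to
    0. In each case the quadrant is the one where that coordinate is driven by the bounded branch,
    so it can move by at most \<open>C * B\<close>.\<close>
  from bnd show False
  proof (elim disjE)
    assume b: "\<forall>v\<le>0. \<bar>H v\<bar> \<le> B"
    obtain r r' where r: "t0 \<le> r" "r \<le> r'" "r' \<le> t1" "\<theta> r = 0" "\<theta> r' = - (pi/2)" "C * B < exp (s r)"
      using cross[of 0] by auto
    have "y q \<le> 0" if "q \<in> {r..r'}" for q
      using range[OF r(1,3) that] r sin_ge_zero[of "- \<theta> q"] pi_gt_zero by (auto simp: mult_nonneg_nonpos)
    then have "\<bar>x r' - x r\<bar> \<le> C * B"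
      by (intro x_increment_le r) (use b B in auto)
    then show False using r by simp
  next
    assume b: "\<forall>v\<le>0. \<bar>G v\<bar> \<le> B"
    obtain r r' where r: "t0 \<le> r" "r \<le> r'" "r' \<le> t1" "\<theta> r = - (pi/2)" "\<theta> r' = - pi" "C * B < exp (s r)"
      using cross[of 1] by auto
    have "x q \<le> 0" if "q \<in> {r..r'}" for q
      using range[OF r(1,3) that] r sin_ge_zero[of "- \<theta> q - pi/2"]
      by (auto simp: mult_nonneg_nonpos sin_diff)
    then have "\<bar>y r' - y r\<bar> \<le> C * B"
      by (intro y_increment_le r) (use b B in auto)
    then show False using r by simp
  next
    assume b: "\<forall>v\<ge>0. \<bar>H v\<bar> \<le> B"
    obtain r r' where r: "t0 \<le> r" "r \<le> r'" "r' \<le> t1" "\<theta> r = - pi" "\<theta> r' = - (3 * (pi/2))" "C * B < exp (s r)"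
      using cross[of 2] by auto
    have "0 \<le> y q" if "q \<in> {r..r'}" for q
      using range[OF r(1,3) that] r sin_ge_zero[of "- \<theta> q - pi"] pi_gt_zero
      by (auto simp: sin_diff)
    then have "\<bar>x r' - x r\<bar> \<le> C * B"
      by (intro x_increment_le r) (use b B in auto)
    moreover have "cos (\<theta> r') = 0" using r(5) cos_3over2_pi by simp
    ultimately show False using r by simp
  next
    assume b: "\<forall>v\<ge>0. \<bar>G v\<bar> \<le> B"
    obtain r r' where r: "t0 \<le> r" "r \<le> r'" "r' \<le> t1" "\<theta> r = - (3 * (pi/2))" "\<theta> r' = - (2 * pi)" "C * B < exp (s r)"
      using cross[of 3] by auto
    have "0 \<le> x q" if "q \<in> {r..r'}" for q
      using range[OF r(1,3) that] r cos_ge_zero[of "\<theta> q + 2 * pi"] by auto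
    then have "\<bar>y r' - y r\<bar> \<le> C * B"
      by (intro y_increment_le r) (use b B in auto)
    moreover have "sin (\<theta> r) = 1" "sin (\<theta> r') = 0" using r(4,5) sin_3over2_pi by simp_all
    ultimately show False using r by simp
  qed
qed

text \<open>By the slope bounds the two angular terms are at least \<open>\<beta>\<close> times the
  squared sine and cosine, with factors 1 and \<open>w\<close>, both at least
  \<open>\<delta>\<close>. The squares add up to 1, so the angular speed is at least
  \<open>\<beta> * \<delta>\<close> on \<open>[\<sigma>1, \<sigma>2]\<close>; at other times the
  angle does not increase.\<close>

lemma many_rotations:
  assumes small: "\<And>t. t \<in> {t0..t1} \<Longrightarrow> exp (s t) \<le> \<epsilon>" and \<beta>: "0 \<le> \<beta>"
    and slope: "\<And>v. \<bar>v\<bar> \<le> \<epsilon> \<Longrightarrow> \<beta> * v\<^sup>2 \<le> v * H v" "\<And>v. \<bar>v\<bar> \<le> \<epsilon> \<Longrightarrow> \<beta> * v\<^sup>2 \<le> v * G v"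
    and \<sigma>: "t0 \<le> \<sigma>1" "\<sigma>1 \<le> \<sigma>2" "\<sigma>2 \<le> t1" and \<delta>: "\<delta> \<le> 1" "\<And>t. t \<in> {\<sigma>1..\<sigma>2} \<Longrightarrow> \<delta> \<le> w t"
  shows "\<theta> t1 \<le> \<theta> t0 - \<beta> * \<delta> * (\<sigma>2 - \<sigma>1)"
proof -
  have "\<theta> \<sigma>2 - \<theta> \<sigma>1 \<le> - (\<beta> * \<delta>) * (\<sigma>2 - \<sigma>1)"
  proof (rule deriv_le_increment[OF \<sigma>(2) _ d\<theta>])
    show "{\<sigma>1..\<sigma>2} \<subseteq> {t0..t1}" using \<sigma> by auto
    fix t assume t: "t \<in> {\<sigma>1..\<sigma>2}"
    then have t': "t \<in> {t0..t1}" using \<sigma> by auto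
    have key: "\<beta> * c\<^sup>2 \<le> c * (exp (- s t) * f (exp (s t) * c))"
      if "\<bar>c\<bar> \<le> 1" and sl: "\<And>v. \<bar>v\<bar> \<le> \<epsilon> \<Longrightarrow> \<beta> * v\<^sup>2 \<le> v * f v" for c and f :: "real \<Rightarrow> real"
    proof -
      let ?v = "exp (s t) * c"
      have "\<bar>?v\<bar> \<le> \<epsilon>"
        using small[OF t'] mult_left_mono[OF that(1) exp_ge_zero, of "s t"]
        unfolding abs_mult abs_exp_cancel mult_1_right by linarith
      then have "\<beta> * ?v\<^sup>2 * (exp (- s t))\<^sup>2 \<le> ?v * f ?v * (exp (- s t))\<^sup>2"
        by (intro mult_right_mono sl) simp_all
      moreover have "\<beta> * ?v\<^sup>2 * (exp (- s t))\<^sup>2 = \<beta> * c\<^sup>2 * (exp (s t) * exp (- s t))\<^sup>2"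
        by (simp add: power_mult_distrib)
      moreover have "?v * f ?v * (exp (- s t))\<^sup>2 = c * (exp (- s t) * f ?v) * (exp (s t) * exp (- s t))"
        by (simp add: power2_eq_square)
      moreover have "exp (s t) * exp (- s t) = 1" by (simp add: exp_minus)
      ultimately show ?thesis by (simp only: power_one mult_1_right)
    qed
    have a: "\<beta> * (sin (\<theta> t))\<^sup>2 \<le> sin (\<theta> t) * (exp (- s t) * H (exp (s t) * sin (\<theta> t)))"
      by (rule key) (use slope in auto)
    have b: "\<beta> * (cos (\<theta> t))\<^sup>2 \<le> cos (\<theta> t) * (exp (- s t) * G (exp (s t) * cos (\<theta> t)))" (is "_ \<le> ?b")
      by (rule key) (use slope in auto)
    have "\<beta> * \<delta> = \<beta> * \<delta> * ((sin (\<theta> t))\<^sup>2 + (cos (\<theta> t))\<^sup>2)" by simp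
    also have "\<dots> = \<delta> * (\<beta> * (sin (\<theta> t))\<^sup>2) + \<delta> * (\<beta> * (cos (\<theta> t))\<^sup>2)" by (simp only: distrib_left ac_simps)
    also have "\<dots> \<le> 1 * (\<beta> * (sin (\<theta> t))\<^sup>2) + w t * (\<beta> * (cos (\<theta> t))\<^sup>2)"
      using \<delta>(1) \<delta>(2)[OF t] \<beta> by (intro add_mono mult_right_mono) auto
    also have "\<dots> \<le> sin (\<theta> t) * (exp (- s t) * H (exp (s t) * sin (\<theta> t))) + w t * ?b"
      using a mult_left_mono[OF b w(1)[OF t']] by simp
    finally show "snd (polar_field H G w t (s t, \<theta> t)) \<le> - (\<beta> * \<delta>)"
      by (simp add: polar_field_def)
  qed
  moreover have "\<theta> \<sigma>1 \<le> \<theta> t0" "\<theta> t1 \<le> \<theta> \<sigma>2" using \<theta>_antimono \<sigma> by auto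
  ultimately show ?thesis by simp
qed

end

section \<open>The period map\<close>

definition polar :: "real \<times> real \<Rightarrow> real \<times> real" where
  "polar z = (fst z * cos (snd z), fst z * sin (snd z))"

definition exp_polar :: "real \<times> real \<Rightarrow> real \<times> real" where
  "exp_polar z = (exp (fst z) * cos (snd z), exp (fst z) * sin (snd z))"

lemma exp_polar_nonzero: "exp_polar z \<noteq> 0"
proof
  assume "exp_polar z = 0"
  then have "cos (snd z) = 0 \<and> sin (snd z) = 0" by (simp add: exp_polar_def zero_prod_def)
  then show False using sin_cos_squared_add[of "snd z"] by simp
qed

lemma has_vector_derivative_join:
  assumes ab: "a \<le> b" "b \<le> c" and eq: "f b = g b"
    and f: "\<And>t. t \<in> {a..b} \<Longrightarrow> (f has_vector_derivative D t) (at t within {a..b})"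
    and g: "\<And>t. t \<in> {b..c} \<Longrightarrow> (g has_vector_derivative E t) (at t within {b..c})"
    and DE: "D b = E b" and t: "t \<in> {a..c}"
  shows "((\<lambda>t. if t \<in> {a..b} then f t else g t) has_vector_derivative
    (if t \<in> {a..b} then D t else E t)) (at t within {a..c})"
proof (rule has_vector_derivative_If_within_closures[where T = "{b..c}"])
  have cl: "{a..b} \<union> (closure {a..b} \<inter> closure {b..c}) = {a..b}"
    "{b..c} \<union> (closure {a..b} \<inter> closure {b..c}) = {b..c}" using ab by auto
  show "(f has_vector_derivative D t) (at t within {a..b} \<union> (closure {a..b} \<inter> closure {b..c}))"
    if "t \<in> {a..b} \<union> (closure {a..b} \<inter> closure {b..c})" using that f unfolding cl by blast
  show "(g has_vector_derivative E t) (at t within {b..c} \<union> (closure {a..b} \<inter> closure {b..c}))"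
    if "t \<in> {b..c} \<union> (closure {a..b} \<inter> closure {b..c})" using that g unfolding cl by blast
  have tb: "t = b" if "t \<in> closure {a..b}" "t \<in> closure {b..c}" using that by simp
  show "f t = g t" if "t \<in> closure {a..b}" "t \<in> closure {b..c}"
    using tb[OF that] eq by simp
  show "D t = E t" if "t \<in> closure {a..b}" "t \<in> closure {b..c}"
    using tb[OF that] DE by simp
qed (use ab t in auto)

lemma has_real_derivative_fst_snd:
  assumes "(f has_vector_derivative D) (at t within S)"
  shows "((\<lambda>t. fst (f t)) has_real_derivative fst D) (at t within S)"
    "((\<lambda>t. snd (f t)) has_real_derivative snd D) (at t within S)"
  using bounded_linear.has_vector_derivative[OF bounded_linear_fst assms]
    bounded_linear.has_vector_derivative[OF bounded_linear_snd assms]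
  by (simp_all add: has_real_derivative_iff_has_vector_derivative)

text \<open>The norm of the nearest point of the closed first quadrant: continuous on the plane, the
  Euclidean norm in that quadrant and 0 in the closed third one. This is a radial coordinate for
  final points that may lie anywhere.\<close>

definition pos_norm :: "real \<times> real \<Rightarrow> real" where
  "pos_norm z = sqrt ((max 0 (fst z))\<^sup>2 + (max 0 (snd z))\<^sup>2)"

lemma pos_norm_ge: "max 0 (fst z) \<le> pos_norm z" "max 0 (snd z) \<le> pos_norm z"
  unfolding pos_norm_def by (auto intro!: real_le_rsqrt)

lemma pos_norm_le: "pos_norm z \<le> max 0 (fst z) + max 0 (snd z)"
  unfolding pos_norm_def by (rule real_le_lsqrt) (auto simp: power2_sum)

lemma continuous_pos_norm: "continuous_on S pos_norm"
  unfolding pos_norm_def by (intro continuous_intros)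

text \<open>A continuous retraction of the plane to polar coordinates \<open>(pos_norm, angle)\<close>, exact on the part
  of the closed first quadrant of norm at least \<open>r\<close>; outside of this quadrant only the radial
  coordinate is used.\<close>

definition quadrant_coords :: "real \<Rightarrow> real \<times> real \<Rightarrow> real \<times> real" where
  "quadrant_coords r z = (pos_norm z, arccos (max 0 (fst z) / max r (pos_norm z)))"

lemma quadrant_coords_ratio:
  assumes "0 < r"
  shows "0 \<le> max 0 (fst z) / max r (pos_norm z)" "max 0 (fst z) / max r (pos_norm z) \<le> 1"
proof -
  have "max 0 (fst z) \<le> max r (pos_norm z)" using pos_norm_ge(1)[of z] by linarith
  then show "0 \<le> max 0 (fst z) / max r (pos_norm z)" "max 0 (fst z) / max r (pos_norm z) \<le> 1"
    using assms by simp_all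
qed

lemma snd_quadrant_coords:
  assumes "0 < r"
  shows "snd (quadrant_coords r z) \<in> {0..pi/2}"
proof -
  note b = quadrant_coords_ratio[OF assms, of z]
  have "0 \<le> arccos (max 0 (fst z) / max r (pos_norm z))"
    by (rule arccos_lbound) (use b in linarith)+
  moreover have "arccos (max 0 (fst z) / max r (pos_norm z)) \<le> pi/2"
    by (rule arccos_le_pi2) (rule b)+
  ultimately show ?thesis by (simp add: quadrant_coords_def)
qed

lemma continuous_quadrant_coords:
  assumes "0 < r"
  shows "continuous_on S (quadrant_coords r)"
  unfolding quadrant_coords_def
proof (intro continuous_on_Pair continuous_pos_norm continuous_on_arccos)
  show "continuous_on S (\<lambda>z. max 0 (fst z) / max r (pos_norm z))"
    by (intro continuous_intros continuous_pos_norm) (use assms in auto)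
  show "\<forall>z\<in>S. - 1 \<le> max 0 (fst z) / max r (pos_norm z) \<and> max 0 (fst z) / max r (pos_norm z) \<le> 1"
    using quadrant_coords_ratio[OF assms] by (meson neg_le_0_iff_le order_trans zero_le_one)
qed

lemma polar_quadrant_coords:
  assumes r: "0 < r" "r \<le> pos_norm z" and z: "0 \<le> fst z" "0 \<le> snd z"
  shows "polar (quadrant_coords r z) = z"
proof -
  let ?N = "pos_norm z"
  have N: "?N > 0" using r by linarith
  have N2: "?N\<^sup>2 = (fst z)\<^sup>2 + (snd z)\<^sup>2" using z by (simp add: pos_norm_def)
  have ratio: "0 \<le> fst z / ?N" "fst z / ?N \<le> 1"
    using quadrant_coords_ratio[OF r(1), of z] r z by (simp_all add: max_def)
  have "?N * sin (arccos (fst z / ?N)) = sqrt (?N\<^sup>2 * (1 - (fst z / ?N)\<^sup>2))"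
    using ratio N by (simp add: sin_arccos real_sqrt_mult)
  also have "?N\<^sup>2 * (1 - (fst z / ?N)\<^sup>2) = (snd z)\<^sup>2"
    using N N2 by (simp add: power_divide right_diff_distrib)
  finally have "?N * sin (arccos (fst z / ?N)) = snd z" using z by simp
  moreover have "?N * cos (arccos (fst z / ?N)) = fst z" using ratio N by (simp add: cos_arccos)
  ultimately show ?thesis
    using r z by (simp add: polar_def quadrant_coords_def max_def prod_eq_iff)
qed

text \<open>The flows are parameters since \<open>polar_flow\<close> only asserts existence.
  \<open>W\<close> bounds the weight on \<open>[0, T1]\<close> alone, so the estimates there are
  independent of the strength of the saddle phase.\<close>

locale switched_system =
  fixes H G b :: "real \<Rightarrow> real" and L W T1 T :: real and M :: "real \<Rightarrow> real"
    and \<phi> \<psi> :: "real \<times> real \<Rightarrow> real \<Rightarrow> real \<times> real"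
  assumes restoring: "restoring H" "restoring G"
    and lipschitz: "L-lipschitz_on UNIV H" "L-lipschitz_on UNIV G"
    and T: "0 < T1" "T1 < T"
    and b_pos: "\<And>t. t \<in> {0..T1} \<Longrightarrow> 0 \<le> b t" "\<And>t. t \<in> {0..T1} \<Longrightarrow> b t \<le> W" and W: "1 \<le> W"
    and b_neg: "\<And>t. t \<in> {T1..T} \<Longrightarrow> b t \<le> 0"
    and M0: "\<And>u. 0 \<le> u \<Longrightarrow> 0 \<le> M u" and M_mono: "\<And>u v. 0 \<le> u \<Longrightarrow> u \<le> v \<Longrightarrow> M u \<le> M v"
    and M: "\<And>v. \<bar>H v\<bar> \<le> M \<bar>v\<bar>" "\<And>v. \<bar>G v\<bar> \<le> M \<bar>v\<bar>"
    and \<phi>0: "\<And>z. \<phi> z 0 = z"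
    and d\<phi>: "\<And>z t. t \<in> {0..T1} \<Longrightarrow> (\<phi> z has_vector_derivative polar_field H G b t (\<phi> z t)) (at t within {0..T1})"
    and continuous_\<phi>: "continuous_on UNIV (\<lambda>z. \<phi> z T1)"
    and \<psi>0: "\<And>z. \<psi> z T1 = z"
    and d\<psi>: "\<And>z t. t \<in> {T1..T} \<Longrightarrow> (\<psi> z has_vector_derivative polar_field H G b t (\<psi> z t)) (at t within {T1..T})"
    and continuous_\<psi>: "continuous_on UNIV (\<lambda>z. \<psi> z T)"
begin

lemma rotating: "rotating_solution H G b (\<lambda>t. fst (\<phi> z t)) (\<lambda>t. snd (\<phi> z t)) 0 T1 W M"
proof unfold_locales
  fix t assume t: "t \<in> {0..T1}"
  show "((\<lambda>t. fst (\<phi> z t)) has_real_derivative fst (polar_field H G b t (fst (\<phi> z t), snd (\<phi> z t)))) (at t within {0..T1})"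
    "((\<lambda>t. snd (\<phi> z t)) has_real_derivative snd (polar_field H G b t (fst (\<phi> z t), snd (\<phi> z t)))) (at t within {0..T1})"
    using has_real_derivative_fst_snd[OF d\<phi>[OF t]] by simp_all
qed (use restoring T b_pos W M0 M_mono M in auto)

lemma polar_\<psi>: "polar_solution H G b (\<lambda>t. fst (\<psi> z t)) (\<lambda>t. snd (\<psi> z t)) T1 T"
proof unfold_locales
  fix t assume t: "t \<in> {T1..T}"
  show "((\<lambda>t. fst (\<psi> z t)) has_real_derivative fst (polar_field H G b t (fst (\<psi> z t), snd (\<psi> z t)))) (at t within {T1..T})"
    "((\<lambda>t. snd (\<psi> z t)) has_real_derivative snd (polar_field H G b t (fst (\<psi> z t), snd (\<psi> z t)))) (at t within {T1..T})"
    using has_real_derivative_fst_snd[OF d\<psi>[OF t]] by simp_all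
qed (use restoring T in auto)

abbreviation X where "X z t \<equiv> fst (exp_polar (\<psi> z t))"
abbreviation Y where "Y z t \<equiv> snd (exp_polar (\<psi> z t))"

lemma saddle: "saddle_solution H G b (X z) (Y z) T1 T"
proof -
  interpret polar_solution H G b "\<lambda>t. fst (\<psi> z t)" "\<lambda>t. snd (\<psi> z t)" T1 T by (rule polar_\<psi>)
  show ?thesis
    unfolding exp_polar_def fst_conv snd_conv
    by unfold_locales (use T b_neg in auto)
qed

lemma \<phi>_solution:
  assumes "t \<in> {0..T1}"
  shows "((\<lambda>t. exp_polar (\<phi> z t)) has_vector_derivative
    (H (snd (exp_polar (\<phi> z t))), - b t * G (fst (exp_polar (\<phi> z t))))) (at t within {0..T1})"
proof -
  interpret rotating_solution H G b "\<lambda>t. fst (\<phi> z t)" "\<lambda>t. snd (\<phi> z t)" 0 T1 W M by (rule rotating)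
  show ?thesis
    unfolding exp_polar_def fst_conv snd_conv
    by (intro has_vector_derivative_Pair dx[OF assms, unfolded has_real_derivative_iff_has_vector_derivative]
        dy[OF assms, unfolded has_real_derivative_iff_has_vector_derivative])
qed

lemma \<psi>_solution:
  assumes "t \<in> {T1..T}"
  shows "((\<lambda>t. exp_polar (\<psi> z t)) has_vector_derivative (H (Y z t), - b t * G (X z t))) (at t within {T1..T})"
proof -
  interpret polar_solution H G b "\<lambda>t. fst (\<psi> z t)" "\<lambda>t. snd (\<psi> z t)" T1 T by (rule polar_\<psi>)
  show ?thesis
    unfolding exp_polar_def fst_conv snd_conv
    by (intro has_vector_derivative_Pair dx[OF assms, unfolded has_real_derivative_iff_has_vector_derivative]
        dy[OF assms, unfolded has_real_derivative_iff_has_vector_derivative])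
qed

definition K :: real where "K = L * (1 + W) * T1"

lemma amplitude_bounds:
  assumes "t \<in> {0..T1}"
  shows "exp (fst z) * exp (- K) \<le> exp (fst (\<phi> z t))" "exp (fst (\<phi> z t)) \<le> exp (fst z) * exp K"
proof -
  interpret rotating_solution H G b "\<lambda>t. fst (\<phi> z t)" "\<lambda>t. snd (\<phi> z t)" 0 T1 W M by (rule rotating)
  have "\<bar>fst (\<phi> z t) - fst (\<phi> z 0)\<bar> \<le> L * (1 + W) * (T1 - 0)"
    by (rule abs_s_diff_le[OF lipschitz]) (use assms b_pos in \<open>auto simp: abs_le_iff intro: order_trans[OF _ b_pos(1)]\<close>)
  then have "fst z + - K \<le> fst (\<phi> z t)" "fst (\<phi> z t) \<le> fst z + K" by (auto simp: K_def \<phi>0)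
  then show "exp (fst z) * exp (- K) \<le> exp (fst (\<phi> z t))" "exp (fst (\<phi> z t)) \<le> exp (fst z) * exp K"
    unfolding exp_add[symmetric] exp_le_cancel_iff .
qed

text \<open>The argument carries the radius, the value its logarithm: sectors are described by
  radii, the flow by logarithms.\<close>

definition mid :: "real \<times> real \<Rightarrow> real \<times> real" where
  "mid z = \<phi> (ln (fst z), snd z) T1"

text \<open>The angular window \<open>[top_angle j - pi/2, top_angle j]\<close> is the fourth quadrant for even \<open>j\<close> and
  the second quadrant for odd \<open>j\<close>. One of its ends is then carried into the third quadrant and the
  other one far out in the first, so the final point lies in the annulus only if \<open>window\<close> does not
  change the angle.\<close>

definition top_angle :: "nat \<Rightarrow> real" where "top_angle j = - (real j + 2) * pi"

definition window :: "nat \<Rightarrow> real \<Rightarrow> real" where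
  "window j \<alpha> = max (top_angle j - pi/2) (min (top_angle j) \<alpha>)"

definition final :: "nat \<Rightarrow> real \<times> real \<Rightarrow> real \<times> real" where
  "final j z = exp_polar (\<psi> (fst (mid z), window j (snd (mid z))) T)"

lemma continuous_mid:
  assumes "\<And>z. z \<in> S \<Longrightarrow> 0 < fst z"
  shows "continuous_on S mid"
proof -
  have "continuous_on S (\<lambda>z. (ln (fst z), snd z))"
    by (intro continuous_intros) (use assms in force)
  from continuous_on_compose2[OF continuous_\<phi> this] show ?thesis by (simp add: mid_def)
qed

lemma continuous_final:
  assumes "\<And>z. z \<in> S \<Longrightarrow> 0 < fst z"
  shows "continuous_on S (final j)"
proof -
  have c: "continuous_on S (\<lambda>z. (fst (mid z), window j (snd (mid z))))"
    unfolding window_def by (intro continuous_intros continuous_mid assms)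
  have "continuous_on UNIV exp_polar" unfolding exp_polar_def by (intro continuous_intros)
  from continuous_on_compose2[OF this continuous_on_compose2[OF continuous_\<psi> c]]
  show ?thesis by (simp add: final_def)
qed

text \<open>Window ends are directions of axes: for even \<open>j\<close> the top is the positive
  \<open>x\<close> axis and the bottom the negative \<open>y\<close> axis, for odd \<open>j\<close>
  the negative \<open>x\<close> axis and the positive \<open>y\<close> axis.\<close>

lemma top_angle_trig:
  "sin (top_angle j) = 0" "cos (top_angle j) = (if even j then 1 else - 1)"
  "cos (top_angle j - pi/2) = 0" "sin (top_angle j - pi/2) = - cos (top_angle j)"
proof -
  have eq: "top_angle j = - (real (j + 2) * pi)" by (simp add: top_angle_def algebra_simps)
  show s: "sin (top_angle j) = 0" unfolding eq sin_minus by (simp only: sin_npi minus_zero)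
  show "cos (top_angle j) = (if even j then 1 else - 1)" unfolding eq cos_minus cos_npi by simp
  show "cos (top_angle j - pi/2) = 0" by (simp add: cos_diff s)
  show "sin (top_angle j - pi/2) = - cos (top_angle j)" by (simp add: sin_diff)
qed

end

context switched_system
begin

lemma mid_amplitude:
  assumes "0 < r" "fst z \<in> {r..R}"
  shows "r * exp (- K) \<le> exp (fst (mid z))" "exp (fst (mid z)) \<le> R * exp K"
proof -
  have "T1 \<in> {0..T1}" using T by simp
  note b = amplitude_bounds[OF this, of "(ln (fst z), snd z)"]
  have "exp (ln (fst z)) = fst z" using assms by simp
  then have "fst z * exp (- K) \<le> exp (fst (mid z))" "exp (fst (mid z)) \<le> fst z * exp K"
    using b by (simp_all add: mid_def)
  moreover have "r * exp (- K) \<le> fst z * exp (- K)" "fst z * exp K \<le> R * exp K"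
    using assms by (auto intro: mult_right_mono)
  ultimately show "r * exp (- K) \<le> exp (fst (mid z))" "exp (fst (mid z)) \<le> R * exp K" by linarith+
qed

text \<open>A start at radius \<open>r\<close> with \<open>r * exp K \<le> \<epsilon>\<close> stays
  where the slope bounds hold.\<close>

lemma mid_angle_inner:
  assumes \<epsilon>: "0 < r" "r * exp K \<le> \<epsilon>" and \<beta>: "0 \<le> \<beta>"
    and slope: "\<And>v. \<bar>v\<bar> \<le> \<epsilon> \<Longrightarrow> \<beta> * v\<^sup>2 \<le> v * H v" "\<And>v. \<bar>v\<bar> \<le> \<epsilon> \<Longrightarrow> \<beta> * v\<^sup>2 \<le> v * G v"
    and \<sigma>: "0 \<le> \<sigma>1" "\<sigma>1 \<le> \<sigma>2" "\<sigma>2 \<le> T1" and \<delta>: "\<delta> \<le> 1" "\<And>t. t \<in> {\<sigma>1..\<sigma>2} \<Longrightarrow> \<delta> \<le> b t"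
  shows "snd (mid (r, \<alpha>)) \<le> \<alpha> - \<beta> * \<delta> * (\<sigma>2 - \<sigma>1)"
proof -
  let ?z = "(ln r, \<alpha>)"
  interpret rotating_solution H G b "\<lambda>t. fst (\<phi> ?z t)" "\<lambda>t. snd (\<phi> ?z t)" 0 T1 W M by (rule rotating)
  have "exp (fst (\<phi> ?z t)) \<le> \<epsilon>" if "t \<in> {0..T1}" for t
    using amplitude_bounds(2)[OF that, of ?z] \<epsilon> by simp
  from many_rotations[OF this \<beta> slope \<sigma> \<delta>] show ?thesis by (simp add: mid_def \<phi>0)
qed

lemma mid_angle_outer:
  assumes start: "0 \<le> \<alpha>" "\<alpha> \<le> pi/2" and B: "0 \<le> B"
    and bnd: "(\<forall>v\<le>0. \<bar>H v\<bar> \<le> B) \<or> (\<forall>v\<ge>0. \<bar>H v\<bar> \<le> B) \<or> (\<forall>v\<le>0. \<bar>G v\<bar> \<le> B) \<or> (\<forall>v\<ge>0. \<bar>G v\<bar> \<le> B)"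
    and large: "0 < R" "(growth (T1 * W) M ^^ 5) (T1 * W * B) < R"
  shows "- 3 * pi \<le> snd (mid (R, \<alpha>))"
proof -
  let ?z = "(ln R, \<alpha>)"
  interpret rotating_solution H G b "\<lambda>t. fst (\<phi> ?z t)" "\<lambda>t. snd (\<phi> ?z t)" 0 T1 W M by (rule rotating)
  have "C = T1 * W" by (simp add: C_def)
  with few_rotations[OF _ _ B bnd] start large show ?thesis by (simp add: mid_def \<phi>0)
qed

text \<open>The angle is monotone, so its value at \<open>T1\<close> bounds the quarter turns made
  up to any earlier time. Initial angles reach up to \<open>pi/2\<close>, whence one application
  more than \<open>n\<close>.\<close>

lemma rotation_box:
  assumes z: "0 < fst z" "fst z \<le> R" "snd z \<le> pi/2"
    and angle: "- real n * (pi/2) \<le> snd (mid z)" and t: "t \<in> {0..T1}"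
  shows "exp (fst (\<phi> (ln (fst z), snd z) t)) \<le> (growth (T1 * W) M ^^ Suc n) R"
proof -
  let ?z = "(ln (fst z), snd z)"
  interpret rotating_solution H G b "\<lambda>t. fst (\<phi> ?z t)" "\<lambda>t. snd (\<phi> ?z t)" 0 T1 W M by (rule rotating)
  have C: "C = T1 * W" by (simp add: C_def)
  have "snd (\<phi> ?z T1) \<le> snd (\<phi> ?z t)" using \<theta>_antimono[of t T1] t by auto
  then have "exp (fst (\<phi> ?z t)) \<le> (\<Phi> ^^ Suc n) (exp (fst (\<phi> ?z 0)))"
    using growth_bound[of 0 t 1 n] t angle z by (auto simp: \<phi>0 mid_def)
  also have "\<dots> \<le> (\<Phi> ^^ Suc n) R"
    by (rule growth_funpow_mono) (use z in \<open>simp_all add: \<phi>0\<close>)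
  finally show ?thesis unfolding C .
qed

lemma start_\<psi>: "X z T1 = exp (fst z) * cos (snd z)" "Y z T1 = exp (fst z) * sin (snd z)"
  by (simp_all add: \<psi>0 exp_polar_def)

lemma final_far:
  assumes \<tau>: "T1 < \<tau>1" "\<tau>1 < \<tau>2" "\<tau>2 < T" and \<kappa>: "\<And>t. t \<in> {\<tau>1..\<tau>2} \<Longrightarrow> b t \<le> - \<kappa>" "0 \<le> \<kappa>"
    and r0: "0 < r0" "r0 \<le> exp (fst z)"
    and dir: "0 \<le> cos (snd z)" "0 \<le> sin (snd z)" "cos (snd z) = 1 \<or> sin (snd z) = 1"
    and mH: "0 < mH" "\<And>v. r0 \<le> \<bar>v\<bar> \<Longrightarrow> \<bar>v\<bar> \<le> R \<Longrightarrow> mH \<le> \<bar>H v\<bar>"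
    and mG: "0 < mG" "\<And>v. min r0 ((\<tau>1 - T1) * mH) \<le> \<bar>v\<bar> \<Longrightarrow> \<bar>v\<bar> \<le> R \<Longrightarrow> mG \<le> \<bar>G v\<bar>"
    and large: "R < \<kappa> * mG * (\<tau>2 - \<tau>1)"
  shows "R < pos_norm (exp_polar (\<psi> z T))"
proof -
  have "R < X z T \<or> R < Y z T"
  proof (rule saddle_solution.expands_in_first_quadrant[OF saddle \<tau> \<kappa> _ _ _ r0(1) mH mG large])
    show "r0 \<le> X z T1 \<or> r0 \<le> Y z T1" using r0 dir(3) unfolding start_\<psi> by auto
  qed (use dir in \<open>auto simp: start_\<psi>\<close>)
  then show ?thesis using pos_norm_ge[of "exp_polar (\<psi> z T)"] by auto
qed

lemma final_near:
  assumes \<tau>: "T1 < \<tau>1" "\<tau>1 < \<tau>2" "\<tau>2 < T" and \<kappa>: "\<And>t. t \<in> {\<tau>1..\<tau>2} \<Longrightarrow> b t \<le> - \<kappa>" "0 \<le> \<kappa>"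
    and R: "exp (fst z) \<le> R" and r: "0 < r"
    and mH: "0 < mH" "\<And>v. r/2 \<le> \<bar>v\<bar> \<Longrightarrow> \<bar>v\<bar> \<le> R \<Longrightarrow> mH \<le> \<bar>H v\<bar>"
    and mG: "0 < mG" "\<And>v. min (r/2) ((T - \<tau>2) * mH) \<le> \<bar>v\<bar> \<Longrightarrow> \<bar>v\<bar> \<le> R \<Longrightarrow> mG \<le> \<bar>G v\<bar>"
    and large: "R < \<kappa> * mG * (\<tau>2 - \<tau>1)"
    and neg: "X z T * Y z T < 0"
  shows "pos_norm (exp_polar (\<psi> z T)) < r"
proof -
  interpret polar_solution H G b "\<lambda>t. fst (\<psi> z t)" "\<lambda>t. snd (\<psi> z t)" T1 T by (rule polar_\<psi>)
  have start: "\<bar>X z T1\<bar> \<le> R" "\<bar>Y z T1\<bar> \<le> R"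
    using abs_xy_le[of T1] R by (auto simp: \<psi>0 exp_polar_def)
  \<comment> \<open>Half of \<open>r\<close> for each coordinate, because \<open>pos_norm\<close> is
    estimated by a sum.\<close>
  have "\<bar>X z T\<bar> < r/2 \<and> \<bar>Y z T\<bar> < r/2"
    by (rule saddle_solution.contracts_off_diagonal_quadrants[OF saddle \<tau>, where \<kappa> = \<kappa> and R = R and r = "r/2" and mH = mH and mG = mG])
       (use start \<kappa> r mH mG large neg in auto)
  then show ?thesis using pos_norm_le[of "exp_polar (\<psi> z T)"] r by auto
qed

lemma final_third_quadrant:
  assumes dir: "cos (snd z) \<le> 0" "sin (snd z) \<le> 0"
  shows "pos_norm (exp_polar (\<psi> z T)) = 0"
proof -
  have "X z T1 \<noteq> 0 \<or> Y z T1 \<noteq> 0"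
    using exp_polar_nonzero[of "\<psi> z T1"] by (auto simp: prod_eq_iff)
  then have "X z T \<le> 0 \<and> Y z T \<le> 0"
    by (intro saddle_solution.third_quadrant_invariant[OF saddle])
       (use dir T in \<open>auto simp: start_\<psi> mult_nonneg_nonpos\<close>)
  then show ?thesis by (simp add: pos_norm_def)
qed

end

text \<open>The numbers fit the windows: \<open>- (2 * real k + 5/2) * pi\<close> is the lower end
  of window \<open>2 * k\<close>, \<open>- 3 * pi\<close> the upper end of window 1, and
  \<open>r * exp (- K)\<close>, \<open>R * exp K\<close> enclose the radius at \<open>T1\<close>.
  The box condition concerns only orbits not turned beyond the last window.\<close>

locale stretching_system = switched_system +
  fixes k :: nat and r R c :: real
  assumes rR: "0 < r" "r < R"
    and inner: "\<And>\<alpha>. \<alpha> \<in> {0..pi/2} \<Longrightarrow> snd (mid (r, \<alpha>)) \<le> - (2 * real k + 5/2) * pi"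
    and outer: "\<And>\<alpha>. \<alpha> \<in> {0..pi/2} \<Longrightarrow> - 3 * pi \<le> snd (mid (R, \<alpha>))"
    and far: "\<And>z. r * exp (- K) \<le> exp (fst z) \<Longrightarrow> 0 \<le> cos (snd z) \<Longrightarrow> 0 \<le> sin (snd z) \<Longrightarrow>
      cos (snd z) = 1 \<or> sin (snd z) = 1 \<Longrightarrow> R < pos_norm (exp_polar (\<psi> z T))"
    and near: "\<And>z. exp (fst z) \<le> R * exp K \<Longrightarrow> X z T * Y z T < 0 \<Longrightarrow> pos_norm (exp_polar (\<psi> z T)) < r"
    and box: "R \<le> c" "\<And>z t. fst z \<in> {r..R} \<Longrightarrow> snd z \<in> {0..pi/2} \<Longrightarrow>
      - (2 * real k + 5/2) * pi \<le> snd (mid z) \<Longrightarrow> t \<in> {0..T1} \<Longrightarrow> exp (fst (\<phi> (ln (fst z), snd z) t)) \<le> c"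
begin

abbreviation sector :: "(real \<times> real) set" where "sector \<equiv> {r..R} \<times> {0..pi/2}"

text \<open>The clamped orbit leaves from the bottom axis of the window: the negative
  \<open>y\<close> axis leads into the third quadrant, the positive one far out.\<close>

lemma low_angle:
  assumes z: "z \<in> sector" and low: "snd (mid z) \<le> top_angle j - pi/2"
  shows "if even j then pos_norm (final j z) = 0 else R < pos_norm (final j z)"
proof -
  let ?w = "(fst (mid z), top_angle j - pi/2)"
  have w: "window j (snd (mid z)) = top_angle j - pi/2"
    using low pi_gt_zero by (auto simp: window_def)
  have amp: "r * exp (- K) \<le> exp (fst ?w)" using mid_amplitude(1)[of r z R] z rR by auto
  show ?thesis
  proof (cases "even j")
    case True
    then have "pos_norm (exp_polar (\<psi> ?w T)) = 0"
      by (intro final_third_quadrant) (simp_all add: top_angle_trig)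
    then show ?thesis using True by (simp add: final_def w)
  next
    case False
    then have "R < pos_norm (exp_polar (\<psi> ?w T))"
      by (intro far amp) (simp_all add: top_angle_trig)
    then show ?thesis using False by (simp add: final_def w)
  qed
qed

text \<open>The start is now on the \<open>x\<close> axis and the two outcomes are interchanged, so
  across a window the radial coordinate sweeps all of \<open>[r, R]\<close>.\<close>

lemma high_angle:
  assumes z: "z \<in> sector" and high: "top_angle j \<le> snd (mid z)"
  shows "if even j then R < pos_norm (final j z) else pos_norm (final j z) = 0"
proof -
  let ?w = "(fst (mid z), top_angle j)"
  have w: "window j (snd (mid z)) = top_angle j"
    using high pi_gt_zero by (auto simp: window_def)
  have amp: "r * exp (- K) \<le> exp (fst ?w)" using mid_amplitude(1)[of r z R] z rR by auto
  show ?thesis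
  proof (cases "even j")
    case True
    then have "R < pos_norm (exp_polar (\<psi> ?w T))"
      by (intro far amp) (simp_all add: top_angle_trig)
    then show ?thesis using True by (simp add: final_def w)
  next
    case False
    then have "pos_norm (exp_polar (\<psi> ?w T)) = 0"
      by (intro final_third_quadrant) (simp_all add: top_angle_trig)
    then show ?thesis using False by (simp add: final_def w)
  qed
qed

lemma top_angle_range:
  assumes "j \<in> {1..2 * k}"
  shows "- (2 * real k + 5/2) * pi \<le> top_angle j - pi/2" "top_angle j \<le> - 3 * pi"
proof -
  have "1 \<le> real j" "real j \<le> 2 * real k" using assms by auto
  then have "1 * pi \<le> real j * pi" "real j * pi \<le> 2 * real k * pi"
    by (intro mult_right_mono; simp)+
  then show "- (2 * real k + 5/2) * pi \<le> top_angle j - pi/2" "top_angle j \<le> - 3 * pi"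
    by (simp_all add: top_angle_def algebra_simps)
qed

lemma boundary:
  assumes j: "j \<in> {1..2 * k}" and \<alpha>: "\<alpha> \<in> {0..pi/2}"
  shows "if even j then pos_norm (final j (r, \<alpha>)) = 0 \<and> R < pos_norm (final j (R, \<alpha>))
    else R < pos_norm (final j (r, \<alpha>)) \<and> pos_norm (final j (R, \<alpha>)) = 0"
proof -
  have "(r, \<alpha>) \<in> sector" "(R, \<alpha>) \<in> sector" using \<alpha> rR by auto
  moreover have "snd (mid (r, \<alpha>)) \<le> top_angle j - pi/2" "top_angle j \<le> snd (mid (R, \<alpha>))"
    using inner[OF \<alpha>] outer[OF \<alpha>] top_angle_range[OF j] by linarith+
  ultimately show ?thesis
    using low_angle[of "(r, \<alpha>)" j] high_angle[of "(R, \<alpha>)" j] by (auto split: if_splits)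
qed

lemma window_hit:
  assumes j: "j \<in> {1..2 * k}"
  obtains z where "z \<in> sector" "snd (mid z) \<in> {top_angle j - pi/2..top_angle j}"
proof -
  have 0: "0 \<in> {0..pi/2}" by simp
  have "continuous_on {r..R} (\<lambda>\<rho>. snd (mid (\<rho>, 0)))"
    by (intro continuous_intros continuous_on_compose2[OF continuous_mid[of sector]]) (use rR in auto)
  moreover have "snd (mid (r, 0)) \<le> top_angle j" "top_angle j \<le> snd (mid (R, 0))"
    using inner[OF 0] outer[OF 0] top_angle_range[OF j] pi_gt_zero by linarith+
  ultimately obtain \<rho> where "r \<le> \<rho>" "\<rho> \<le> R" "snd (mid (\<rho>, 0)) = top_angle j"
    using IVT'[of "\<lambda>\<rho>. snd (mid (\<rho>, 0))" r "top_angle j" R] rR by auto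
  then show thesis using that[of "(\<rho>, 0)"] by simp
qed

text \<open>At or beyond a window end the final radial coordinate would be 0 or exceed
  \<open>R\<close>, so the angle is strictly inside. A final point with negative product of
  coordinates has \<open>pos_norm\<close> below \<open>r\<close>, one in the third quadrant has 0;
  only the first quadrant remains.\<close>

lemma final_in_annulus:
  assumes j: "j \<in> {1..2 * k}" and z: "z \<in> sector" and fin: "pos_norm (final j z) \<in> {r..R}"
  shows "snd (mid z) \<in> {top_angle j - pi/2..top_angle j}" and "final j z = exp_polar (\<psi> (mid z) T)"
    and "0 \<le> X (mid z) T" "0 \<le> Y (mid z) T"
proof -
  have "\<not> snd (mid z) \<le> top_angle j - pi/2"
    using low_angle[OF z, of j] fin rR by (cases "even j") auto
  moreover have "\<not> top_angle j \<le> snd (mid z)"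
    using high_angle[OF z, of j] fin rR by (cases "even j") auto
  ultimately show w: "snd (mid z) \<in> {top_angle j - pi/2..top_angle j}" by simp
  then show f: "final j z = exp_polar (\<psi> (mid z) T)"
    by (simp add: final_def window_def)
  have "exp (fst (mid z)) \<le> R * exp K" using mid_amplitude(2)[of r z R] z rR by auto
  then have nn: "\<not> X (mid z) T * Y (mid z) T < 0"
    using near[of "mid z"] fin unfolding f by auto
  have pn: "0 < pos_norm (exp_polar (\<psi> (mid z) T))" using fin rR unfolding f by simp
  have "0 \<le> X (mid z) T \<and> 0 \<le> Y (mid z) T"
  proof (rule ccontr)
    assume neg: "\<not> ?thesis"
    then have "X (mid z) T \<le> 0 \<and> Y (mid z) T \<le> 0"
      using nn by (auto simp: mult_less_0_iff not_le not_less)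
    then show False using pn by (simp add: pos_norm_def)
  qed
  then show "0 \<le> X (mid z) T" "0 \<le> Y (mid z) T" by auto
qed

text \<open>\<open>box\<close> confines the phase up to \<open>T1\<close>, the annulus confines the
  final point, and \<open>abs_le_endpoints\<close> confines the saddle phase between them.\<close>

lemma period_solution:
  assumes j: "j \<in> {1..2 * k}" and z: "z \<in> sector" and fin: "pos_norm (final j z) \<in> {r..R}"
  obtains v where "v 0 = polar z" "v T = polar (quadrant_coords r (final j z))"
    and "\<And>t. t \<in> {0..T} \<Longrightarrow> v t \<noteq> 0 \<and> \<bar>fst (v t)\<bar> \<le> c \<and> \<bar>snd (v t)\<bar> \<le> c"
    and "\<And>t. t \<in> {0..T} \<Longrightarrow> (v has_vector_derivative (H (snd (v t)), - b t * G (fst (v t)))) (at t within {0..T})"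
proof -
  note F = final_in_annulus[OF j z fin]
  define f where "f t = exp_polar (\<phi> (ln (fst z), snd z) t)" for t
  define g where "g t = exp_polar (\<psi> (mid z) t)" for t
  define v where "v t = (if t \<in> {0..T1} then f t else g t)" for t
  have fg: "f T1 = g T1" by (simp add: f_def g_def \<psi>0 mid_def)
  have zpos: "0 < fst z" using z rR by auto
  have bx: "exp (fst (\<phi> (ln (fst z), snd z) t)) \<le> c" if "t \<in> {0..T1}" for t
    by (rule box(2)) (use that z F(1) top_angle_range[OF j] in auto)
  have boxf: "\<bar>fst (f t)\<bar> \<le> c" "\<bar>snd (f t)\<bar> \<le> c" if "t \<in> {0..T1}" for t
  proof -
    interpret rotating_solution H G b "\<lambda>t. fst (\<phi> (ln (fst z), snd z) t)" "\<lambda>t. snd (\<phi> (ln (fst z), snd z) t)" 0 T1 W M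
      by (rule rotating)
    show "\<bar>fst (f t)\<bar> \<le> c" "\<bar>snd (f t)\<bar> \<le> c"
      using abs_xy_le[of t] bx[OF that] by (auto simp: f_def exp_polar_def)
  qed
  have "fst (g T) \<le> pos_norm (g T)" "snd (g T) \<le> pos_norm (g T)"
    using pos_norm_ge[of "g T"] by auto
  then have gT: "\<bar>fst (g T)\<bar> \<le> c" "\<bar>snd (g T)\<bar> \<le> c"
    using F fin box(1) by (auto simp: g_def)
  have boxg: "\<bar>fst (g t)\<bar> \<le> c" "\<bar>snd (g t)\<bar> \<le> c" if "t \<in> {T1..T}" for t
  proof -
    have "\<bar>fst (g t)\<bar> \<le> max \<bar>fst (g T1)\<bar> \<bar>fst (g T)\<bar>" "\<bar>snd (g t)\<bar> \<le> max \<bar>snd (g T1)\<bar> \<bar>snd (g T)\<bar>"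
      unfolding g_def by (rule saddle_solution.abs_le_endpoints[OF saddle that])+
    moreover have "\<bar>fst (g T1)\<bar> \<le> c" "\<bar>snd (g T1)\<bar> \<le> c" using boxf[of T1] fg T by auto
    ultimately show "\<bar>fst (g t)\<bar> \<le> c" "\<bar>snd (g t)\<bar> \<le> c" using gT by (meson max.boundedI order_trans)+
  qed
  show thesis
  proof (rule that[of v])
    show "v 0 = polar z"
      using T zpos by (simp add: v_def f_def \<phi>0 exp_polar_def polar_def)
    have "polar (quadrant_coords r (final j z)) = final j z"
      by (rule polar_quadrant_coords) (use rR fin F in auto)
    then show "v T = polar (quadrant_coords r (final j z))"
      using T F(2) by (simp add: v_def g_def)
    fix t assume t: "t \<in> {0..T}"
    show "v t \<noteq> 0 \<and> \<bar>fst (v t)\<bar> \<le> c \<and> \<bar>snd (v t)\<bar> \<le> c"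
      using boxf[of t] boxg[of t] t exp_polar_nonzero by (auto simp: v_def f_def g_def)
    have "((\<lambda>t. if t \<in> {0..T1} then f t else g t) has_vector_derivative
        (if t \<in> {0..T1} then (H (snd (f t)), - b t * G (fst (f t))) else (H (snd (g t)), - b t * G (fst (g t)))))
        (at t within {0..T})"
    proof (rule has_vector_derivative_join[where f = f and g = g and b = T1])
      show "(f has_vector_derivative (H (snd (f s)), - b s * G (fst (f s)))) (at s within {0..T1})"
        if "s \<in> {0..T1}" for s unfolding f_def by (rule \<phi>_solution[OF that])
      show "(g has_vector_derivative (H (snd (g s)), - b s * G (fst (g s)))) (at s within {T1..T})"
        if "s \<in> {T1..T}" for s unfolding g_def by (rule \<psi>_solution[OF that])
    qed (use T fg t in auto)
    moreover have "(if t \<in> {0..T1} then (H (snd (f t)), - b t * G (fst (f t))) else (H (snd (g t)), - b t * G (fst (g t))))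
      = (H (snd (v t)), - b t * G (fst (v t)))" by (simp add: v_def)
    ultimately show "(v has_vector_derivative (H (snd (v t)), - b t * G (fst (v t)))) (at t within {0..T})"
      unfolding v_def[abs_def] by simp
  qed
qed

end

section \<open>Weights, majorants and the choice of constants\<close>

lemma a_lm_nonneg: "0 \<le> a t \<Longrightarrow> a_lm a lam mu t = lam * a t"
  by (simp add: a_lm_def pos_part_def neg_part_def)

lemma a_lm_nonpos: "a t \<le> 0 \<Longrightarrow> a_lm a lam mu t = mu * a t"
  by (simp add: a_lm_def pos_part_def neg_part_def)

lemma continuous_a_lm: "continuous_on S a \<Longrightarrow> continuous_on S (a_lm a lam mu)"
  unfolding a_lm_def[abs_def] pos_part_def neg_part_def by (intro continuous_intros) auto

lemma restoring_clip:
  assumes "restoring f" "0 < c"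
  shows "restoring (\<lambda>v. f (clip c v))"
  unfolding restoring_def
proof (intro conjI allI impI)
  show "f (clip c 0) = 0" using assms by (simp add: restoring_def clip_def)
  fix v :: real assume v: "v \<noteq> 0"
  have pos: "0 < f u * u" if "u \<noteq> 0" for u using assms(1) that by (simp add: restoring_def)
  show "0 < f (clip c v) * v"
  proof (cases "0 < v")
    case True
    then show ?thesis using pos[of "clip c v"] clip_sgn(1)[OF assms(2) True] by (auto simp: zero_less_mult_iff)
  next
    case False
    then have "v < 0" using v by simp
    then show ?thesis using pos[of "clip c v"] clip_sgn(2)[OF assms(2) \<open>v < 0\<close>] by (auto simp: zero_less_mult_iff)
  qed
qed

text \<open>A supremum over symmetric intervals. Truncation does not increase it, so one majorant
  serves all truncation levels.\<close>

lemma two_sided_majorant: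
  fixes h g :: "real \<Rightarrow> real"
  assumes "continuous_on UNIV h" "continuous_on UNIV g"
  obtains M :: "real \<Rightarrow> real"
  where "\<And>u. 0 \<le> u \<Longrightarrow> 0 \<le> M u" and "\<And>u v. 0 \<le> u \<Longrightarrow> u \<le> v \<Longrightarrow> M u \<le> M v"
    and "\<And>v. \<bar>h v\<bar> \<le> M \<bar>v\<bar>" "\<And>v. \<bar>g v\<bar> \<le> M \<bar>v\<bar>"
proof -
  define F where "F v = \<bar>h v\<bar> + \<bar>g v\<bar>" for v
  define M where "M u = Sup (F ` {-u..u})" for u
  have "continuous_on {-u..u} F" for u
    unfolding F_def by (intro continuous_intros continuous_on_subset[OF assms(1)] continuous_on_subset[OF assms(2)]) auto
  then have bdd: "bdd_above (F ` {-u..u})" for u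
    by (intro bounded_imp_bdd_above compact_imp_bounded compact_continuous_image) auto
  have le: "F v \<le> M u" if "\<bar>v\<bar> \<le> u" for u v
    unfolding M_def by (rule cSup_upper[OF imageI bdd]) (use that in auto)
  have F0: "0 \<le> F v" for v by (simp add: F_def)
  show thesis
  proof
    show "0 \<le> M u" if "0 \<le> u" for u
      using le[of 0 u] that F0[of 0] by simp
    show "M u \<le> M v" if "0 \<le> u" "u \<le> v" for u v
      unfolding M_def by (rule cSup_subset_mono) (use that bdd in auto)
    show "\<bar>h v\<bar> \<le> M \<bar>v\<bar>" "\<bar>g v\<bar> \<le> M \<bar>v\<bar>" for v
      using le[of v "\<bar>v\<bar>"] by (auto simp: F_def)
  qed
qed

lemma bounded_image_abs_le:
  fixes f :: "real \<Rightarrow> real"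
  assumes "bounded (f ` S)"
  obtains B where "0 \<le> B" "\<And>v. v \<in> S \<Longrightarrow> \<bar>f v\<bar> \<le> B"
  using assms by (auto simp: bounded_pos intro: less_imp_le)

text \<open>The weight is normalised to \<open>a\<close> on \<open>[0, T1]\<close>, so everything
  except the flows is fixed before \<open>\<nu>\<close>. In \<open>rot\<close>, the
  \<open>2 * real k + 3\<close> half turns are \<open>2 * real k + 5/2\<close> to pass the last
  window and 1/2 for the initial angle.\<close>

lemma exists_stretching:
  fixes h g a :: "real \<Rightarrow> real"
  assumes lip: "loc_lipschitz h" "loc_lipschitz g" and rest: "restoring h" "restoring g"
    and bnd: "bounded (h ` {..0}) \<or> bounded (h ` {0..}) \<or> bounded (g ` {..0}) \<or> bounded (g ` {0..})"
    and a: "continuous_on UNIV a" and T: "0 < T1" "T1 < T"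
    and a_pos: "\<And>t. t \<in> {0..T1} \<Longrightarrow> 0 \<le> a t" and a_neg: "\<And>t. t \<in> {T1..T} \<Longrightarrow> a t \<le> 0"
    and \<epsilon>: "0 < \<epsilon>" and \<beta>: "0 \<le> \<beta>"
    and slope: "\<And>v. \<bar>v\<bar> \<le> \<epsilon> \<Longrightarrow> \<beta> * v\<^sup>2 \<le> v * h v" "\<And>v. \<bar>v\<bar> \<le> \<epsilon> \<Longrightarrow> \<beta> * v\<^sup>2 \<le> v * g v"
    and \<sigma>: "0 \<le> \<sigma>1" "\<sigma>1 \<le> \<sigma>2" "\<sigma>2 \<le> T1" and \<delta>: "\<delta> \<le> 1" "\<And>t. t \<in> {\<sigma>1..\<sigma>2} \<Longrightarrow> \<delta> \<le> a t"
    and rot: "(2 * real k + 3) * pi \<le> \<beta> * \<delta> * (\<sigma>2 - \<sigma>1)"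
    and \<tau>: "T1 < \<tau>1" "\<tau>1 < \<tau>2" "\<tau>2 < T" and \<kappa>: "0 < \<kappa>" "\<And>t. t \<in> {\<tau>1..\<tau>2} \<Longrightarrow> a t \<le> - \<kappa>"
  obtains \<nu>0 c L W M r R where "0 < \<nu>0" "0 < c"
    "\<And>\<nu>. \<nu>0 < \<nu> \<Longrightarrow> \<exists>\<phi> \<psi>. stretching_system (\<lambda>v. h (clip c v)) (\<lambda>v. g (clip c v)) (a_lm a 1 \<nu>)
      L W T1 T M \<phi> \<psi> k r R c"
proof -
  have "compact (a ` {0..T1})"
    by (rule compact_continuous_image) (auto intro: continuous_on_subset[OF a])
  from bounded_image_abs_le[OF compact_imp_bounded[OF this]]
  obtain W0 where W0: "\<And>t. t \<in> {0..T1} \<Longrightarrow> \<bar>a t\<bar> \<le> W0"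
    by blast
  define W where "W = max 1 W0"
  have W: "1 \<le> W" "\<And>t. t \<in> {0..T1} \<Longrightarrow> a t \<le> W"
    using W0 by (force simp: W_def le_max_iff_disj)+
  obtain B where B: "0 \<le> B" and hgB: "(\<forall>v\<le>0. \<bar>h v\<bar> \<le> B) \<or> (\<forall>v\<ge>0. \<bar>h v\<bar> \<le> B)
      \<or> (\<forall>v\<le>0. \<bar>g v\<bar> \<le> B) \<or> (\<forall>v\<ge>0. \<bar>g v\<bar> \<le> B)"
    using bnd by (elim disjE; elim bounded_image_abs_le) (simp; blast)+
  have conts: "continuous_on UNIV h" "continuous_on UNIV g"
    using lip by (auto intro: loc_lipschitz_continuous)
  obtain M where M: "\<And>u. 0 \<le> u \<Longrightarrow> 0 \<le> M u" "\<And>u v. 0 \<le> u \<Longrightarrow> u \<le> v \<Longrightarrow> M u \<le> M v"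
    "\<And>v. \<bar>h v\<bar> \<le> M \<bar>v\<bar>" "\<And>v. \<bar>g v\<bar> \<le> M \<bar>v\<bar>"
    using two_sided_majorant[OF conts] by blast
  \<comment> \<open>Beyond the amplitude at which \<open>few_rotations\<close> applies; the maximum
    with \<open>\<epsilon>\<close> secures \<open>r < R\<close>.\<close>
  define R where "R = max ((growth (T1 * W) M ^^ 5) (T1 * W * B)) \<epsilon> + 1"
  have R: "\<epsilon> < R" "0 < R" "(growth (T1 * W) M ^^ 5) (T1 * W * B) < R" using \<epsilon> by (auto simp: R_def)
  \<comment> \<open>The lower end of the last window is \<open>4 * k + 5\<close> quarter turns below
    0; the \<open>Suc\<close> accounts for the initial quadrant.\<close>
  define c where "c = max ((growth (T1 * W) M ^^ Suc (4 * k + 5)) R) R"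
  have c: "0 < c" "R \<le> c" "\<epsilon> \<le> c" "(growth (T1 * W) M ^^ Suc (4 * k + 5)) R \<le> c"
    using R by (auto simp: c_def)
  define H where "H v = h (clip c v)" for v
  define G where "G v = g (clip c v)" for v
  have rHG: "restoring H" "restoring G"
    unfolding H_def[abs_def] G_def[abs_def] using restoring_clip rest c by auto
  obtain LH LG where "LH-lipschitz_on UNIV H" "LG-lipschitz_on UNIV G"
    using loc_lipschitz_clip[OF lip(1), of c] loc_lipschitz_clip[OF lip(2), of c] c
    unfolding H_def[abs_def] G_def[abs_def] by (metis less_imp_le)
  then have L: "(max LH LG)-lipschitz_on UNIV H" "(max LH LG)-lipschitz_on UNIV G"
    by (auto intro: lipschitz_on_mono)
  define L where "L = max LH LG"
  note L = L[folded L_def]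
  have contHG: "continuous_on UNIV H" "continuous_on UNIV G"
    using L lipschitz_on_continuous_on by auto
  have MHG: "\<bar>H v\<bar> \<le> M \<bar>v\<bar>" "\<bar>G v\<bar> \<le> M \<bar>v\<bar>" for v
    unfolding H_def G_def using M(2)[OF _ abs_clip_le[of c v]] M(3,4)[of "clip c v"] c(1) by force+
  have HGB: "(\<forall>v\<le>0. \<bar>H v\<bar> \<le> B) \<or> (\<forall>v\<ge>0. \<bar>H v\<bar> \<le> B) \<or> (\<forall>v\<le>0. \<bar>G v\<bar> \<le> B) \<or> (\<forall>v\<ge>0. \<bar>G v\<bar> \<le> B)"
  proof -
    have "clip c v \<le> 0" if "v \<le> 0" for v using that c by (auto simp: clip_def)
    moreover have "0 \<le> clip c v" if "0 \<le> v" for v using that c by (auto simp: clip_def)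
    ultimately show ?thesis using hgB unfolding H_def G_def by meson
  qed
  have slopeHG: "\<beta> * v\<^sup>2 \<le> v * H v" "\<beta> * v\<^sup>2 \<le> v * G v" if "\<bar>v\<bar> \<le> \<epsilon>" for v
  proof -
    have "clip c v = v" by (rule clip_id) (use that c in linarith)
    then show "\<beta> * v\<^sup>2 \<le> v * H v" "\<beta> * v\<^sup>2 \<le> v * G v" using slope[OF that] by (simp_all add: H_def G_def)
  qed
  define K where K_eq: "K = L * (1 + W) * T1"
  \<comment> \<open>Orbits from radius \<open>r\<close> stay below \<open>\<epsilon>\<close> up to
    \<open>T1\<close>. This choice has to wait for \<open>K\<close>, which contains the Lipschitz
    constant of the truncation.\<close>
  define r where "r = \<epsilon> * exp (- K)"
  have K: "0 \<le> K" using lipschitz_on_nonneg[OF L(1)] W T by (simp add: K_eq)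
  have r: "0 < r" "r * exp K = \<epsilon>" "r < R"
  proof -
    show "0 < r" using \<epsilon> by (simp add: r_def)
    show "r * exp K = \<epsilon>" by (simp add: r_def exp_minus)
    have "r \<le> \<epsilon> * 1" unfolding r_def using \<epsilon> K by (intro mult_left_mono) auto
    then show "r < R" using R by simp
  qed
  have r0: "0 < r * exp (- K)" using r by simp
  \<comment> \<open>The first pair of bounds is for expansion from radii at least
    \<open>r * exp (- K)\<close>, the second for contraction from radii up to
    \<open>R * exp K\<close>.\<close>
  obtain mH1 where mH1: "mH1 > 0" "\<And>v. r * exp (- K) \<le> \<bar>v\<bar> \<Longrightarrow> \<bar>v\<bar> \<le> R \<Longrightarrow> mH1 \<le> \<bar>H v\<bar>"
    using restoring_lower_bound[OF rHG(1) contHG(1) r0] by blast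
  have "0 < min (r * exp (- K)) ((\<tau>1 - T1) * mH1)" using r0 mH1 \<tau> by simp
  then obtain mG1 where mG1: "mG1 > 0"
    "\<And>v. min (r * exp (- K)) ((\<tau>1 - T1) * mH1) \<le> \<bar>v\<bar> \<Longrightarrow> \<bar>v\<bar> \<le> R \<Longrightarrow> mG1 \<le> \<bar>G v\<bar>"
    using restoring_lower_bound[OF rHG(2) contHG(2)] by metis
  have "0 < r/2" using r by simp
  then obtain mH2 where mH2: "mH2 > 0" "\<And>v. r/2 \<le> \<bar>v\<bar> \<Longrightarrow> \<bar>v\<bar> \<le> R * exp K \<Longrightarrow> mH2 \<le> \<bar>H v\<bar>"
    using restoring_lower_bound[OF rHG(1) contHG(1)] by metis
  have "0 < min (r/2) ((T - \<tau>2) * mH2)" using r mH2 \<tau> by simp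
  then obtain mG2 where mG2: "mG2 > 0"
    "\<And>v. min (r/2) ((T - \<tau>2) * mH2) \<le> \<bar>v\<bar> \<Longrightarrow> \<bar>v\<bar> \<le> R * exp K \<Longrightarrow> mG2 \<le> \<bar>G v\<bar>"
    using restoring_lower_bound[OF rHG(2) contHG(2)] by metis
  \<comment> \<open>The quotients are the strengths demanded by the expansion and the contraction
    estimate.\<close>
  define \<nu>0 where "\<nu>0 = max 1 (max (R / (\<kappa> * mG1 * (\<tau>2 - \<tau>1))) (R * exp K / (\<kappa> * mG2 * (\<tau>2 - \<tau>1))))"
  have "\<exists>\<phi> \<psi>. stretching_system H G (a_lm a 1 \<nu>) L W T1 T M \<phi> \<psi> k r R c" if \<nu>: "\<nu>0 < \<nu>" for \<nu>
  proof -
    define b where "b = a_lm a 1 \<nu>"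
    have \<nu>1: "1 < \<nu>" using \<nu> by (simp add: \<nu>0_def)
    have large1: "R < (\<nu> * \<kappa>) * mG1 * (\<tau>2 - \<tau>1)"
    proof -
      have "R / (\<kappa> * mG1 * (\<tau>2 - \<tau>1)) < \<nu>" using \<nu> by (simp add: \<nu>0_def)
      then show ?thesis using \<kappa> mG1 \<tau> by (simp add: pos_divide_less_eq ac_simps)
    qed
    have large2: "R * exp K < (\<nu> * \<kappa>) * mG2 * (\<tau>2 - \<tau>1)"
    proof -
      have "R * exp K / (\<kappa> * mG2 * (\<tau>2 - \<tau>1)) < \<nu>" using \<nu> by (simp add: \<nu>0_def)
      then show ?thesis using \<kappa> mG2 \<tau> by (simp add: pos_divide_less_eq ac_simps)
    qed
    have b1: "b t = a t" if "t \<in> {0..T1}" for t using a_lm_nonneg[of a, OF a_pos[OF that]] by (simp add: b_def)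
    have b2: "b t = \<nu> * a t" if "t \<in> {T1..T}" for t using a_lm_nonpos[of a, OF a_neg[OF that]] by (simp add: b_def)
    have bc: "continuous_on S b" for S
      unfolding b_def by (rule continuous_a_lm) (rule continuous_on_subset[OF a], simp)
    have HG0: "H 0 = 0" "G 0 = 0" using rHG by (auto simp: restoring_def)
    obtain \<phi> where \<phi>: "\<And>z. \<phi> z 0 = z"
      "\<And>z t. t \<in> {0..T1} \<Longrightarrow> (\<phi> z has_vector_derivative polar_field H G b t (\<phi> z t)) (at t within {0..T1})"
      "\<And>t. t \<in> {0..T1} \<Longrightarrow> continuous_on UNIV (\<lambda>z. \<phi> z t)"
      by (rule polar_flow[OF less_imp_le[OF T(1)] L(1) HG0(1) L(2) HG0(2) bc]) blast
    obtain \<psi> where \<psi>: "\<And>z. \<psi> z T1 = z"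
      "\<And>z t. t \<in> {T1..T} \<Longrightarrow> (\<psi> z has_vector_derivative polar_field H G b t (\<psi> z t)) (at t within {T1..T})"
      "\<And>t. t \<in> {T1..T} \<Longrightarrow> continuous_on UNIV (\<lambda>z. \<psi> z t)"
      by (rule polar_flow[OF less_imp_le[OF T(2)] L(1) HG0(1) L(2) HG0(2) bc]) blast
    have bneg: "b t \<le> 0" if "t \<in> {T1..T}" for t
      using b2[OF that] a_neg[OF that] \<nu>1 by (simp add: mult_nonneg_nonpos)
    interpret switched_system H G b L W T1 T M \<phi> \<psi>
      by unfold_locales (use rHG L T a_pos W M MHG \<phi> \<psi> bneg b1 in auto)
    have KK: "switched_system.K L W T1 = K" unfolding K_def K_eq ..
    have b\<kappa>: "b t \<le> - (\<nu> * \<kappa>)" if "t \<in> {\<tau>1..\<tau>2}" for t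
    proof -
      have "b t = \<nu> * a t" using b2[of t] that \<tau> by auto
      also have "\<dots> \<le> \<nu> * (- \<kappa>)" using \<kappa>(2)[OF that] \<nu>1 by (intro mult_left_mono) auto
      finally show ?thesis by simp
    qed
    have \<nu>\<kappa>: "0 \<le> \<nu> * \<kappa>" using \<nu>1 \<kappa> by simp
    have "stretching_system H G b L W T1 T M \<phi> \<psi> k r R c"
    proof unfold_locales
      show "0 < r" "r < R" "R \<le> c" by (fact r c)+
      show "snd (mid (r, \<alpha>)) \<le> - (2 * real k + 5/2) * pi" if "\<alpha> \<in> {0..pi/2}" for \<alpha>
      proof -
        have "snd (mid (r, \<alpha>)) \<le> \<alpha> - \<beta> * \<delta> * (\<sigma>2 - \<sigma>1)"
        proof (rule mid_angle_inner[OF r(1) _ \<beta> slopeHG \<sigma> \<delta>(1)])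
          show "r * exp (switched_system.K L W T1) \<le> \<epsilon>" unfolding KK using r by simp
          show "\<delta> \<le> b t" if "t \<in> {\<sigma>1..\<sigma>2}" for t using b1[of t] \<delta>(2)[OF that] that \<sigma> by auto
        qed
        also have "\<dots> \<le> pi/2 - (2 * real k + 3) * pi" using that rot by auto
        finally show ?thesis by (simp add: algebra_simps)
      qed
      show "- 3 * pi \<le> snd (mid (R, \<alpha>))" if "\<alpha> \<in> {0..pi/2}" for \<alpha>
        by (rule mid_angle_outer[OF _ _ B HGB R(2,3)]) (use that in auto)
      show "R < pos_norm (exp_polar (\<psi> z T))"
        if "r * exp (- switched_system.K L W T1) \<le> exp (fst z)" "0 \<le> cos (snd z)" "0 \<le> sin (snd z)"
          "cos (snd z) = 1 \<or> sin (snd z) = 1" for z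
        by (rule final_far[OF \<tau> b\<kappa> \<nu>\<kappa> r0 _ that(2-4) mH1 mG1 large1]) (use that(1) in \<open>simp_all add: KK\<close>)
      show "pos_norm (exp_polar (\<psi> z T)) < r"
        if "exp (fst z) \<le> R * exp (switched_system.K L W T1)" "X z T * Y z T < 0" for z
        by (rule final_near[OF \<tau> b\<kappa> \<nu>\<kappa> _ r(1) mH2 mG2 large2 that(2)]) (use that(1) in \<open>simp_all add: KK\<close>)
      show "exp (fst (\<phi> (ln (fst z), snd z) t)) \<le> c"
        if "fst z \<in> {r..R}" "snd z \<in> {0..pi/2}" "- (2 * real k + 5/2) * pi \<le> snd (mid z)" "t \<in> {0..T1}" for z t
      proof -
        have "exp (fst (\<phi> (ln (fst z), snd z) t)) \<le> (growth (T1 * W) M ^^ Suc (4 * k + 5)) R"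
          by (rule rotation_box[OF _ _ _ _ that(4)]) (use that r in \<open>auto simp: algebra_simps\<close>)
        then show ?thesis using c(4) by linarith
      qed
    qed
    then show ?thesis unfolding b_def by blast
  qed
  moreover have "0 < \<nu>0" by (simp add: \<nu>0_def less_max_iff_disj)
  ultimately show thesis using that[of \<nu>0 c] c(1) unfolding H_def[abs_def] G_def[abs_def] by blast
qed

section \<open>Periodic itineraries\<close>

lemma polar_in_quad1:
  assumes "0 < fst z" "snd z \<in> {0..pi/2}"
  shows "polar z \<in> quad1"
proof -
  have "0 \<le> cos (snd z)" "0 \<le> sin (snd z)"
    using assms by (auto intro!: cos_ge_zero sin_ge_zero)
  moreover have "cos (snd z) \<noteq> 0 \<or> sin (snd z) \<noteq> 0"
    using sin_zero_abs_cos_one[of "snd z"] by fastforce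
  ultimately show ?thesis using assms by (auto simp: quad1_def polar_def)
qed

lemma inj_polar: "inj_on polar ({0<..} \<times> {0..pi/2})"
proof (rule inj_onI)
  fix z z' assume z: "z \<in> {0<..} \<times> {0..pi/2}" and z': "z' \<in> {0<..} \<times> {0..pi/2}" and eq: "polar z = polar z'"
  have norm: "(fst (polar z))\<^sup>2 + (snd (polar z))\<^sup>2 = (fst z)\<^sup>2" for z
  proof -
    have "(fst (polar z))\<^sup>2 + (snd (polar z))\<^sup>2 = (fst z)\<^sup>2 * ((cos (snd z))\<^sup>2 + (sin (snd z))\<^sup>2)"
      by (simp only: polar_def fst_conv snd_conv power_mult_distrib distrib_left)
    then show ?thesis by simp
  qed
  have "(fst z)\<^sup>2 = (fst z')\<^sup>2" using norm[of z] norm[of z'] eq by simp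
  then have fst: "fst z = fst z'" using z z' by (auto simp: power2_eq_iff)
  then have "cos (snd z) = cos (snd z')" using eq z z' by (auto simp: polar_def)
  moreover have "0 \<le> snd z" "snd z \<le> pi" "0 \<le> snd z'" "snd z' \<le> pi" using z z' pi_gt_zero by auto
  ultimately have "snd z = snd z'" using cos_inj_pi by blast
  with fst show "z = z'" by (simp add: prod_eq_iff)
qed

lemma periodic_sequence_mod:
  fixes \<xi> :: "int \<Rightarrow> 'b"
  assumes m: "m > 0" and per: "\<And>n. \<xi> (n + int m) = \<xi> n"
  shows "\<xi> (n mod int m) = \<xi> n"
proof -
  have nat: "\<xi> (n + int i * int m) = \<xi> n" for i n
  proof (induction i)
    case (Suc i)
    then show ?case using per[of "n + int i * int m"] by (simp add: algebra_simps)
  qed simp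
  have "\<xi> (n mod int m + q * int m) = \<xi> (n mod int m)" for q
  proof (cases "0 \<le> q")
    case True
    then show ?thesis using nat[of "n mod int m" "nat q"] by simp
  next
    case False
    then show ?thesis using nat[of "n mod int m + q * int m" "nat (- q)"] by (simp add: algebra_simps)
  qed
  from this[of "n div int m"] show ?thesis by (simp add: add.commute)
qed

text \<open>Initial points are sorted by a lifted angle, later the one reached at \<open>T1\<close>:
  equal directions after different numbers of turns belong to different cells.\<close>

definition cell :: "real \<Rightarrow> real \<Rightarrow> (real \<times> real \<Rightarrow> real) \<Rightarrow> real \<Rightarrow> (real \<times> real) set" where
  "cell r R \<Theta> \<alpha> = polar ` {z \<in> {r..R} \<times> {0..pi/2}. \<Theta> z \<in> {\<alpha> - pi/2..\<alpha>}}"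

lemma cellE:
  assumes "p \<in> cell r R \<Theta> \<alpha>"
  obtains z where "z \<in> {r..R} \<times> {0..pi/2}" "\<Theta> z \<in> {\<alpha> - pi/2..\<alpha>}" "p = polar z"
  using assms unfolding cell_def by blast

lemma cellI:
  assumes "z \<in> {r..R} \<times> {0..pi/2}" "\<Theta> z \<in> {\<alpha> - pi/2..\<alpha>}"
  shows "polar z \<in> cell r R \<Theta> \<alpha>"
  using assms unfolding cell_def by blast

context stretching_system
begin

abbreviation symbol_set :: "nat \<Rightarrow> (real \<times> real) set" where
  "symbol_set j \<equiv> cell r R (\<lambda>z. snd (mid z)) (top_angle j)"

lemma symbol_set_nonempty:
  assumes "j \<in> {1..2 * k}"
  shows "symbol_set j \<noteq> {}"
proof -
  obtain z where "z \<in> sector" "snd (mid z) \<in> {top_angle j - pi/2..top_angle j}"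
    by (rule window_hit[OF assms])
  then have "polar z \<in> symbol_set j" by (rule cellI)
  then show ?thesis by blast
qed

lemma symbol_set_compact: "compact (symbol_set j)"
proof -
  have c: "continuous_on sector (\<lambda>z. snd (mid z))"
    by (intro continuous_intros continuous_mid) (use rR in auto)
  have "compact sector" by (intro compact_Times compact_Icc)
  moreover have "closed (sector \<inter> (\<lambda>z. snd (mid z)) -` {top_angle j - pi/2..top_angle j})"
    by (intro continuous_closed_preimage c compact_imp_closed[OF \<open>compact sector\<close>] closed_atLeastAtMost)
  ultimately have 1: "compact (sector \<inter> (sector \<inter> (\<lambda>z. snd (mid z)) -` {top_angle j - pi/2..top_angle j}))"
    by (rule compact_Int_closed)
  have 2: "sector \<inter> (sector \<inter> (\<lambda>z. snd (mid z)) -` {top_angle j - pi/2..top_angle j})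
     = {z \<in> sector. snd (mid z) \<in> {top_angle j - pi/2..top_angle j}}" by auto
  show ?thesis
    unfolding cell_def
  proof (rule compact_continuous_image)
    show "continuous_on {z \<in> sector. snd (mid z) \<in> {top_angle j - pi/2..top_angle j}} polar"
      unfolding polar_def by (intro continuous_intros)
    show "compact {z \<in> sector. snd (mid z) \<in> {top_angle j - pi/2..top_angle j}}"
      using 1 unfolding 2 .
  qed
qed

lemma symbol_set_quad1: "symbol_set j \<subseteq> quad1"
  unfolding cell_def using rR by (auto intro!: polar_in_quad1)

text \<open>Consecutive window tops are \<open>pi\<close> apart and windows have width
  \<open>pi/2\<close>; \<open>polar\<close> is injective on the sector, so a common point would have
  one angle in two windows.\<close>

lemma symbol_set_disjoint:
  assumes "i \<noteq> j"
  shows "symbol_set i \<inter> symbol_set j = {}"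
proof -
  have *: "i = j" if "top_angle i - pi/2 \<le> \<alpha>" "\<alpha> \<le> top_angle i" "top_angle j - pi/2 \<le> \<alpha>" "\<alpha> \<le> top_angle j"
    for \<alpha>
  proof -
    have "(real j - real i) * pi \<le> (1/2) * pi" "(real i - real j) * pi \<le> (1/2) * pi"
      using that by (auto simp: top_angle_def algebra_simps)
    then have "real j - real i \<le> 1/2" "real i - real j \<le> 1/2"
      by (simp_all only: mult_le_cancel_right_pos[OF pi_gt_zero])
    then show ?thesis by linarith
  qed
  have False if p: "p \<in> symbol_set i" "p \<in> symbol_set j" for p
  proof -
    obtain z where z: "z \<in> sector" "snd (mid z) \<in> {top_angle i - pi/2..top_angle i}" "p = polar z"
      using p(1) by (rule cellE)
    obtain z' where z': "z' \<in> sector" "snd (mid z') \<in> {top_angle j - pi/2..top_angle j}" "p = polar z'"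
      using p(2) by (rule cellE)
    have "z = z'" by (rule inj_onD[OF inj_polar]) (use z z' rR in auto)
    then show False using * z(2) z'(2) assms by auto
  qed
  then show ?thesis by blast
qed

text \<open>Each point of the cycle has its successor in the sector, so its final point lies in the
  annulus, where the clamped map agrees with the true period map.\<close>

lemma itinerary_cycle:
  fixes \<xi> :: "int \<Rightarrow> nat"
  assumes m: "m > 0" and \<xi>: "\<And>n. \<xi> n \<in> {1..2 * k}" and per: "\<And>n. \<xi> (n + int m) = \<xi> n"
  obtains V where "\<And>n. V n T = V (n + 1) 0" "\<And>n. V (n + int m) = V n" "\<And>n. V n 0 \<in> symbol_set (\<xi> n)"
    and "\<And>n t. t \<in> {0..T} \<Longrightarrow> V n t \<noteq> 0 \<and> \<bar>fst (V n t)\<bar> \<le> c \<and> \<bar>snd (V n t)\<bar> \<le> c"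
    and "\<And>n t. t \<in> {0..T} \<Longrightarrow>
      (V n has_vector_derivative (H (snd (V n t)), - b t * G (fst (V n t)))) (at t within {0..T})"
proof -
  define \<Phi> where "\<Phi> i z = quadrant_coords r (final (\<xi> (int i)) z)" for i z
  have fst\<Phi>: "fst (\<Phi> i z) = pos_norm (final (\<xi> (int i)) z)" for i z
    by (simp add: \<Phi>_def quadrant_coords_def)
  obtain z where z: "\<And>i. i < m \<Longrightarrow> z i \<in> sector" "\<And>i. i < m \<Longrightarrow> \<Phi> i (z i) = z (Suc i mod m)"
  proof (rule stretching_cycle[of r R 0 "pi/2" m \<Phi>])
    fix i assume "i < m"
    have "continuous_on sector (final (\<xi> (int i)))"
      by (rule continuous_final) (use rR in auto)
    from continuous_on_compose2[OF continuous_quadrant_coords[OF rR(1)] this subset_UNIV]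
    show "continuous_on sector (\<Phi> i)" by (simp add: \<Phi>_def[abs_def])
    show "snd (\<Phi> i z) \<in> {0..pi/2}" for z
      unfolding \<Phi>_def by (rule snd_quadrant_coords[OF rR(1)])
    show "(\<forall>t\<in>{0..pi/2}. fst (\<Phi> i (r, t)) \<le> r \<and> R \<le> fst (\<Phi> i (R, t))) \<or>
          (\<forall>t\<in>{0..pi/2}. R \<le> fst (\<Phi> i (r, t)) \<and> fst (\<Phi> i (R, t)) \<le> r)"
      using boundary[OF \<xi>[of "int i"]] rR unfolding fst\<Phi>
      by (cases "even (\<xi> (int i))") (auto simp: less_imp_le)
  qed (use rR m in auto)
  have "\<exists>v. v 0 = polar (z i) \<and> v T = polar (z (Suc i mod m)) \<and>
      (\<forall>t\<in>{0..T}. v t \<noteq> 0 \<and> \<bar>fst (v t)\<bar> \<le> c \<and> \<bar>snd (v t)\<bar> \<le> c) \<and>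
      (\<forall>t\<in>{0..T}. (v has_vector_derivative (H (snd (v t)), - b t * G (fst (v t)))) (at t within {0..T})) \<and>
      polar (z i) \<in> symbol_set (\<xi> (int i))" if i: "i < m" for i
  proof -
    have "z (Suc i mod m) \<in> sector" using m by (intro z) simp
    then have fin: "pos_norm (final (\<xi> (int i)) (z i)) \<in> {r..R}"
      unfolding fst\<Phi>[symmetric] z(2)[OF i] by auto
    have quad: "quadrant_coords r (final (\<xi> (int i)) (z i)) = z (Suc i mod m)"
      using z(2)[OF i] by (simp only: \<Phi>_def)
    have cell: "polar (z i) \<in> symbol_set (\<xi> (int i))"
      by (rule cellI) (rule z(1)[OF i] final_in_annulus(1)[OF \<xi> z(1)[OF i] fin])+
    show ?thesis
    proof (rule period_solution[OF \<xi> z(1)[OF i] fin])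
      fix v
      assume "v 0 = polar (z i)" "v T = polar (quadrant_coords r (final (\<xi> (int i)) (z i)))"
        and "\<And>t. t \<in> {0..T} \<Longrightarrow> v t \<noteq> 0 \<and> \<bar>fst (v t)\<bar> \<le> c \<and> \<bar>snd (v t)\<bar> \<le> c"
        and "\<And>t. t \<in> {0..T} \<Longrightarrow>
          (v has_vector_derivative (H (snd (v t)), - b t * G (fst (v t)))) (at t within {0..T})"
      with quad cell show ?thesis by (intro exI[of _ v]) simp
    qed
  qed
  then obtain v where v: "\<And>i. i < m \<Longrightarrow> v i 0 = polar (z i) \<and> v i T = polar (z (Suc i mod m)) \<and>
      (\<forall>t\<in>{0..T}. v i t \<noteq> 0 \<and> \<bar>fst (v i t)\<bar> \<le> c \<and> \<bar>snd (v i t)\<bar> \<le> c) \<and>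
      (\<forall>t\<in>{0..T}. (v i has_vector_derivative (H (snd (v i t)), - b t * G (fst (v i t)))) (at t within {0..T})) \<and>
      polar (z i) \<in> symbol_set (\<xi> (int i))"
    by metis
  \<comment> \<open>The \<open>m\<close> pieces found are repeated along all integers.\<close>
  define idx where "idx n = nat (n mod int m)" for n
  have idx: "idx n < m" "int (idx n) = n mod int m" for n
    using m by (simp_all add: idx_def nat_less_iff)
  have idx_Suc: "idx (n + 1) = Suc (idx n) mod m" for n
  proof -
    have "int (Suc (idx n) mod m) = (n mod int m + 1) mod int m"
      unfolding zmod_int using idx(2)[of n] by (simp add: add.commute)
    also have "\<dots> = int (idx (n + 1))" unfolding idx(2) by (rule mod_add_left_eq)
    finally show ?thesis by simp
  qed
  show thesis
  proof (rule that[of "\<lambda>n. v (idx n)"])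
    show "v (idx n) T = v (idx (n + 1)) 0" for n
      using v[OF idx(1), of n] v[OF idx(1), of "n + 1"] by (simp add: idx_Suc)
    show "v (idx (n + int m)) = v (idx n)" for n by (simp add: idx_def)
    show "v (idx n) 0 \<in> symbol_set (\<xi> n)" for n
      using v[OF idx(1), of n] periodic_sequence_mod[where \<xi> = \<xi>, OF m per, of n] by (simp add: idx(2))
  qed (use v idx in blast)+
qed

end

text \<open>Minimality of the period is left out here. Nonvanishing is recorded because the weight
  will be recovered from the orbit.\<close>

definition itinerary_solution ::
  "(real \<Rightarrow> real) \<Rightarrow> (real \<Rightarrow> real) \<Rightarrow> (real \<Rightarrow> real) \<Rightarrow> real \<Rightarrow> nat \<Rightarrow> (nat \<Rightarrow> (real \<times> real) set) \<Rightarrow>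
   (int \<Rightarrow> nat) \<Rightarrow> (real \<Rightarrow> real \<times> real) \<Rightarrow> bool" where
  "itinerary_solution h g w T m S \<xi> u \<longleftrightarrow> is_solution h g w u \<and> (\<forall>t. u (t + real m * T) = u t) \<and>
     (\<forall>t. u t \<noteq> 0) \<and> (\<forall>n. u (of_int n * T) \<in> S (\<xi> n))"

text \<open>The sets depend neither on \<open>m\<close> nor on the sequence. Arbitrary
  nonlinearities and weights are allowed, so the property can be transported by linear changes of
  variables.\<close>

definition symbolic_family ::
  "(real \<Rightarrow> real) \<Rightarrow> (real \<Rightarrow> real) \<Rightarrow> (real \<Rightarrow> real) \<Rightarrow> real \<Rightarrow> nat \<Rightarrow> (real \<times> real) set \<Rightarrow>
   (nat \<Rightarrow> (real \<times> real) set) \<Rightarrow> bool" where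
  "symbolic_family h g w T N Q S \<longleftrightarrow>
     (\<forall>j\<in>{1..N}. S j \<noteq> {} \<and> compact (S j) \<and> S j \<subseteq> Q) \<and>
     (\<forall>i\<in>{1..N}. \<forall>j\<in>{1..N}. i \<noteq> j \<longrightarrow> S i \<inter> S j = {}) \<and>
     (\<forall>m \<xi>. m > 0 \<longrightarrow> (\<forall>n. \<xi> n \<in> {1..N}) \<longrightarrow> (\<forall>n. \<xi> (n + int m) = \<xi> n) \<longrightarrow>
       (\<exists>u. itinerary_solution h g w T m S \<xi> u))"

lemma symbolic_family_sets:
  "symbolic_family h g w T N Q S \<Longrightarrow> j \<in> {1..N} \<Longrightarrow> S j \<noteq> {} \<and> compact (S j) \<and> S j \<subseteq> Q"
  unfolding symbolic_family_def by simp

lemma symbolic_family_disjoint: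
  "symbolic_family h g w T N Q S \<Longrightarrow> i \<in> {1..N} \<Longrightarrow> j \<in> {1..N} \<Longrightarrow> i \<noteq> j \<Longrightarrow> S i \<inter> S j = {}"
  unfolding symbolic_family_def by simp

lemma symbolic_family_itinerary:
  "symbolic_family h g w T N Q S \<Longrightarrow> m > 0 \<Longrightarrow> \<forall>n. \<xi> n \<in> {1..N} \<Longrightarrow> \<forall>n. \<xi> (n + int m) = \<xi> n \<Longrightarrow>
    \<exists>u. itinerary_solution h g w T m S \<xi> u"
  unfolding symbolic_family_def by simp

lemma stretching_symbolic_family:
  assumes S: "stretching_system (\<lambda>v. h (clip c v)) (\<lambda>v. g (clip c v)) w L W T1 T M \<phi> \<psi> k r R c"
    and per: "\<And>t. w (t + T) = w t"
  shows "\<exists>S. symbolic_family h g w T (2 * k) quad1 S"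
proof -
  interpret stretching_system "\<lambda>v. h (clip c v)" "\<lambda>v. g (clip c v)" w L W T1 T M \<phi> \<psi> k r R c by (rule S)
  have T0: "T > 0" using T by simp
  have "\<exists>u. itinerary_solution h g w T m symbol_set \<xi> u"
    if m: "m > 0" and \<xi>: "\<And>n. \<xi> n \<in> {1..2 * k}" "\<And>n. \<xi> (n + int m) = \<xi> n" for m \<xi>
  proof -
    show ?thesis
    proof (rule itinerary_cycle[where \<xi> = \<xi>, OF m \<xi>])
      fix V
      assume V: "\<And>n. V n T = V (n + 1) 0" "\<And>n. V (n + int m) = V n" "\<And>n. V n 0 \<in> symbol_set (\<xi> n)"
        "\<And>n t. t \<in> {0..T} \<Longrightarrow> V n t \<noteq> 0 \<and> \<bar>fst (V n t)\<bar> \<le> c \<and> \<bar>snd (V n t)\<bar> \<le> c"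
        "\<And>n t. t \<in> {0..T} \<Longrightarrow> (V n has_vector_derivative
           (h (clip c (snd (V n t))), - w t * g (clip c (fst (V n t))))) (at t within {0..T})"
      define u where "u t = V \<lfloor>t / T\<rfloor> (t - of_int \<lfloor>t / T\<rfloor> * T)" for t
      \<comment> \<open>Within the box \<open>clip c\<close> is the identity, so the pieces solve
        the original system.\<close>
      have "(V n has_vector_derivative (\<lambda>t z. (h (snd z), - w t * g (fst z))) t (V n t)) (at t within {0..T})"
        if "t \<in> {0..T}" for n t
        using V(5)[OF that, of n] V(4)[OF that, of n] by (simp add: clip_id)
      then have "(u has_vector_derivative (h (snd (u t)), - w t * g (fst (u t)))) (at t)" for t
        using concatenate_solutions[where f = "\<lambda>t z. (h (snd z), - w t * g (fst z))" and V = V and T = T, OF T0]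
          V(1) per unfolding u_def[abs_def] by simp
      then have "is_solution h g w u" by (simp add: is_solution_def)
      moreover have "u (t + real m * T) = u t" for t
      proof -
        have "(t + real m * T) / T = t / T + of_int (int m)" using T0 by (simp add: add_divide_distrib)
        then have "\<lfloor>(t + real m * T) / T\<rfloor> = \<lfloor>t / T\<rfloor> + int m" by (simp only: floor_add_int)
        then have "u (t + real m * T) = V \<lfloor>t / T\<rfloor> (t + real m * T - of_int (\<lfloor>t / T\<rfloor> + int m) * T)"
          by (simp only: u_def V(2))
        also have "t + real m * T - of_int (\<lfloor>t / T\<rfloor> + int m) * T = t - of_int \<lfloor>t / T\<rfloor> * T"
          by (simp add: distrib_right)
        finally show ?thesis by (simp only: u_def)
      qed
      moreover have "u t \<noteq> 0" for t
      proof -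
        have "of_int \<lfloor>t / T\<rfloor> \<le> t / T" "t / T < of_int \<lfloor>t / T\<rfloor> + 1"
          using floor_correct[of "t / T"] by auto
        then have "t - of_int \<lfloor>t / T\<rfloor> * T \<in> {0..T}"
          unfolding pos_le_divide_eq[OF T0] pos_divide_less_eq[OF T0] by (simp add: distrib_right)
        then show ?thesis unfolding u_def using V(4) by blast
      qed
      moreover have "u (of_int n * T) \<in> symbol_set (\<xi> n)" for n
        using V(3)[of n] T0 by (simp add: u_def)
      ultimately show ?thesis unfolding itinerary_solution_def by blast
    qed
  qed
  then show ?thesis
    unfolding symbolic_family_def
    using symbol_set_nonempty symbol_set_compact symbol_set_quad1 symbol_set_disjoint
    by (intro exI[of _ "symbol_set"]) blast
qed

section \<open>From the measure-theoretic sign conditions to pointwise bounds\<close>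

lemma meets_open_interval:
  fixes p q t :: real
  assumes "open U" "t \<in> U" "t \<in> {p..q}" "p < q"
  obtains s e where "0 < e" "{s - e..s + e} \<subseteq> U" "p < s - e" "s + e < q"
proof -
  have "t \<in> closure {p<..<q}" using assms by simp
  then have "U \<inter> {p<..<q} \<noteq> {}" using assms(1,2) open_Int_closure_eq_empty[OF assms(1)] by blast
  then obtain s where "s \<in> U \<inter> {p<..<q}" by blast
  moreover have "open (U \<inter> {p<..<q})" by (intro open_Int assms(1) open_greaterThanLessThan)
  ultimately obtain e where e: "0 < e" "cball s e \<subseteq> U \<inter> {p<..<q}"
    using open_contains_cball by blast
  then have sub: "{s - e..s + e} \<subseteq> U \<inter> {p<..<q}" by (simp only: cball_eq_atLeastAtMost)
  moreover have "s - e \<in> {s - e..s + e}" "s + e \<in> {s - e..s + e}" using e by auto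
  ultimately have "s - e \<in> {p<..<q}" "s + e \<in> {p<..<q}" by blast+
  then have "p < s - e" "s + e < q" by simp_all
  with e(1) sub show thesis by (intro that[of e s]) auto
qed

text \<open>By continuity a negative value would persist on a whole interval, which is not
  negligible.\<close>

lemma succ0_on_nonneg:
  assumes a: "continuous_on UNIV a" and s: "succ0_on a {p..q}" and pq: "p < q" and t: "t \<in> {p..q}"
  shows "0 \<le> a t"
proof (rule ccontr)
  assume neg: "\<not> 0 \<le> a t"
  have op: "open {s. a s < 0}" by (intro open_Collect_less a continuous_on_const)
  have "t \<in> {s. a s < 0}" using neg by simp
  from meets_open_interval[OF op this t pq]
  obtain s e where e: "0 < e" "{s - e..s + e} \<subseteq> {s. a s < 0}" "p < s - e" "s + e < q"
    by blast
  obtain N where N: "N \<in> null_sets lebesgue" "{t \<in> space lebesgue. \<not> (t \<in> {p..q} \<longrightarrow> a t \<ge> 0)} \<subseteq> N"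
    using s unfolding succ0_on_def eventually_ae_filter by blast
  have "{s - e<..<s + e} \<subseteq> N"
  proof
    fix r assume r: "r \<in> {s - e<..<s + e}"
    then have "r \<in> {s - e..s + e}" "r \<in> {p..q}" using e by auto
    then have "a r < 0" "r \<in> {p..q}" using e(2) by blast+
    then have "r \<in> {t \<in> space lebesgue. \<not> (t \<in> {p..q} \<longrightarrow> a t \<ge> 0)}" by simp
    then show "r \<in> N" using N(2) by blast
  qed
  moreover have "negligible N" using N(1) by (simp add: negligible_iff_null_sets)
  ultimately have "negligible {s - e<..<s + e}" by (rule negligible_subset[rotated])
  moreover have "\<not> negligible {s - e<..<s + e}"
    by (rule open_not_negligible) (use e in auto)
  ultimately show False by blast
qed

lemma succ0_on_pos:
  assumes "succ0_on a I"
  obtains t where "t \<in> I" "0 < a t"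
proof -
  obtain S where "S \<subseteq> I" "emeasure lebesgue S > 0" "\<forall>t\<in>S. a t > 0"
    using assms unfolding succ0_on_def by blast
  moreover from this have "S \<noteq> {}" by auto
  ultimately show thesis using that by blast
qed

text \<open>Continuity turns one positive value into a uniform bound on a closed interval strictly
  inside: the time during which rotation or saddle drift can be counted on.\<close>

lemma succ0_on_plateau:
  assumes a: "continuous_on UNIV a" and s: "succ0_on a {p..q}" and pq: "p < q"
  obtains \<sigma>1 \<sigma>2 \<delta> where "p < \<sigma>1" "\<sigma>1 < \<sigma>2" "\<sigma>2 < q" "0 < \<delta>" "\<And>t. t \<in> {\<sigma>1..\<sigma>2} \<Longrightarrow> \<delta> \<le> a t"
proof -
  obtain t where t: "t \<in> {p..q}" "0 < a t" by (rule succ0_on_pos[OF s])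
  have op: "open {s. a t / 2 < a s}" by (intro open_Collect_less a continuous_on_const)
  have "t \<in> {s. a t / 2 < a s}" using t(2) by simp
  from meets_open_interval[OF op this t(1) pq]
  obtain s e where e: "0 < e" "{s - e..s + e} \<subseteq> {s. a t / 2 < a s}" "p < s - e" "s + e < q"
    by blast
  show thesis
  proof (rule that[of "s - e" "s + e" "a t / 2"])
    show "a t / 2 \<le> a r" if "r \<in> {s - e..s + e}" for r
      using subsetD[OF e(2) that] by simp
  qed (use e t in auto)
qed

lemma cond_C0_restoring: "cond_C0 f \<Longrightarrow> restoring f"
  by (simp add: cond_C0_def restoring_def)

text \<open>Any real number strictly between 0 and the lower limit serves as \<open>\<eta>\<close>;
  halving the radius gives a closed interval.\<close>

lemma cond_C0_slope:
  assumes "cond_C0 f"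
  obtains \<eta> \<epsilon> where "0 < \<eta>" "0 < \<epsilon>" "\<And>v. \<bar>v\<bar> \<le> \<epsilon> \<Longrightarrow> \<eta> * v\<^sup>2 \<le> v * f v"
proof -
  have "0 < Liminf (at (0::real)) (\<lambda>x. ereal (f x / x))" using assms by (simp add: cond_C0_def)
  then obtain \<eta> where \<eta>: "0 < ereal \<eta>" "ereal \<eta> < Liminf (at (0::real)) (\<lambda>x. ereal (f x / x))"
    using ereal_dense2 by blast
  from less_LiminfD[OF \<eta>(2)] obtain d where d: "d > 0" "\<And>x. x \<noteq> 0 \<Longrightarrow> \<bar>x\<bar> < d \<Longrightarrow> \<eta> < f x / x"
    unfolding eventually_at by (auto simp: dist_real_def)
  show thesis
  proof (rule that[of \<eta> "d/2"])
    show "\<eta> * v\<^sup>2 \<le> v * f v" if "\<bar>v\<bar> \<le> d/2" for v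
    proof (cases "v = 0")
      case False
      then have "\<eta> * v\<^sup>2 \<le> f v / v * v\<^sup>2" using d that by (intro mult_right_mono less_imp_le[OF d(2)]) auto
      also have "\<dots> = v * f v" using False by (simp add: power2_eq_square)
      finally show ?thesis .
    qed simp
  qed (use \<eta> d in auto)
qed

text \<open>Two diagonal changes of variables matter: \<open>p = 1\<close>,
  \<open>q = sqrt lam\<close> normalises the weight, and \<open>p = q = - 1\<close> exchanges the
  first and third quadrants.\<close>

lemma symbolic_family_rescale:
  assumes fam: "symbolic_family H G w T N Q S" and pq: "p \<noteq> 0" "q \<noteq> 0"
    and Q: "\<And>x y. (x, y) \<in> Q \<Longrightarrow> (p * x, q * y) \<in> Q'"
    and h: "\<And>y. h (q * y) = p * H y" and g: "\<And>t x. w' t * g (p * x) = q * (w t * G x)"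
  shows "symbolic_family h g w' T N Q' (\<lambda>j. (\<lambda>z. (p * fst z, q * snd z)) ` S j)"
proof -
  let ?F = "\<lambda>z. (p * fst z, q * snd z) :: real \<times> real"
  have inj: "inj ?F" using pq by (auto intro!: injI simp: prod_eq_iff)
  note S = symbolic_family_sets[OF fam] symbolic_family_disjoint[OF fam] symbolic_family_itinerary[OF fam]
  have "?F ` S j \<noteq> {} \<and> compact (?F ` S j) \<and> ?F ` S j \<subseteq> Q'" if "j \<in> {1..N}" for j
  proof (intro conjI)
    show "?F ` S j \<noteq> {}" using S(1)[OF that] by simp
    show "compact (?F ` S j)"
      by (rule compact_continuous_image) (use S(1)[OF that] in \<open>auto intro!: continuous_intros\<close>)
    show "?F ` S j \<subseteq> Q'" using S(1)[OF that] Q by force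
  qed
  moreover have "?F ` S i \<inter> ?F ` S j = {}" if "i \<in> {1..N}" "j \<in> {1..N}" "i \<noteq> j" for i j
    using S(2)[OF that] image_Int[OF inj, of "S i" "S j"] by simp
  moreover have "\<exists>u. itinerary_solution h g w' T m (\<lambda>j. ?F ` S j) \<xi> u"
    if \<xi>: "m > 0" "\<forall>n. \<xi> n \<in> {1..N}" "\<forall>n. \<xi> (n + int m) = \<xi> n" for m \<xi>
  proof -
    obtain u where u: "is_solution H G w u" "\<And>t. u (t + real m * T) = u t" "\<And>t. u t \<noteq> 0"
      "\<And>n. u (of_int n * T) \<in> S (\<xi> n)"
      using S(3)[OF \<xi>] unfolding itinerary_solution_def by blast
    have lin: "bounded_linear ?F"
      by (intro bounded_linear_Pair bounded_linear_const_mult bounded_linear_fst bounded_linear_snd)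
    have "((\<lambda>t. ?F (u t)) has_vector_derivative (h (snd (?F (u t))), - w' t * g (fst (?F (u t))))) (at t)" for t
    proof -
      have "(u has_vector_derivative (H (snd (u t)), - w t * G (fst (u t)))) (at t)"
        using u(1) by (simp add: is_solution_def)
      from bounded_linear.has_vector_derivative[OF lin this] show ?thesis by (simp add: h g)
    qed
    then have "is_solution h g w' (\<lambda>t. ?F (u t))" by (simp add: is_solution_def)
    moreover have "?F (u t) \<noteq> 0" for t using u(3)[of t] pq by (auto simp: prod_eq_iff)
    moreover have "?F (u (of_int n * T)) \<in> ?F ` S (\<xi> n)" for n by (rule imageI[OF u(4)])
    moreover have "?F (u (t + real m * T)) = ?F (u t)" for t by (simp only: u(2))
    ultimately have "itinerary_solution h g w' T m (\<lambda>j. ?F ` S j) \<xi> (\<lambda>t. ?F (u t))"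
      unfolding itinerary_solution_def by blast
    then show ?thesis by blast
  qed
  ultimately show ?thesis unfolding symbolic_family_def by blast
qed

lemma loc_lipschitz_rescale:
  assumes "loc_lipschitz f"
  shows "loc_lipschitz (\<lambda>v. p * f (q * v))"
  unfolding loc_lipschitz_def
proof
  fix x
  obtain U L where U: "open U" "q * x \<in> U" "L-lipschitz_on U f"
    using assms unfolding loc_lipschitz_def by blast
  let ?V = "(\<lambda>v. q * v) -` U"
  have "open ?V" by (intro open_vimage U continuous_intros)
  moreover have "(\<bar>p\<bar> * L * \<bar>q\<bar>)-lipschitz_on ?V (\<lambda>v. p * f (q * v))"
  proof (rule lipschitz_onI)
    have L: "0 \<le> L" using U(3) by (rule lipschitz_on_nonneg)
    then show "0 \<le> \<bar>p\<bar> * L * \<bar>q\<bar>" by simp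
    fix u v assume "u \<in> ?V" "v \<in> ?V"
    then have "dist (f (q * u)) (f (q * v)) \<le> L * dist (q * u) (q * v)"
      using lipschitz_onD[OF U(3)] by simp
    then have "\<bar>p\<bar> * \<bar>f (q * u) - f (q * v)\<bar> \<le> \<bar>p\<bar> * (L * \<bar>q * u - q * v\<bar>)"
      by (intro mult_left_mono) (simp_all add: dist_real_def)
    then show "dist (p * f (q * u)) (p * f (q * v)) \<le> \<bar>p\<bar> * L * \<bar>q\<bar> * dist u v"
      by (simp add: dist_real_def abs_mult ac_simps flip: right_diff_distrib)
  qed
  ultimately show "\<exists>U L. open U \<and> x \<in> U \<and> L-lipschitz_on U (\<lambda>v. p * f (q * v))"
    using U(2) by blast
qed

lemma bounded_image_rescale:
  fixes f :: "real \<Rightarrow> real"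
  assumes "bounded (f ` A)" "\<And>v. v \<in> B \<Longrightarrow> q * v \<in> A"
  shows "bounded ((\<lambda>v. p * f (q * v)) ` B)"
proof -
  obtain K where K: "0 \<le> K" "\<And>v. v \<in> A \<Longrightarrow> \<bar>f v\<bar> \<le> K"
    using bounded_image_abs_le[OF assms(1)] by blast
  have "\<bar>p * f (q * v)\<bar> \<le> \<bar>p\<bar> * K" if "v \<in> B" for v
    using K assms(2)[OF that] by (simp add: abs_mult mult_left_mono)
  then show ?thesis by (intro boundedI[of _ "\<bar>p\<bar> * K"]) auto
qed

lemma restoring_rescale:
  assumes "restoring f" "0 < p * q"
  shows "restoring (\<lambda>v. p * f (q * v))"
  unfolding restoring_def
proof (intro conjI allI impI)
  show "p * f (q * 0) = 0" using assms by (simp add: restoring_def)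
  fix v :: real assume "v \<noteq> 0"
  then have "q * v \<noteq> 0" using assms(2) by auto
  then have "0 < f (q * v) * (q * v)" using assms(1) unfolding restoring_def by blast
  then have "0 < (p * q) * (f (q * v) * (q * v))" using assms(2) by simp
  also have "\<dots> = (p * f (q * v) * v) * q\<^sup>2" by (simp add: power2_eq_square ac_simps)
  finally show "0 < p * f (q * v) * v" by (simp add: zero_less_mult_iff)
qed

text \<open>Rescaling \<open>y\<close> by \<open>sqrt lam\<close> normalises the weight on \<open>[0, T1]\<close> to \<open>a\<close> and multiplies both slopes at the
  origin by \<open>sqrt lam\<close>, so large \<open>lam\<close> means fast rotation near the origin.\<close>

lemma exists_quad1_family:
  fixes h g a :: "real \<Rightarrow> real"
  assumes lip: "loc_lipschitz h" "loc_lipschitz g" and rest: "restoring h" "restoring g"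
    and slope: "0 < \<eta>" "0 < \<epsilon>" "\<And>v. \<bar>v\<bar> \<le> \<epsilon> \<Longrightarrow> \<eta> * v\<^sup>2 \<le> v * h v" "\<And>v. \<bar>v\<bar> \<le> \<epsilon> \<Longrightarrow> \<eta> * v\<^sup>2 \<le> v * g v"
    and bnd: "bounded (h ` {..0}) \<or> bounded (h ` {0..}) \<or> bounded (g ` {..0}) \<or> bounded (g ` {0..})"
    and a: "continuous_on UNIV a" and T: "0 < T1" "T1 < T" and per: "\<forall>t. a (t + T) = a t"
    and sgn: "succ0_on a {0..T1}" "prec0_on a {T1..T}"
  shows "\<exists>\<Lambda>>0. \<forall>lam>\<Lambda>. \<exists>\<mu>s>0. \<forall>\<mu>>\<mu>s. \<exists>S. symbolic_family h g (a_lm a lam \<mu>) T (2 * k) quad1 S"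
proof -
  have a': "continuous_on UNIV (\<lambda>t. - a t)" using a by (intro continuous_intros)
  have sgn': "succ0_on (\<lambda>t. - a t) {T1..T}" using sgn(2) by (simp add: prec0_on_def)
  have a_pos: "0 \<le> a t" if "t \<in> {0..T1}" for t by (rule succ0_on_nonneg[OF a sgn(1) T(1) that])
  have a_neg: "a t \<le> 0" if "t \<in> {T1..T}" for t using succ0_on_nonneg[OF a' sgn' T(2) that] by simp
  obtain \<sigma>1 \<sigma>2 \<delta>0 where \<sigma>: "0 < \<sigma>1" "\<sigma>1 < \<sigma>2" "\<sigma>2 < T1" "0 < \<delta>0" "\<And>t. t \<in> {\<sigma>1..\<sigma>2} \<Longrightarrow> \<delta>0 \<le> a t"
    by (rule succ0_on_plateau[OF a sgn(1) T(1)]) blast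
  obtain \<tau>1 \<tau>2 \<kappa> where \<tau>: "T1 < \<tau>1" "\<tau>1 < \<tau>2" "\<tau>2 < T" "0 < \<kappa>" "\<And>t. t \<in> {\<tau>1..\<tau>2} \<Longrightarrow> \<kappa> \<le> - a t"
    by (rule succ0_on_plateau[OF a' sgn' T(2)]) blast
  define \<delta> where "\<delta> = min 1 \<delta>0"
  have \<delta>: "0 < \<delta>" "\<delta> \<le> 1" "\<And>t. t \<in> {\<sigma>1..\<sigma>2} \<Longrightarrow> \<delta> \<le> a t" using \<sigma>(4,5) by (auto simp: \<delta>_def min_le_iff_disj)
  \<comment> \<open>The scale factor \<open>sqrt lam\<close> at which the enlarged slope just
    produces the required rotation; the threshold for \<open>lam\<close> is therefore its
    square.\<close>
  define q where "q = (2 * real k + 3) * pi / (\<eta> * \<delta> * (\<sigma>2 - \<sigma>1))"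
  have den: "0 < \<eta> * \<delta> * (\<sigma>2 - \<sigma>1)" using slope \<delta> \<sigma> by simp
  have q: "0 < q" unfolding q_def by (rule divide_pos_pos[OF _ den]) (simp add: add_nonneg_pos)
  have main: "\<exists>\<mu>s>0. \<forall>\<mu>>\<mu>s. \<exists>S. symbolic_family h g (a_lm a lam \<mu>) T (2 * k) quad1 S" if lam: "q\<^sup>2 < lam" for lam
  proof -
    have lam0: "0 < lam" using lam zero_le_power2[of q] by linarith
    define s where "s = sqrt lam"
    have s: "0 < s" "s\<^sup>2 = lam" using lam0 by (auto simp: s_def)
    have qs: "q < s" unfolding s_def using lam by (intro real_less_rsqrt)
    \<comment> \<open>With \<open>y = s * Y\<close> the system becomes
      \<open>x' = h (s * Y)\<close>, \<open>Y' = - a_lm a 1 \<nu> t * (s * g x)\<close>, where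
      \<open>\<mu> = lam * \<nu>\<close>: of the two factors \<open>s\<close> in \<open>lam\<close>,
      one is cancelled by the rescaling.\<close>
    define H where "H v = h (s * v)" for v
    define G where "G v = s * g v" for v
    have HG: "H = (\<lambda>v. 1 * h (s * v))" "G = (\<lambda>v. s * g (1 * v))" by (auto simp: H_def G_def)
    \<comment> \<open>The argument of \<open>h\<close> is multiplied by \<open>s\<close>, so
      \<open>H\<close> needs \<open>\<epsilon> / s\<close>; \<open>G\<close> needs
      \<open>\<epsilon>\<close>.\<close>
    define \<epsilon>' where "\<epsilon>' = min \<epsilon> (\<epsilon> / s)"
    have slopeH: "(s * \<eta>) * v\<^sup>2 \<le> v * H v" if "\<bar>v\<bar> \<le> \<epsilon>'" for v
    proof -
      have "\<bar>v\<bar> \<le> \<epsilon> / s" using that by (simp add: \<epsilon>'_def)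
      then have "\<bar>s * v\<bar> \<le> \<epsilon>" using s by (simp add: abs_mult pos_le_divide_eq mult.commute)
      from slope(3)[OF this] have "s * ((s * \<eta>) * v\<^sup>2) \<le> s * (v * H v)"
        by (simp add: H_def power2_eq_square ac_simps)
      then show ?thesis using s by simp
    qed
    have slopeG: "(s * \<eta>) * v\<^sup>2 \<le> v * G v" if "\<bar>v\<bar> \<le> \<epsilon>'" for v
    proof -
      have "\<bar>v\<bar> \<le> \<epsilon>" using that by (simp add: \<epsilon>'_def)
      from mult_left_mono[OF slope(4)[OF this], of s] show ?thesis using s by (simp add: G_def ac_simps)
    qed
    have lipHG: "loc_lipschitz H" "loc_lipschitz G"
      unfolding HG by (intro loc_lipschitz_rescale lip)+
    have restHG: "restoring H" "restoring G"
      unfolding HG by (intro restoring_rescale rest; use s in simp)+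
    have bndHG: "bounded (H ` {..0}) \<or> bounded (H ` {0..}) \<or> bounded (G ` {..0}) \<or> bounded (G ` {0..})"
    proof -
      have h: "bounded (h ` A) \<Longrightarrow> bounded (H ` A)" if "\<And>v. v \<in> A \<Longrightarrow> s * v \<in> A" for A
        unfolding HG by (rule bounded_image_rescale) (use that in auto)
      have g: "bounded (g ` A) \<Longrightarrow> bounded (G ` A)" for A
        unfolding HG by (rule bounded_image_rescale) auto
      have "bounded (h ` {..0}) \<Longrightarrow> bounded (H ` {..0})" "bounded (h ` {0..}) \<Longrightarrow> bounded (H ` {0..})"
        by (rule h; use s in \<open>simp add: mult_nonneg_nonpos\<close>)+
      then show ?thesis using bnd g by blast
    qed
    have rot: "(2 * real k + 3) * pi \<le> (s * \<eta>) * \<delta> * (\<sigma>2 - \<sigma>1)"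
    proof -
      have "(2 * real k + 3) * pi = q * (\<eta> * \<delta> * (\<sigma>2 - \<sigma>1))"
        using den by (metis nonzero_eq_divide_eq order_less_irrefl q_def)
      also have "\<dots> \<le> s * (\<eta> * \<delta> * (\<sigma>2 - \<sigma>1))" using qs den by (intro mult_right_mono) auto
      finally show ?thesis by (simp add: ac_simps)
    qed
    have \<epsilon>': "0 < \<epsilon>'" "0 \<le> s * \<eta>" using s slope by (auto simp: \<epsilon>'_def)
    have \<tau>5: "a t \<le> - \<kappa>" if "t \<in> {\<tau>1..\<tau>2}" for t using \<tau>(5)[OF that] by simp
    obtain \<nu>0 c L W M r R where \<nu>0: "0 < \<nu>0" "\<And>\<nu>. \<nu>0 < \<nu> \<Longrightarrow>
        \<exists>\<phi> \<psi>. stretching_system (\<lambda>v. H (clip c v)) (\<lambda>v. G (clip c v)) (a_lm a 1 \<nu>) L W T1 T M \<phi> \<psi> k r R c"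
      using exists_stretching[OF lipHG restHG bndHG a T a_pos a_neg \<epsilon>' slopeH slopeG
          less_imp_le[OF \<sigma>(1)] less_imp_le[OF \<sigma>(2)] less_imp_le[OF \<sigma>(3)] \<delta>(2,3) rot \<tau>(1-4) \<tau>5] by metis
    have "\<exists>S. symbolic_family h g (a_lm a lam \<mu>) T (2 * k) quad1 S" if \<mu>: "lam * \<nu>0 < \<mu>" for \<mu>
    proof -
      define \<nu> where "\<nu> = \<mu> / lam"
      have "\<nu>0 < \<nu>" using \<mu> lam0 by (simp add: \<nu>_def pos_less_divide_eq mult.commute)
      moreover have "a_lm a 1 \<nu> (t + T) = a_lm a 1 \<nu> t" for t
        using per by (simp add: a_lm_def pos_part_def neg_part_def)
      ultimately obtain S where S: "symbolic_family H G (a_lm a 1 \<nu>) T (2 * k) quad1 S"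
        using \<nu>0(2) stretching_symbolic_family by meson
      have "symbolic_family h g (a_lm a lam \<mu>) T (2 * k) quad1 (\<lambda>j. (\<lambda>z. (1 * fst z, s * snd z)) ` S j)"
      proof (rule symbolic_family_rescale[OF S])
        have w: "a_lm a lam \<mu> t = lam * a_lm a 1 \<nu> t" for t
          using lam0 by (simp add: a_lm_def \<nu>_def algebra_simps)
        show "a_lm a lam \<mu> t * g (1 * x) = s * (a_lm a 1 \<nu> t * G x)" for t x
          unfolding w G_def using s(2) by (simp add: power2_eq_square mult.left_commute flip: s(2))
      qed (use s in \<open>auto simp: H_def quad1_def\<close>)
      then show ?thesis by blast
    qed
    moreover have "0 < lam * \<nu>0" using lam0 \<nu>0 by simp
    ultimately show ?thesis by blast
  qed
  have "0 < q\<^sup>2" using q by simp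
  with main show ?thesis by blast
qed

text \<open>Reflection in the origin moves the bounded branch to the other half line, so the
  disjunction of the four boundedness conditions is preserved, as are the slopes and the
  weight.\<close>

lemma exists_quad3_family:
  fixes h g a :: "real \<Rightarrow> real"
  assumes lip: "loc_lipschitz h" "loc_lipschitz g" and rest: "restoring h" "restoring g"
    and slope: "0 < \<eta>" "0 < \<epsilon>" "\<And>v. \<bar>v\<bar> \<le> \<epsilon> \<Longrightarrow> \<eta> * v\<^sup>2 \<le> v * h v" "\<And>v. \<bar>v\<bar> \<le> \<epsilon> \<Longrightarrow> \<eta> * v\<^sup>2 \<le> v * g v"
    and bnd: "bounded (h ` {..0}) \<or> bounded (h ` {0..}) \<or> bounded (g ` {..0}) \<or> bounded (g ` {0..})"
    and a: "continuous_on UNIV a" and T: "0 < T1" "T1 < T" and per: "\<forall>t. a (t + T) = a t"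
    and sgn: "succ0_on a {0..T1}" "prec0_on a {T1..T}"
  shows "\<exists>\<Lambda>>0. \<forall>lam>\<Lambda>. \<exists>\<mu>s>0. \<forall>\<mu>>\<mu>s. \<exists>S. symbolic_family h g (a_lm a lam \<mu>) T (2 * k) quad3 S"
proof -
  define H where "H v = - 1 * h (- 1 * v)" for v
  define G where "G v = - 1 * g (- 1 * v)" for v
  have "\<exists>\<Lambda>>0. \<forall>lam>\<Lambda>. \<exists>\<mu>s>0. \<forall>\<mu>>\<mu>s. \<exists>S. symbolic_family H G (a_lm a lam \<mu>) T (2 * k) quad1 S"
  proof (rule exists_quad1_family[OF _ _ _ _ slope(1,2) _ _ _ a T per sgn])
    show "loc_lipschitz H" "loc_lipschitz G"
      unfolding H_def[abs_def] G_def[abs_def] by (intro loc_lipschitz_rescale lip)+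
    show "restoring H" "restoring G"
      unfolding H_def[abs_def] G_def[abs_def] by (intro restoring_rescale rest; simp)+
    show "\<eta> * v\<^sup>2 \<le> v * H v" "\<eta> * v\<^sup>2 \<le> v * G v" if "\<bar>v\<bar> \<le> \<epsilon>" for v
      using slope(3,4)[of "- v"] that by (simp_all add: H_def G_def)
    show "bounded (H ` {..0}) \<or> bounded (H ` {0..}) \<or> bounded (G ` {..0}) \<or> bounded (G ` {0..})"
    proof -
      have *: "bounded (f ` {..0}) \<Longrightarrow> bounded ((\<lambda>v. - 1 * f (- 1 * v)) ` {0..})"
        "bounded (f ` {0..}) \<Longrightarrow> bounded ((\<lambda>v. - 1 * f (- 1 * v)) ` {..0})" for f :: "real \<Rightarrow> real"
        by (rule bounded_image_rescale, assumption, simp)+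
      show ?thesis
        unfolding H_def[abs_def] G_def[abs_def] using bnd *[of h] *[of g] by blast
    qed
  qed
  moreover have "\<exists>S. symbolic_family h g w T (2 * k) quad3 S"
    if S: "\<exists>S. symbolic_family H G w T (2 * k) quad1 S" for w
  proof -
    from S obtain S where S: "symbolic_family H G w T (2 * k) quad1 S" by blast
    have "symbolic_family h g w T (2 * k) quad3 (\<lambda>j. (\<lambda>z. (- 1 * fst z, - 1 * snd z)) ` S j)"
      by (rule symbolic_family_rescale[OF S]) (auto simp: H_def G_def quad1_def quad3_def)
    then show ?thesis by blast
  qed
  ultimately show ?thesis by meson
qed

section \<open>Minimal periods\<close>

text \<open>Where \<open>x\<close> vanishes \<open>y\<close> does not, so the zeros of \<open>x\<close> are isolated; elsewhere the second equation
  determines the weight from the orbit.\<close>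

lemma solution_period_imp_weight_period:
  assumes sol: "is_solution h g w u" and rest: "restoring h" "restoring g" and nz: "\<And>t. u t \<noteq> 0"
    and w: "continuous_on UNIV w" and per: "\<And>t. u (t + q) = u t"
  shows "w (t + q) = w t"
proof -
  have du: "(u has_vector_derivative (h (snd (u t)), - w t * g (fst (u t)))) (at t)" for t
    using sol by (simp add: is_solution_def)
  have ne: "f v \<noteq> 0" if "restoring f" "v \<noteq> 0" for f :: "real \<Rightarrow> real" and v
  proof -
    have "0 < f v * v" using that by (simp add: restoring_def)
    then show ?thesis by auto
  qed
  have off: "w (t + q) = w t" if "fst (u t) \<noteq> 0" for t
  proof -
    have "((u \<circ> (\<lambda>t. t + q)) has_vector_derivative 1 *\<^sub>R (h (snd (u (t + q))), - w (t + q) * g (fst (u (t + q))))) (at t)"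
      by (rule vector_diff_chain_at[OF _ du]) (auto intro!: derivative_eq_intros)
    moreover have "u \<circ> (\<lambda>t. t + q) = u" using per by auto
    ultimately have "(u has_vector_derivative (h (snd (u t)), - w (t + q) * g (fst (u t)))) (at t)"
      by (simp add: per)
    from vector_derivative_unique_at[OF this du[of t]] show ?thesis
      using ne[OF rest(2) that] by simp
  qed
  show ?thesis
  proof (cases "fst (u t) = 0")
    case True
    then have "snd (u t) \<noteq> 0" using nz[of t] by (simp add: prod_eq_iff)
    then have D: "h (snd (u t)) \<noteq> 0" by (rule ne[OF rest(1)])
    have "((\<lambda>s. fst (u s)) has_real_derivative h (snd (u t))) (at t)"
      using has_real_derivative_fst_snd(1)[OF du[of t]] by simp
    then have "((\<lambda>s. (fst (u s) - fst (u t)) / (s - t)) \<longlongrightarrow> h (snd (u t))) (at t)"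
      by (simp add: has_field_derivative_iff)
    from tendsto_imp_eventually_ne[OF this D]
    have ev: "\<forall>\<^sub>F s in at t. w (s + q) = w s"
      by (rule eventually_mono) (use True in \<open>auto intro!: off\<close>)
    have cont: "isCont w s" for s using w by (simp add: continuous_on_eq_continuous_at)
    have "(\<lambda>s. w (s + q) - w s) \<midarrow>t\<rightarrow> w (t + q) - w t"
      by (intro tendsto_diff isCont_tendsto_compose[OF cont] isContD[OF cont] tendsto_intros)
    moreover have "(\<lambda>s. w (s + q) - w s) \<midarrow>t\<rightarrow> 0"
      by (rule tendsto_eventually) (use ev in \<open>auto elim: eventually_mono\<close>)
    ultimately have "w (t + q) - w t = 0" by (rule LIM_unique)
    then show ?thesis by simp
  qed (rule off)
qed

text \<open>Shifted by \<open>r\<close>, a positive time close to the supremum of \<open>P\<close>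
  can land neither in \<open>[0, T1]\<close>, beyond the supremum, nor in \<open>[T1, T]\<close>, so
  it lands past \<open>T\<close>. Hence \<open>T - r \<le> T1\<close>, and shifting negative times
  left by \<open>T - r\<close> keeps them in \<open>N\<close>, against its infimum.\<close>

lemma no_smaller_period:
  fixes w :: "real \<Rightarrow> real"
  assumes per: "\<And>t. w (t + T) = w t" "\<And>t. w (t + r) = w t" and r: "0 < r" "r < T"
    and pos: "\<And>t. t \<in> {0..T1} \<Longrightarrow> 0 \<le> w t" and neg: "\<And>t. t \<in> {T1..T} \<Longrightarrow> w t \<le> 0"
    and p: "p \<in> {0..T1}" "0 < w p" and n: "n \<in> {T1..T}" "w n < 0"
  shows False
proof -
  define P where "P = {t \<in> {0..T1}. 0 < w t}"
  define N where "N = {t \<in> {T1..T}. w t < 0}"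
  have P: "P \<noteq> {}" "bdd_above P" using p by (auto simp: P_def intro!: bdd_aboveI[of _ T1])
  have N: "N \<noteq> {}" "bdd_below N" using n by (auto simp: N_def intro!: bdd_belowI[of _ T1])
  obtain t where t: "t \<in> P" "Sup P - r < t" using less_cSupD[OF P(1), of "Sup P - r"] r by auto
  have wt: "0 < w (t + r)" using t(1) per(2)[of t] by (simp add: P_def)
  have far: "T \<le> t + r"
  proof (rule ccontr)
    assume lt: "\<not> T \<le> t + r"
    show False
    proof (cases "t + r \<le> T1")
      case True
      then have "t + r \<in> P" using t(1) r wt by (simp add: P_def)
      then show False using cSup_upper[OF _ P(2)] t(2) by force
    next
      case False
      then have "w (t + r) \<le> 0" using lt by (intro neg) auto
      then show False using wt by simp
    qed
  qed
  have shift: "s - (T - r) \<in> N" if "s \<in> N" for s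
  proof -
    have s: "T1 \<le> s" "s \<le> T" "w s < 0" using that by (auto simp: N_def)
    have "w (s - (T - r)) = w s" using per(1)[of "s - (T - r)"] per(2)[of s] by (simp add: algebra_simps)
    then have ws: "w (s - (T - r)) < 0" using s by simp
    have "0 \<le> s - (T - r)" using far s t(1) by (simp add: P_def)
    moreover have "\<not> s - (T - r) \<le> T1" using pos[of "s - (T - r)"] ws calculation by auto
    ultimately show ?thesis using s ws r by (simp add: N_def)
  qed
  obtain s where s: "s \<in> N" "s < Inf N + (T - r)" using cInf_lessD[OF N(1), of "Inf N + (T - r)"] r by auto
  then show False using cInf_lower[OF shift[OF s(1)] N(2)] by simp
qed

text \<open>Write a smaller period as \<open>i * T + r\<close> with \<open>0 \<le> r < T\<close>. It
  is also a period of the weight, whose signs exclude \<open>r > 0\<close>; for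
  \<open>r = 0\<close>, disjointness of the sets would give the sequence the period
  \<open>i < m\<close>.\<close>

lemma itinerary_minimal_period:
  assumes u: "itinerary_solution h g (a_lm a lam mu) T m S \<xi> u"
    and disj: "\<And>i j. i \<in> {1..N} \<Longrightarrow> j \<in> {1..N} \<Longrightarrow> i \<noteq> j \<Longrightarrow> S i \<inter> S j = {}"
    and \<xi>: "\<And>n. \<xi> n \<in> {1..N}" "seq_minimal_period \<xi> m"
    and rest: "restoring h" "restoring g" and lm: "0 < lam" "0 < mu"
    and a: "continuous_on UNIV a" and T: "0 < T1" "T1 < T" and per: "\<forall>t. a (t + T) = a t"
    and sgn: "succ0_on a {0..T1}" "prec0_on a {T1..T}"
  shows "minimal_period u (real m * T)"
proof -
  let ?w = "a_lm a lam mu"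
  have a': "continuous_on UNIV (\<lambda>t. - a t)" using a by (intro continuous_intros)
  have sgn': "succ0_on (\<lambda>t. - a t) {T1..T}" using sgn(2) by (simp add: prec0_on_def)
  have wpos: "0 \<le> ?w t" if "t \<in> {0..T1}" for t
    using succ0_on_nonneg[OF a sgn(1) T(1) that] lm by (simp add: a_lm_nonneg)
  have wneg: "?w t \<le> 0" if "t \<in> {T1..T}" for t
    using succ0_on_nonneg[OF a' sgn' T(2) that] lm by (simp add: a_lm_nonpos mult_nonneg_nonpos)
  obtain p where p: "p \<in> {0..T1}" "0 < a p" by (rule succ0_on_pos[OF sgn(1)])
  obtain n where n: "n \<in> {T1..T}" "0 < - a n" by (rule succ0_on_pos[OF sgn'])
  have wp: "0 < ?w p" using p lm by (simp add: a_lm_nonneg)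
  have wn: "?w n < 0" using n lm by (simp add: a_lm_nonpos mult_pos_neg)
  have wT: "?w (t + T) = ?w t" for t using per by (simp add: a_lm_def pos_part_def neg_part_def)
  have T0: "0 < T" using T by simp
  have wTn: "?w (t + real i * T) = ?w t" for t i
  proof (induction i)
    case (Suc i)
    then show ?case using wT[of "t + real i * T"] by (simp add: algebra_simps)
  qed simp
  have sol: "is_solution h g ?w u" "\<And>t. u (t + real m * T) = u t" "\<And>t. u t \<noteq> 0"
    "\<And>n. u (of_int n * T) \<in> S (\<xi> n)"
    using u by (auto simp: itinerary_solution_def)
  have m: "m > 0" using \<xi>(2) by (simp add: seq_minimal_period_def)
  have False if q: "0 < q" "q < real m * T" "\<forall>t. u (t + q) = u t" for q
  proof -
    have wq: "?w (t + q) = ?w t" for t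
      by (rule solution_period_imp_weight_period[OF sol(1) rest sol(3) continuous_a_lm[OF a]]) (use q in simp)
    define i where "i = nat \<lfloor>q / T\<rfloor>"
    define r where "r = q - real i * T"
    have i: "real i \<le> q / T" "q / T < real i + 1"
      using q T0 floor_correct[of "q / T"] by (simp_all add: i_def)
    then have r: "0 \<le> r" "r < T"
      unfolding r_def pos_le_divide_eq[OF T0] pos_divide_less_eq[OF T0] by (simp_all add: distrib_right)
    show False
    proof (cases "r = 0")
      case False
      have "?w (t + r) = ?w t" for t
        using wTn[of "t + r" i] wq[of t] by (simp add: r_def algebra_simps)
      then show False
        using no_smaller_period[of ?w T r T1 p n] wT r False wpos wneg p n wp wn by auto
    next
      case True
      then have qi: "q = real i * T" by (simp add: r_def)
      then have "i \<noteq> 0" using q(1) by (intro notI) simp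
      then have im: "0 < i" "i < m" using q(2) qi T0 by simp_all
      have "\<xi> (n + int i) = \<xi> n" for n
      proof (rule ccontr)
        assume "\<xi> (n + int i) \<noteq> \<xi> n"
        then have "S (\<xi> (n + int i)) \<inter> S (\<xi> n) = {}" by (intro disj \<xi>)
        moreover have "u (of_int (n + int i) * T) = u (of_int n * T)"
          using q(3)[rule_format, of "of_int n * T"] by (simp add: qi distrib_right)
        ultimately show False using sol(4)[of "n + int i"] sol(4)[of n] by auto
      qed
      then show False using \<xi>(2) im unfolding seq_minimal_period_def by blast
    qed
  qed
  then show ?thesis unfolding minimal_period_def using m T0 sol(2) by (metis mult_pos_pos of_nat_0_less_iff)
qed

theorem theorem5p2:
  fixes h g a :: "real \<Rightarrow> real" and T T1 :: real and m :: nat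
  assumes lip_h: "loc_lipschitz h" and lip_g: "loc_lipschitz g"
    and C0h: "cond_C0 h" and C0g: "cond_C0 g"
    and bnd: "bounded (h ` {..0}) \<or> bounded (h ` {0..}) \<or> bounded (g ` {..0}) \<or> bounded (g ` {0..})"
    and cont_a: "continuous_on UNIV a"
    and T_pos: "T > 0" and per_a: "\<forall>t. a (t + T) = a t"
    and sign_change: "(\<exists>t. a t > 0) \<and> (\<exists>t. a t < 0)"
    and T1: "0 < T1" "T1 < T"
    and a_pos: "succ0_on a {0..T1}" and a_neg: "prec0_on a {T1..T}"
    and m: "m \<ge> 2"
  shows "\<forall>k::nat. k \<ge> 1 \<longrightarrow>
    (\<exists>\<Lambda>>0. \<forall>lam>\<Lambda>. \<exists>\<mu>s>0. \<forall>\<mu>>\<mu>s.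
      (\<exists>S1 S2 :: nat \<Rightarrow> (real \<times> real) set.
        (\<forall>j\<in>{1..2*k}. S1 j \<noteq> {} \<and> compact (S1 j) \<and> S1 j \<subseteq> quad1
                       \<and> S2 j \<noteq> {} \<and> compact (S2 j) \<and> S2 j \<subseteq> quad3) \<and>
        (\<forall>i\<in>{1..2*k}. \<forall>j\<in>{1..2*k}. i \<noteq> j \<longrightarrow> S1 i \<inter> S1 j = {} \<and> S2 i \<inter> S2 j = {}) \<and>
        (\<forall>\<xi> :: int \<Rightarrow> nat. (\<forall>n. \<xi> n \<in> {1..2*k}) \<and> seq_minimal_period \<xi> m \<longrightarrow>
          (\<exists>u1 u2.
             is_solution h g (a_lm a lam \<mu>) u1 \<and> is_solution h g (a_lm a lam \<mu>) u2 \<and>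
             minimal_period u1 (real m * T) \<and> minimal_period u2 (real m * T) \<and>
             \<not> same_periodicity_class T m u1 u2 \<and>
             (\<forall>n::int. u1 (real_of_int n * T) \<in> S1 (\<xi> n) \<and> u2 (real_of_int n * T) \<in> S2 (\<xi> n))))))"
proof (intro allI impI)
  fix k :: nat
  let ?G = "\<lambda>lam \<mu>. \<exists>S1 S2 :: nat \<Rightarrow> (real \<times> real) set.
        (\<forall>j\<in>{1..2*k}. S1 j \<noteq> {} \<and> compact (S1 j) \<and> S1 j \<subseteq> quad1
                       \<and> S2 j \<noteq> {} \<and> compact (S2 j) \<and> S2 j \<subseteq> quad3) \<and>
        (\<forall>i\<in>{1..2*k}. \<forall>j\<in>{1..2*k}. i \<noteq> j \<longrightarrow> S1 i \<inter> S1 j = {} \<and> S2 i \<inter> S2 j = {}) \<and>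
        (\<forall>\<xi> :: int \<Rightarrow> nat. (\<forall>n. \<xi> n \<in> {1..2*k}) \<and> seq_minimal_period \<xi> m \<longrightarrow>
          (\<exists>u1 u2.
             is_solution h g (a_lm a lam \<mu>) u1 \<and> is_solution h g (a_lm a lam \<mu>) u2 \<and>
             minimal_period u1 (real m * T) \<and> minimal_period u2 (real m * T) \<and>
             \<not> same_periodicity_class T m u1 u2 \<and>
             (\<forall>n::int. u1 (real_of_int n * T) \<in> S1 (\<xi> n) \<and> u2 (real_of_int n * T) \<in> S2 (\<xi> n))))"
  have rest: "restoring h" "restoring g" using C0h C0g by (auto intro: cond_C0_restoring)
  obtain \<eta>1 \<epsilon>1 where h0: "0 < \<eta>1" "0 < \<epsilon>1" "\<And>v. \<bar>v\<bar> \<le> \<epsilon>1 \<Longrightarrow> \<eta>1 * v\<^sup>2 \<le> v * h v"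
    by (rule cond_C0_slope[OF C0h]) blast
  obtain \<eta>2 \<epsilon>2 where g0: "0 < \<eta>2" "0 < \<epsilon>2" "\<And>v. \<bar>v\<bar> \<le> \<epsilon>2 \<Longrightarrow> \<eta>2 * v\<^sup>2 \<le> v * g v"
    by (rule cond_C0_slope[OF C0g]) blast
  define \<eta> where "\<eta> = min \<eta>1 \<eta>2"
  define \<epsilon> where "\<epsilon> = min \<epsilon>1 \<epsilon>2"
  have le: "\<eta> * v\<^sup>2 \<le> \<eta>1 * v\<^sup>2" "\<eta> * v\<^sup>2 \<le> \<eta>2 * v\<^sup>2" for v :: real
    by (auto simp: \<eta>_def intro: mult_right_mono)
  have slope: "0 < \<eta>" "0 < \<epsilon>" "\<And>v. \<bar>v\<bar> \<le> \<epsilon> \<Longrightarrow> \<eta> * v\<^sup>2 \<le> v * h v" "\<And>v. \<bar>v\<bar> \<le> \<epsilon> \<Longrightarrow> \<eta> * v\<^sup>2 \<le> v * g v"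
    using h0(1,2) g0(1,2) by (auto simp: \<eta>_def \<epsilon>_def intro!: order_trans[OF le(1)[unfolded \<eta>_def] h0(3)]
        order_trans[OF le(2)[unfolded \<eta>_def] g0(3)])
  note args = lip_h lip_g rest slope bnd cont_a T1 per_a a_pos a_neg
  obtain \<Lambda>1 where \<Lambda>1: "\<Lambda>1 > 0" "\<And>lam. \<Lambda>1 < lam \<Longrightarrow>
      \<exists>\<mu>s>0. \<forall>\<mu>>\<mu>s. \<exists>S. symbolic_family h g (a_lm a lam \<mu>) T (2 * k) quad1 S"
    using exists_quad1_family[OF args] by blast
  obtain \<Lambda>3 where \<Lambda>3: "\<Lambda>3 > 0" "\<And>lam. \<Lambda>3 < lam \<Longrightarrow>
      \<exists>\<mu>s>0. \<forall>\<mu>>\<mu>s. \<exists>S. symbolic_family h g (a_lm a lam \<mu>) T (2 * k) quad3 S"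
    using exists_quad3_family[OF args] by blast
  show "\<exists>\<Lambda>>0. \<forall>lam>\<Lambda>. \<exists>\<mu>s>0. \<forall>\<mu>>\<mu>s. ?G lam \<mu>"
  proof (rule exI[of _ "max \<Lambda>1 \<Lambda>3"], intro conjI allI impI)
    show "0 < max \<Lambda>1 \<Lambda>3" using \<Lambda>1 by simp
    fix lam assume lam: "max \<Lambda>1 \<Lambda>3 < lam"
    obtain \<mu>1 where \<mu>1: "\<mu>1 > 0" "\<And>\<mu>. \<mu>1 < \<mu> \<Longrightarrow> \<exists>S. symbolic_family h g (a_lm a lam \<mu>) T (2 * k) quad1 S"
      using \<Lambda>1(2)[of lam] lam by auto
    obtain \<mu>3 where \<mu>3: "\<mu>3 > 0" "\<And>\<mu>. \<mu>3 < \<mu> \<Longrightarrow> \<exists>S. symbolic_family h g (a_lm a lam \<mu>) T (2 * k) quad3 S"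
      using \<Lambda>3(2)[of lam] lam by auto
    have main: "?G lam \<mu>" if \<mu>: "max \<mu>1 \<mu>3 < \<mu>" for \<mu>
    proof -
      let ?w = "a_lm a lam \<mu>"
      have pos: "0 < lam" "0 < \<mu>" using lam \<mu> \<Lambda>1(1) \<mu>1(1) by auto
      obtain S1 where S1: "symbolic_family h g ?w T (2 * k) quad1 S1" using \<mu>1(2)[of \<mu>] \<mu> by auto
      obtain S2 where S2: "symbolic_family h g ?w T (2 * k) quad3 S2" using \<mu>3(2)[of \<mu>] \<mu> by auto
      have sets: "\<forall>j\<in>{1..2*k}. S1 j \<noteq> {} \<and> compact (S1 j) \<and> S1 j \<subseteq> quad1 \<and>
          S2 j \<noteq> {} \<and> compact (S2 j) \<and> S2 j \<subseteq> quad3"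
        "\<forall>i\<in>{1..2*k}. \<forall>j\<in>{1..2*k}. i \<noteq> j \<longrightarrow> S1 i \<inter> S1 j = {} \<and> S2 i \<inter> S2 j = {}"
        using symbolic_family_sets[OF S1] symbolic_family_sets[OF S2]
          symbolic_family_disjoint[OF S1] symbolic_family_disjoint[OF S2] by simp_all
      have orbit: "\<exists>u. itinerary_solution h g ?w T m S \<xi> u \<and> minimal_period u (real m * T)"
        if S: "symbolic_family h g ?w T (2 * k) Q S" and \<xi>: "\<forall>n. \<xi> n \<in> {1..2*k}" "seq_minimal_period \<xi> m" for S Q \<xi>
      proof -
        have "m > 0" "\<forall>n. \<xi> (n + int m) = \<xi> n" using \<xi>(2) by (auto simp: seq_minimal_period_def)
        then obtain u where u: "itinerary_solution h g ?w T m S \<xi> u"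
          using symbolic_family_itinerary[OF S _ \<xi>(1)] by blast
        have "minimal_period u (real m * T)"
        proof (rule itinerary_minimal_period[OF u _ _ \<xi>(2) rest pos cont_a T1 per_a a_pos a_neg])
          show "S i \<inter> S j = {}" if "i \<in> {1..2*k}" "j \<in> {1..2*k}" "i \<noteq> j" for i j
            by (rule symbolic_family_disjoint[OF S that])
        qed (use \<xi>(1) in blast)
        with u show ?thesis by blast
      qed
      have pair: "\<exists>u1 u2. is_solution h g ?w u1 \<and> is_solution h g ?w u2 \<and>
             minimal_period u1 (real m * T) \<and> minimal_period u2 (real m * T) \<and>
             \<not> same_periodicity_class T m u1 u2 \<and>
             (\<forall>n::int. u1 (real_of_int n * T) \<in> S1 (\<xi> n) \<and> u2 (real_of_int n * T) \<in> S2 (\<xi> n))"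
        if \<xi>: "\<forall>n. \<xi> n \<in> {1..2*k}" "seq_minimal_period \<xi> m" for \<xi>
      proof -
        obtain u1 where u1: "itinerary_solution h g ?w T m S1 \<xi> u1" "minimal_period u1 (real m * T)"
          using orbit[OF S1 \<xi>] by blast
        obtain u2 where u2: "itinerary_solution h g ?w T m S2 \<xi> u2" "minimal_period u2 (real m * T)"
          using orbit[OF S2 \<xi>] by blast
        have in1: "u1 (real_of_int n * T) \<in> S1 (\<xi> n)" and in2: "u2 (real_of_int n * T) \<in> S2 (\<xi> n)" for n
          using u1(1) u2(1) by (auto simp: itinerary_solution_def)
        have "\<not> same_periodicity_class T m u1 u2"
        proof
          assume "same_periodicity_class T m u1 u2"
          then obtain i where "\<And>t. u2 t = u1 (t - real i * T)" unfolding same_periodicity_class_def by blast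
          \<comment> \<open>At time \<open>i * T\<close> the second orbit would sit where the first
            one is at time 0, in the third and in the first quadrant at once.\<close>
          then have "u2 (real_of_int (int i) * T) = u1 (real_of_int 0 * T)" by simp
          moreover have "u2 (real_of_int (int i) * T) \<in> quad3" using in2[of "int i"] sets(1) \<xi>(1) by blast
          moreover have "u1 (real_of_int 0 * T) \<in> quad1" using in1[of 0] sets(1) \<xi>(1) by blast
          ultimately show False by (auto simp: quad1_def quad3_def)
        qed
        then show ?thesis
          using u1 u2 in1 in2 unfolding itinerary_solution_def by blast
      qed
      show ?thesis
        by (rule exI[of _ S1], rule exI[of _ S2], intro conjI sets allI impI, elim conjE, rule pair)
    qed
    have pos: "0 < max \<mu>1 \<mu>3" using \<mu>1 by simp
    show "\<exists>\<mu>s>0. \<forall>\<mu>>\<mu>s. ?G lam \<mu>"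
      by (rule exI[of _ "max \<mu>1 \<mu>3"]) (intro conjI allI impI pos main)
  qed
qed

end
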